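(* Fix an integer $d\geq 2$. Let $(N_n)_{n\geq 1}$ be a sequence of positive integers with $N_n\to\infty$ and, for each $n\geq 1$, let $\{a_n(i_1,\ldots,i_d)\}_{1\leq i_1,\ldots,i_d\leq N_n}$ be real numbers that are symmetric in the indices and vanish on diagonals (that is, $a_n(i_1,\ldots,i_d)=0$ whenever $i_j=i_k$ for some $j\neq k$). Let $Q_n:\mathbb{R}^{N_n}\to\mathbb{R}$ be the homogeneous polynomial $$Q_n(x_1,\ldots,x_{N_n})=\sum_{i_1,\ldots,i_d=1}^{N_n} a_n(i_1,\ldots,i_d)\,x_{i_1}\cdots x_{i_d}.$$ Assume that $$d!\sum_{i_1,\ldots,i_d=1}^{N_n} a_n(i_1,\ldots,i_d)^2=1\quad\text{for all } n\geq 1,$$ and that $$\lim_{n\to\infty}\ \max_{1\leq i_1\leq N_n}\ \sum_{i_2,\ldots,i_d=1}^{N_n} a_n(i_1,\ldots,i_d)^2=0.$$ Let $\mathbf{X}=(X_1,X_2,\ldots)$ belong to $\mathcal{D}(\alpha,p,2+\epsilon)$ for some $\epsilon>0$, $\alpha>0$ and $p\in(0,1]$, and write $Q_n(\mathbf{X})=Q_n(X_1,\ldots,X_{N_n})$. If $Q_n(\mathbf{X})$ converges in law, as $n\to\infty$, to a real random variable $W$, then the law of $W$ has a density with respect to Lebesgue measure and $Q_n(\mathbf{X})$ converges to $W$ in total variation, i.e. $\lim_{n\to\infty}d_{TV}(Q_n(\mathbf{X}),W)=0$.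
   Context: Total variation distance: for real random variables $U,V$, $d_{TV}(U,V)=\sup_{A\in\mathcal{B}(\mathbb{R})}|P(U\in A)-P(V\in A)|$, where $\mathcal{B}(\mathbb{R})$ is the Borel $\sigma$-field. Class $\mathcal{C}(p,\alpha)$: for $p\in(0,1]$ and $\alpha>0$, $\mathcal{C}(p,\alpha)$ is the set of real random variables $X$ that have the same law as $\varepsilon(\alpha U+x_0)+(1-\varepsilon)V$, where $x_0\in\mathbb{R}$ is some real number and $U,\varepsilon,V$ are three independent random variables such that $U$ is uniformly distributed on $[-1,1]$, $\varepsilon$ is Bernoulli with $P(\varepsilon=1)=p=1-P(\varepsilon=0)$, and $V$ is a real random variable with arbitrary distribution. Class $\mathcal{D}(\alpha,p,2+\epsilon)$: for $\alpha>0$, $p\in(0,1]$, $\epsilon>0$, a sequence $\mathbf{X}=(X_1,X_2,\ldots)$ of real random variables belongs to $\mathcal{D}(\alpha,p,2+\epsilon)$ if the $X_i$ are independent, $\sup_i E|X_i|^{2+\epsilon}<\infty$, and, for each $i$, $E[X_i]=0$, $E[X_i^2]=1$ and $X_i\in\mathcal{C}(p,\alpha)$ (same $p$ and $\alpha$ for all $i$; $x_0$ and the law of $V$ may depend on $i$). *)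

theory Defs
  imports "HOL-Probability.Probability" "HOL-Combinatorics.Combinatorics"
begin

definition index_tuples :: "nat \<Rightarrow> nat \<Rightarrow> nat list set" where
  "index_tuples d N = {ii. length ii = d \<and> set ii \<subseteq> {1..N}}"

text \<open>A coefficient array \<open>a(i\<^sub>1,\<dots>,i\<^sub>d)\<close> is a function on lists; only its values on
  \<^term>\<open>index_tuples d N\<close> matter.\<close>

definition symmetric_coeffs :: "nat \<Rightarrow> nat \<Rightarrow> (nat list \<Rightarrow> real) \<Rightarrow> bool" where
  "symmetric_coeffs d N a \<longleftrightarrow>
    (\<forall>ii\<in>index_tuples d N. \<forall>\<sigma>. \<sigma> permutes {..<d} \<longrightarrow> a (permute_list \<sigma> ii) = a ii)"

definition vanishes_on_diagonals :: "nat \<Rightarrow> nat \<Rightarrow> (nat list \<Rightarrow> real) \<Rightarrow> bool" where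
  "vanishes_on_diagonals d N a \<longleftrightarrow>
    (\<forall>ii\<in>index_tuples d N. (\<exists>j<d. \<exists>k<d. j \<noteq> k \<and> ii ! j = ii ! k) \<longrightarrow> a ii = 0)"

definition hom_poly :: "nat \<Rightarrow> nat \<Rightarrow> (nat list \<Rightarrow> real) \<Rightarrow> (nat \<Rightarrow> real) \<Rightarrow> real" where
  "hom_poly d N a x = (\<Sum>ii\<in>index_tuples d N. a ii * prod_list (map x ii))"

definition tv_dist :: "'a measure \<Rightarrow> ('a \<Rightarrow> real) \<Rightarrow> 'b measure \<Rightarrow> ('b \<Rightarrow> real) \<Rightarrow> real" where
  "tv_dist M U M' V =
    (SUP A\<in>sets (borel :: real measure).
      \<bar>measure M (U -` A \<inter> space M) - measure M' (V -` A \<inter> space M')\<bar>)"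

text \<open>The auxiliary variables \<open>U, \<epsilon>, V\<close> need not live on \<open>M\<close>. HOL cannot quantify over the type of
  their sample space; taking its elements to be triples of reals loses no generality, since only the
  joint law of \<open>(U, \<epsilon>, V)\<close> on \<open>\<real>\<^sup>3\<close> enters.\<close>

definition class_C :: "'a measure \<Rightarrow> real \<Rightarrow> real \<Rightarrow> ('a \<Rightarrow> real) \<Rightarrow> bool" where
  "class_C M p \<alpha> X \<longleftrightarrow> 0 < p \<and> p \<le> 1 \<and> 0 < \<alpha> \<and> X \<in> borel_measurable M \<and>
    (\<exists>x0 (P :: (real \<times> real \<times> real) measure) U \<epsilon> V.
      prob_space P \<and>
      prob_space.indep_vars P (\<lambda>_. borel) (\<lambda>k. [U, \<epsilon>, V] ! k) {..<3} \<and>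
      distr P borel U = uniform_measure lborel {-1..1} \<and>
      measure P {\<omega> \<in> space P. \<epsilon> \<omega> = 1} = p \<and>
      measure P {\<omega> \<in> space P. \<epsilon> \<omega> = 0} = 1 - p \<and>
      distr M borel X = distr P borel (\<lambda>\<omega>. \<epsilon> \<omega> * (\<alpha> * U \<omega> + x0) + (1 - \<epsilon> \<omega>) * V \<omega>))"

text \<open>The sequence is \<open>X\<^sub>1, X\<^sub>2, \<dots>\<close>; \<open>X 0\<close> is unused. The moment is taken in \<^typ>\<open>ennreal\<close>, so that
  its finiteness is a genuine requirement. The last argument is the full exponent \<open>2 + \<epsilon>\<close>.\<close>

definition class_D :: "'a measure \<Rightarrow> (nat \<Rightarrow> 'a \<Rightarrow> real) \<Rightarrow> real \<Rightarrow> real \<Rightarrow> real \<Rightarrow> bool" where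
  "class_D M X \<alpha> p r \<longleftrightarrow>
    prob_space.indep_vars M (\<lambda>_. borel) X {1..} \<and>
    (SUP i\<in>{1..}. \<integral>\<^sup>+ \<omega>. ennreal (\<bar>X i \<omega>\<bar> powr r) \<partial>M) < \<infinity> \<and>
    (\<forall>i\<ge>1. integral\<^sup>L M (X i) = 0 \<and> (\<integral>\<omega>. (X i \<omega>)\<^sup>2 \<partial>M) = 1 \<and> class_C M p \<alpha> (X i))"

end

theory Submission
  imports Defs "HOL-Complex_Analysis.Cauchy_Integral_Formula"
    "HOL-Computational_Algebra.Fundamental_Theorem_Algebra"
begin

text \<open>Attach to every \<open>X i\<close> a random curve \<open>t \<mapsto> X i t\<close> whose law at each time is that of \<open>X i\<close>:
  pair \<open>U\<close> with an independent copy and rotate the pair when it lies in the unit disc, which preserves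
  the uniform law of the square. Along these curves the homogeneous sum is a trigonometric polynomial
  in \<open>t\<close> of bounded degree. The law of \<open>Q\<^sub>n(X)\<close> is thus a mixture of image measures of the uniform law
  on the circle under such polynomials, and a trigonometric polynomial of bounded degree whose
  oscillation is bounded below has a law that moves little in total variation under small shifts.

  The oscillation is small with small probability only: the disc is cut into \<open>m\<close> annuli with
  different frequencies and random orientations, chosen such that at suitable times exactly one
  annulus has moved. The \<open>m\<close> increments are independent given the positions, each is a
  polynomial in random signs, and hypercontractivity bounds the probability that it is small by
  some \<open>\<rho> < 1\<close> depending on \<open>d\<close> only; low influences make its conditional variance concentrate.

  Hence shifts by small amounts are negligible in total variation, uniformly in large \<open>n\<close>, and this
  improves weak convergence to convergence in total variation and gives the limit a density.\<close>

section \<open>Walsh expansions and hypercontractivity\<close>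

text \<open>The shape is dictated by hypercontractivity: it makes one increment large only with
  probability at least \<open>1 / (4 * 9 ^ d)\<close>. With a single rotating disc the remaining
  probability would persist as an error that no small shift removes. Given positions with no
  degenerate conditional variance, increment j depends on the orientations in annulus j alone, so
  all m increments are small together with probability at most \<open>\<rho> ^ m\<close>. The
  analysis on the circle has a single time variable, so the annuli must be told apart by their
  frequencies.

  No orientation pattern changes the law of the chaos at any time. The orientations are therefore
  averaged outside, as a finite sum, and are not part of the sample space. Anticoncentration is read
  off from the Walsh coefficients of top degree, which the parts of the coordinates that do not
  depend on the signs cannot cancel.

  Order of choices: the error e fixes m; then come the frequencies, the degree, the variance bound
  \<open>s0\<close> and the shift size h; last, n is taken large to make the influences small
  against constants that depend on m.\<close>

definition sg :: "nat set \<Rightarrow> nat \<Rightarrow> real" where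
  "sg D i = (if i \<in> D then -1 else 1)"

text \<open>A point of the sign cube is encoded by the set \<open>D\<close> of its negative
  coordinates, so that an average over random signs is a sum over \<open>Pow V\<close>.\<close>

definition walsh :: "nat set \<Rightarrow> (nat set \<Rightarrow> real) \<Rightarrow> nat set \<Rightarrow> real" where
  "walsh V g D = (\<Sum>T\<in>Pow V. g T * (\<Prod>i\<in>T. sg D i))"

lemma sum_Pow_insert:
  fixes f :: "'b set \<Rightarrow> 'a :: comm_monoid_add"
  assumes "finite V" "x \<notin> V"
  shows "(\<Sum>T\<in>Pow (insert x V). f T) = (\<Sum>T\<in>Pow V. f T) + (\<Sum>T\<in>Pow V. f (insert x T))"
proof -
  have "inj_on (insert x) (Pow V)"
    using assms(2) unfolding inj_on_def by (metis PowD insert_ident subset_iff)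
  moreover have "Pow V \<inter> insert x ` Pow V = {}" using assms(2) by auto
  ultimately show ?thesis
    using assms by (simp add: Pow_insert sum.union_disjoint sum.reindex)
qed

text \<open>With y the new sign, the function is h + y k where h and k do not involve y; these are
  its values at y = 1 and y = -1. Both inductions below rest on this.\<close>

lemma walsh_insert:
  assumes "finite V" "x \<notin> V" "D \<subseteq> V"
  shows "walsh (insert x V) g D = walsh V g D + walsh V (\<lambda>T. g (insert x T)) D"
    and "walsh (insert x V) g (insert x D) = walsh V g D - walsh V (\<lambda>T. g (insert x T)) D"
proof -
  have ins: "(\<Prod>i\<in>insert x T. sg E i) = sg E x * (\<Prod>i\<in>T. sg E i)" if "T \<in> Pow V" for T E
    using that assms finite_subset by (subst prod.insert) auto
  have cong: "(\<Prod>i\<in>T. sg (insert x D) i) = (\<Prod>i\<in>T. sg D i)" if "T \<in> Pow V" for T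
    using that assms by (intro prod.cong) (auto simp: sg_def)
  have "sg D x = 1" "sg (insert x D) x = -1" using assms by (auto simp: sg_def)
  then show "walsh (insert x V) g D = walsh V g D + walsh V (\<lambda>T. g (insert x T)) D"
    and "walsh (insert x V) g (insert x D) = walsh V g D - walsh V (\<lambda>T. g (insert x T)) D"
    using assms by (simp_all add: walsh_def sum_Pow_insert ins cong sum_negf cong: sum.cong_simp)
qed

lemma parseval:
  assumes "finite V"
  shows "(\<Sum>D\<in>Pow V. (walsh V g D)\<^sup>2) = 2 ^ card V * (\<Sum>T\<in>Pow V. (g T)\<^sup>2)"
  using assms
proof (induction V arbitrary: g rule: finite_induct)
  case empty
  then show ?case by (simp add: walsh_def)
next
  case (insert x V)
  let ?h = "walsh V g" and ?k = "walsh V (\<lambda>T. g (insert x T))"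
  have "(\<Sum>D\<in>Pow (insert x V). (walsh (insert x V) g D)\<^sup>2)
      = (\<Sum>D\<in>Pow V. (?h D + ?k D)\<^sup>2) + (\<Sum>D\<in>Pow V. (?h D - ?k D)\<^sup>2)"
    using insert.hyps by (simp add: sum_Pow_insert walsh_insert cong: sum.cong_simp)
  also have "\<dots> = (\<Sum>D\<in>Pow V. 2 * (?h D)\<^sup>2 + 2 * (?k D)\<^sup>2)"
    by (simp add: sum.distrib[symmetric] power2_sum power2_diff)
  also have "\<dots> = 2 ^ card (insert x V) * (\<Sum>T\<in>Pow (insert x V). (g T)\<^sup>2)"
    using insert.hyps
    by (simp add: sum.distrib sum_distrib_left[symmetric] insert.IH sum_Pow_insert algebra_simps)
  finally show ?case .
qed

text \<open>Bonami's hypercontractive inequality between the second and fourth moments, not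
  normalised. In the fourth power of h + y k the odd powers of y cancel, k has degree one less, and
  Cauchy-Schwarz controls the mixed term.\<close>

lemma bonami:
  assumes "finite V" "\<And>T. T \<subseteq> V \<Longrightarrow> card T > d \<Longrightarrow> g T = 0"
  shows "(\<Sum>D\<in>Pow V. walsh V g D ^ 4) \<le> 9 ^ d * 2 ^ card V * (\<Sum>T\<in>Pow V. (g T)\<^sup>2)\<^sup>2"
  using assms
proof (induction V arbitrary: g d rule: finite_induct)
  case empty
  have "1 * (g {})^4 \<le> 9 ^ d * (g {})^4"
    by (intro mult_right_mono) auto
  then show ?case by (simp add: walsh_def)
next
  case (insert x V)
  let ?h = "walsh V g" and ?k' = "\<lambda>T. g (insert x T)"
  let ?k = "walsh V ?k'"
  define H K where "H = (\<Sum>T\<in>Pow V. (g T)\<^sup>2)" and "K = (\<Sum>T\<in>Pow V. (?k' T)\<^sup>2)"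
  have HK: "H \<ge> 0" "K \<ge> 0" by (auto simp: H_def K_def sum_nonneg)
  have card_ins: "card (insert x T) = Suc (card T)" if "T \<subseteq> V" for T
    using that insert.hyps finite_subset by (subst card_insert_disjoint) auto
  have tot: "(\<Sum>T\<in>Pow (insert x V). (g T)\<^sup>2) = H + K"
    using insert.hyps by (simp add: sum_Pow_insert H_def K_def)
  have H4: "(\<Sum>D\<in>Pow V. ?h D ^ 4) \<le> 9 ^ d * 2 ^ card V * H\<^sup>2"
    unfolding H_def by (rule insert.IH) (use insert.prems in auto)
  have split4: "(\<Sum>D\<in>Pow (insert x V). (walsh (insert x V) g D) ^ 4)
      = 2 * (\<Sum>D\<in>Pow V. ?h D ^ 4) + 12 * (\<Sum>D\<in>Pow V. (?h D)\<^sup>2 * (?k D)\<^sup>2) + 2 * (\<Sum>D\<in>Pow V. ?k D ^ 4)"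
  proof -
    have "(\<Sum>D\<in>Pow (insert x V). (walsh (insert x V) g D) ^ 4)
      = (\<Sum>D\<in>Pow V. (?h D + ?k D) ^ 4) + (\<Sum>D\<in>Pow V. (?h D - ?k D) ^ 4)"
      using insert.hyps by (simp add: sum_Pow_insert walsh_insert cong: sum.cong_simp)
    also have "\<dots> = (\<Sum>D\<in>Pow V. 2 * ?h D ^ 4 + 12 * ((?h D)\<^sup>2 * (?k D)\<^sup>2) + 2 * ?k D ^ 4)"
      unfolding sum.distrib[symmetric]
      by (intro sum.cong refl) (simp add: power4_eq_xxxx power2_eq_square algebra_simps)
    finally show ?thesis by (simp add: sum.distrib sum_distrib_left)
  qed
  show ?case
  proof (cases d)
    \<comment> \<open>Degree 0 is separate because the degree bound for k would be d - 1; here k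
      vanishes.\<close>
    case 0
    have "?k' T = 0" if "T \<subseteq> V" for T
      using insert.prems[of "insert x T"] that 0 card_ins[OF that] by auto
    then have "?k D = 0" "K = 0" for D by (auto simp: walsh_def K_def)
    then show ?thesis unfolding split4 tot
      using H4 insert.hyps 0 by simp
  next
    case (Suc e)
    have K4: "(\<Sum>D\<in>Pow V. ?k D ^ 4) \<le> 9 ^ e * 2 ^ card V * K\<^sup>2"
      unfolding K_def
    proof (rule insert.IH)
      show "?k' T = 0" if "T \<subseteq> V" "card T > e" for T
        using insert.prems[of "insert x T"] card_ins[of T] that Suc by auto
    qed
    have "(\<Sum>D\<in>Pow V. (?h D)\<^sup>2 * (?k D)\<^sup>2)\<^sup>2 \<le> (\<Sum>D\<in>Pow V. ((?h D)\<^sup>2)\<^sup>2) * (\<Sum>D\<in>Pow V. ((?k D)\<^sup>2)\<^sup>2)"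
      by (rule Cauchy_Schwarz_ineq_sum)
    also have "\<dots> = (\<Sum>D\<in>Pow V. ?h D ^ 4) * (\<Sum>D\<in>Pow V. ?k D ^ 4)"
      by simp
    also have "\<dots> \<le> (9 ^ d * 2 ^ card V * H\<^sup>2) * (9 ^ e * 2 ^ card V * K\<^sup>2)"
      using H4 K4 HK by (intro mult_mono) (auto intro!: sum_nonneg)
    also have "\<dots> = (3 * 9 ^ e * 2 ^ card V * H * K)\<^sup>2"
      by (simp add: Suc power2_eq_square)
    finally have "(\<Sum>D\<in>Pow V. (?h D)\<^sup>2 * (?k D)\<^sup>2) \<le> 3 * 9 ^ e * 2 ^ card V * H * K"
      by (rule power2_le_imp_le) (use HK in auto)
    then have "(\<Sum>D\<in>Pow (insert x V). (walsh (insert x V) g D) ^ 4)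
      \<le> 2 * (9 ^ d * 2 ^ card V * H\<^sup>2) + 12 * (3 * 9 ^ e * 2 ^ card V * H * K) + 2 * (9 ^ e * 2 ^ card V * K\<^sup>2)"
      unfolding split4 using H4 K4 by linarith
    also have "\<dots> \<le> 9 ^ d * 2 ^ card (insert x V) * (H + K)\<^sup>2"
    proof -
      \<comment> \<open>The H^2 and HK terms agree exactly, which is what forces the constant 9; all
        the slack is in K^2.\<close>
      have "9 ^ d * 2 ^ card (insert x V) * (H + K)\<^sup>2 -
          (2 * (9 ^ d * 2 ^ card V * H\<^sup>2) + 12 * (3 * 9 ^ e * 2 ^ card V * H * K) + 2 * (9 ^ e * 2 ^ card V * K\<^sup>2))
          = 16 * 9 ^ e * 2 ^ card V * K\<^sup>2"
        using insert.hyps by (simp add: Suc power2_eq_square algebra_simps)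
      moreover have "\<dots> \<ge> 0" by simp
      ultimately show ?thesis by linarith
    qed
    finally show ?thesis unfolding tot .
  qed
qed

text \<open>Paley-Zygmund: the set where the square exceeds half its mean carries at least half the
  second moment, and by Cauchy-Schwarz and \<open>bonami\<close> a small set cannot. Only a lower
  bound \<open>S\<close> on the mass enters, so it suffices to know some of the
  coefficients.\<close>

lemma walsh_anticoncentration:
  assumes V: "finite V" and deg: "\<And>T. T \<subseteq> V \<Longrightarrow> card T > d \<Longrightarrow> g T = 0"
    and S: "0 < S" "S \<le> (\<Sum>T\<in>Pow V. (g T)\<^sup>2)"
  shows "real (card {D\<in>Pow V. (walsh V g D)\<^sup>2 \<le> S / 2}) \<le> (1 - 1 / (4 * 9 ^ d)) * 2 ^ card V"
proof -
  define Q where "Q = (\<Sum>T\<in>Pow V. (g T)\<^sup>2)"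
  define n :: real where "n = 2 ^ card V"
  define B where "B = {D\<in>Pow V. (walsh V g D)\<^sup>2 > Q / 2}"
  define L where "L = {D\<in>Pow V. (walsh V g D)\<^sup>2 \<le> Q / 2}"
  have Q: "Q > 0" "n > 0" using S by (auto simp: Q_def n_def)
  have fin: "finite B" "finite L" using V by (auto simp: B_def L_def)
  have un: "Pow V = B \<union> L" "B \<inter> L = {}" by (auto simp: B_def L_def)
  have cards: "real (card B) + real (card L) = n"
    using card_Un_disjoint[OF fin un(2)] un(1) card_Pow[OF V]
    by (metis n_def of_nat_add of_nat_numeral of_nat_power)
  have "n * Q = (\<Sum>D\<in>Pow V. (walsh V g D)\<^sup>2)" using parseval[OF V] by (simp add: n_def Q_def)
  also have "\<dots> = (\<Sum>D\<in>B. (walsh V g D)\<^sup>2) + (\<Sum>D\<in>L. (walsh V g D)\<^sup>2)"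
    unfolding un(1) using fin un(2) by (rule sum.union_disjoint)
  also have "(\<Sum>D\<in>L. (walsh V g D)\<^sup>2) \<le> card L * (Q / 2)"
    by (rule sum_bounded_above) (auto simp: L_def)
  also have "\<dots> \<le> n * (Q / 2)" using cards Q by (intro mult_right_mono) auto
  finally have low: "n * Q / 2 \<le> (\<Sum>D\<in>B. (walsh V g D)\<^sup>2)" by simp
  then have "(n * Q / 2)\<^sup>2 \<le> (\<Sum>D\<in>B. 1 * (walsh V g D)\<^sup>2)\<^sup>2"
    using Q by (intro power_mono) auto
  also have "\<dots> \<le> (\<Sum>D\<in>B. 1\<^sup>2) * (\<Sum>D\<in>B. ((walsh V g D)\<^sup>2)\<^sup>2)"
    by (rule Cauchy_Schwarz_ineq_sum)
  also have "\<dots> \<le> card B * (\<Sum>D\<in>Pow V. walsh V g D ^ 4)"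
    using V by (simp, intro mult_left_mono sum_mono2) (auto simp: B_def)
  also have "\<dots> \<le> card B * (9 ^ d * n * Q\<^sup>2)"
    using bonami[OF V deg] by (intro mult_left_mono) (auto simp: n_def Q_def)
  finally have "n * n * Q\<^sup>2 \<le> card B * 4 * 9 ^ d * n * Q\<^sup>2"
    by (simp add: power2_eq_square field_simps)
  then have "n * (n * Q\<^sup>2) \<le> (card B * 4 * 9 ^ d) * (n * Q\<^sup>2)" by (simp add: mult_ac)
  then have "n \<le> real (card B * 4 * 9 ^ d)"
    by (rule mult_right_le_imp_le) (use Q in auto)
  then have "n / (4 * 9 ^ d) \<le> card B" by (simp add: field_simps)
  then have "card L \<le> (1 - 1 / (4 * 9 ^ d)) * n" using cards by (simp add: algebra_simps)
  moreover have "card {D\<in>Pow V. (walsh V g D)\<^sup>2 \<le> S / 2} \<le> card L"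
    using S fin by (intro card_mono) (auto simp: L_def Q_def)
  ultimately show ?thesis unfolding n_def by linarith
qed

section \<open>Homogeneous sums as functions of random signs\<close>

definition ksets :: "nat \<Rightarrow> nat \<Rightarrow> nat set set" where
  "ksets d N = {S. S \<subseteq> {1..N} \<and> card S = d}"

text \<open>The coefficient of a squarefree monomial once the tuples that are orderings of the same
  set are collected.\<close>

definition set_coeff :: "(nat list \<Rightarrow> real) \<Rightarrow> nat set \<Rightarrow> real" where
  "set_coeff a S = (\<Sum>ii\<in>permutations_of_set S. a ii)"

lemma finite_index_tuples [simp]: "finite (index_tuples d N)"
  using finite_lists_length_eq[of "{1..N}" d] by (simp add: index_tuples_def conj_commute)

lemma finite_ksets [simp]: "finite (ksets d N)"
  by (rule finite_subset[of _ "Pow {1..N}"]) (auto simp: ksets_def)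

lemma ksetsD: "S \<in> ksets d N \<Longrightarrow> finite S \<and> S \<subseteq> {1..N} \<and> card S = d"
  by (auto simp: ksets_def intro: finite_subset)

lemma permutations_of_set_subset:
  assumes "S \<in> ksets d N"
  shows "permutations_of_set S \<subseteq> index_tuples d N"
  using assms distinct_card by (fastforce simp: permutations_of_set_def index_tuples_def ksets_def)

lemma hom_poly_eq_sum_ksets:
  assumes "vanishes_on_diagonals d N a"
  shows "hom_poly d N a x = (\<Sum>S\<in>ksets d N. set_coeff a S * (\<Prod>i\<in>S. x i))"
proof -
  let ?I = "{ii\<in>index_tuples d N. distinct ii}"
  have fib: "{ii\<in>?I. set ii = S} = permutations_of_set S" if "S \<in> ksets d N" for S
    using permutations_of_set_subset[OF that] by (auto simp: permutations_of_set_def)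
  have "hom_poly d N a x = (\<Sum>ii\<in>?I. a ii * prod_list (map x ii))"
    unfolding hom_poly_def
  proof (rule sum.mono_neutral_right)
    show "\<forall>ii\<in>index_tuples d N - ?I. a ii * prod_list (map x ii) = 0"
      using assms unfolding vanishes_on_diagonals_def index_tuples_def distinct_conv_nth by fastforce
  qed auto
  also have "\<dots> = (\<Sum>S\<in>ksets d N. \<Sum>ii\<in>{ii\<in>?I. set ii = S}. a ii * prod_list (map x ii))"
  proof (rule sum.group[symmetric])
    show "finite ?I" by (rule finite_subset[OF _ finite_index_tuples]) auto
    show "set ` ?I \<subseteq> ksets d N" by (auto simp: ksets_def index_tuples_def distinct_card)
  qed simp
  also have "\<dots> = (\<Sum>S\<in>ksets d N. set_coeff a S * (\<Prod>i\<in>S. x i))"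
  proof (rule sum.cong[OF refl])
    fix S assume S: "S \<in> ksets d N"
    have "prod_list (map x ii) = (\<Prod>i\<in>S. x i)" if "ii \<in> permutations_of_set S" for ii
      using that by (auto simp: permutations_of_set_def prod.distinct_set_conv_list)
    then show "(\<Sum>ii\<in>{ii\<in>?I. set ii = S}. a ii * prod_list (map x ii)) = set_coeff a S * (\<Prod>i\<in>S. x i)"
      unfolding fib[OF S] set_coeff_def by (simp add: sum_distrib_right)
  qed
  finally show ?thesis .
qed

lemma set_coeff_eq:
  assumes "symmetric_coeffs d N a" "S \<in> ksets d N" "ii \<in> permutations_of_set S"
  shows "set_coeff a S = fact d * a ii"
proof -
  have "a jj = a ii" if "jj \<in> permutations_of_set S" for jj
  proof -
    have "mset jj = mset ii"
      using that assms(3) by (metis permutations_of_setD set_eq_iff_mset_eq_distinct)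
    then obtain \<sigma> where "\<sigma> permutes {..<length ii}" "permute_list \<sigma> ii = jj"
      by (rule mset_eq_permutation)
    moreover have "ii \<in> index_tuples d N" using assms permutations_of_set_subset by auto
    ultimately show ?thesis using assms(1)
      by (auto simp: symmetric_coeffs_def index_tuples_def)
  qed
  then have "set_coeff a S = (\<Sum>jj\<in>permutations_of_set S. a ii)"
    unfolding set_coeff_def by (intro sum.cong) auto
  then show ?thesis using ksetsD[OF assms(2)] by simp
qed

text \<open>The \<open>fact d\<close> orderings of a set carry equal values, so the square of their
  sum is \<open>fact d\<close> times the sum of their squares. The normalisation of the theorem thus
  becomes unit mass for the squared set coefficients.\<close>

lemma sum_set_coeff_sq:
  assumes "symmetric_coeffs d N a" "vanishes_on_diagonals d N a"
  shows "(\<Sum>S\<in>ksets d N. (set_coeff a S)\<^sup>2) = fact d * (\<Sum>ii\<in>index_tuples d N. (a ii)\<^sup>2)"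
proof -
  \<comment> \<open>A sum of squares is the homogeneous polynomial of the squared array at the point
    with all coordinates 1.\<close>
  have "vanishes_on_diagonals d N (\<lambda>ii. (a ii)\<^sup>2)"
    using assms(2) by (auto simp: vanishes_on_diagonals_def)
  from hom_poly_eq_sum_ksets[OF this, of "\<lambda>_. 1"]
  have "(\<Sum>ii\<in>index_tuples d N. (a ii)\<^sup>2) = (\<Sum>S\<in>ksets d N. set_coeff (\<lambda>ii. (a ii)\<^sup>2) S)"
    by (simp add: hom_poly_def map_replicate_const)
  moreover have "(set_coeff a S)\<^sup>2 = fact d * set_coeff (\<lambda>ii. (a ii)\<^sup>2) S" if S: "S \<in> ksets d N" for S
  proof -
    obtain ii where ii: "ii \<in> permutations_of_set S"
      using ksetsD[OF S] permutations_of_set_empty_iff by blast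
    have "(a jj)\<^sup>2 = (a ii)\<^sup>2" if "jj \<in> permutations_of_set S" for jj
      using set_coeff_eq[OF assms(1) S ii] set_coeff_eq[OF assms(1) S that] by simp
    then have "set_coeff (\<lambda>ii. (a ii)\<^sup>2) S = (\<Sum>jj\<in>permutations_of_set S. (a ii)\<^sup>2)"
      unfolding set_coeff_def by (intro sum.cong) auto
    then show ?thesis
      using set_coeff_eq[OF assms(1) S ii] ksetsD[OF S] by (simp add: power2_eq_square)
  qed
  ultimately show ?thesis by (simp add: sum_distrib_left)
qed

text \<open>Each set containing \<open>i\<close> is represented by a single tuple starting with
  \<open>i\<close>. The other orderings of the tail are discarded, which costs a factor that is
  harmless since the right side will tend to 0.\<close>

lemma influence_le:
  assumes "symmetric_coeffs d N a"
  shows "(\<Sum>T\<in>{T\<in>ksets d N. i \<in> T}. (set_coeff a T)\<^sup>2)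
    \<le> (fact d)\<^sup>2 * (\<Sum>jj\<in>index_tuples (d - 1) N. (a (i # jj))\<^sup>2)"
proof -
  let ?K = "{T\<in>ksets d N. i \<in> T}"
  have "\<exists>jj. set jj = T - {i} \<and> distinct jj" if "T \<in> ?K" for T
    using that by (intro finite_distinct_list) (auto dest: ksetsD)
  then obtain l where l: "\<And>T. T \<in> ?K \<Longrightarrow> set (l T) = T - {i} \<and> distinct (l T)" by metis
  have inj: "inj_on l ?K"
    by (rule inj_onI) (metis (no_types, lifting) l insert_Diff mem_Collect_eq)
  have perm: "i # l T \<in> permutations_of_set T" if "T \<in> ?K" for T
    using l[OF that] that by (auto simp: permutations_of_set_def)
  have range: "l ` ?K \<subseteq> index_tuples (d - 1) N"
  proof
    fix jj assume "jj \<in> l ` ?K"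
    then obtain T where "T \<in> ?K" "jj = l T" by auto
    then have "i # jj \<in> index_tuples d N"
      using permutations_of_set_subset[of T d N] perm[of T] by blast
    then show "jj \<in> index_tuples (d - 1) N" by (auto simp: index_tuples_def)
  qed
  have "(\<Sum>T\<in>?K. (set_coeff a T)\<^sup>2) = (\<Sum>T\<in>?K. (fact d)\<^sup>2 * (a (i # l T))\<^sup>2)"
    using set_coeff_eq[OF assms _ perm] by (intro sum.cong) (auto simp: power_mult_distrib)
  also have "\<dots> = (fact d)\<^sup>2 * (\<Sum>jj\<in>l ` ?K. (a (i # jj))\<^sup>2)"
    using inj by (simp add: sum.reindex sum_distrib_left)
  also have "\<dots> \<le> (fact d)\<^sup>2 * (\<Sum>jj\<in>index_tuples (d - 1) N. (a (i # jj))\<^sup>2)"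
    using range by (intro mult_left_mono sum_mono2) auto
  finally show ?thesis .
qed

text \<open>As a function of the signs, the polynomial has Walsh coefficient
  \<open>set_coeff a T * (\<Prod>i\<in>T. v i)\<close> at every \<open>T\<close> of top degree.\<close>

lemma hom_poly_sign_anticoncentration:
  assumes "vanishes_on_diagonals d N a" "d \<ge> 1"
    and S: "0 < s" "s \<le> (\<Sum>S\<in>ksets d N. (set_coeff a S)\<^sup>2 * (\<Prod>i\<in>S. (v i)\<^sup>2))"
  shows "real (card {D\<in>Pow {1..N}. (hom_poly d N a (\<lambda>i. u i + v i * sg D i) - b)\<^sup>2 \<le> s / 2})
    \<le> (1 - 1 / (4 * 9 ^ d)) * 2 ^ N"
proof -
  \<comment> \<open>Expand each product by the set \<open>T\<close> of factors that contribute their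
    sign term; \<open>b\<close> only changes the constant coefficient.\<close>
  define g where "g T = (\<Sum>S\<in>{S\<in>ksets d N. T \<subseteq> S}. set_coeff a S * (\<Prod>i\<in>T. v i) * (\<Prod>i\<in>S-T. u i))
      - (if T = {} then b else 0)" for T
  have W: "walsh {1..N} g D = hom_poly d N a (\<lambda>i. u i + v i * sg D i) - b" for D
  proof -
    have "hom_poly d N a (\<lambda>i. u i + v i * sg D i)
      = (\<Sum>S\<in>ksets d N. \<Sum>T\<in>Pow S. set_coeff a S * ((\<Prod>i\<in>T. v i * sg D i) * (\<Prod>i\<in>S-T. u i)))"
      unfolding hom_poly_eq_sum_ksets[OF assms(1)]
    proof (rule sum.cong[OF refl])
      fix S assume "S \<in> ksets d N"
      then have "finite S" using ksetsD by auto
      then have "(\<Prod>i\<in>S. v i * sg D i + u i) = (\<Sum>T\<in>Pow S. (\<Prod>i\<in>T. v i * sg D i) * (\<Prod>i\<in>S-T. u i))"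
        by (rule prod_add)
      then show "set_coeff a S * (\<Prod>i\<in>S. u i + v i * sg D i)
        = (\<Sum>T\<in>Pow S. set_coeff a S * ((\<Prod>i\<in>T. v i * sg D i) * (\<Prod>i\<in>S-T. u i)))"
        by (simp add: add.commute sum_distrib_left)
    qed
    also have "\<dots> = (\<Sum>S\<in>ksets d N. \<Sum>T\<in>{T\<in>Pow {1..N}. T \<subseteq> S}.
        set_coeff a S * ((\<Prod>i\<in>T. v i * sg D i) * (\<Prod>i\<in>S-T. u i)))"
      using ksetsD by (intro sum.cong) blast+
    also have "\<dots> = (\<Sum>T\<in>Pow {1..N}. \<Sum>S\<in>{S\<in>ksets d N. T \<subseteq> S}.
        set_coeff a S * ((\<Prod>i\<in>T. v i * sg D i) * (\<Prod>i\<in>S-T. u i)))"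
      by (rule sum.swap_restrict) auto
    also have "\<dots> = (\<Sum>T\<in>Pow {1..N}. (g T + (if T = {} then b else 0)) * (\<Prod>i\<in>T. sg D i))"
      by (simp add: g_def sum_distrib_left prod.distrib mult_ac)
    also have "\<dots> = walsh {1..N} g D + (\<Sum>T\<in>Pow {1..N}. (if T = {} then b else 0) * (\<Prod>i\<in>T. sg D i))"
      by (simp add: walsh_def ring_distribs sum.distrib)
    also have "(\<Sum>T\<in>Pow {1..N}. (if T = {} then b else 0) * (\<Prod>i\<in>T. sg D i))
      = (\<Sum>T\<in>Pow {1..N}. if T = {} then b else 0)"
      by (intro sum.cong) auto
    also have "\<dots> = b" by (subst sum.delta) auto
    finally show ?thesis by simp
  qed
  have deg: "g T = 0" if "T \<subseteq> {1..N}" "card T > d" for T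
  proof -
    have e: "{S\<in>ksets d N. T \<subseteq> S} = {}"
      using that by (auto dest!: ksetsD) (metis card_mono not_less)
    have "T \<noteq> {}" using that by auto
    then show ?thesis unfolding g_def e by simp
  qed
  \<comment> \<open>A set of size d lies in no other set of size d, so neither \<open>u\<close> nor
    other monomials enter; \<open>b\<close> stays out because d is positive.\<close>
  have top: "g T = set_coeff a T * (\<Prod>i\<in>T. v i)" if "T \<in> ksets d N" for T
  proof -
    have "S = T" if "S \<in> ksets d N" "T \<subseteq> S" for S
      using card_subset_eq[of S T] ksetsD[OF that(1)] ksetsD[OF \<open>T \<in> ksets d N\<close>] that(2) by simp
    then have e: "{S\<in>ksets d N. T \<subseteq> S} = {T}" using that by auto
    have "T \<noteq> {}" using that assms(2) by (auto simp: ksets_def)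
    then show ?thesis unfolding g_def e by simp
  qed
  have "s \<le> (\<Sum>T\<in>ksets d N. (g T)\<^sup>2)"
    using S by (simp add: top power_mult_distrib prod_power_distrib)
  also have "\<dots> \<le> (\<Sum>T\<in>Pow {1..N}. (g T)\<^sup>2)"
    by (intro sum_mono2) (auto simp: ksets_def)
  finally have "real (card {D\<in>Pow {1..N}. (walsh {1..N} g D)\<^sup>2 \<le> s / 2}) \<le> (1 - 1 / (4 * 9 ^ d)) * 2 ^ card {1..N}"
    using deg S(1) by (intro walsh_anticoncentration) auto
  then show ?thesis unfolding W by simp
qed

section \<open>Trigonometric polynomials\<close>

text \<open>A trigonometric polynomial of degree \<open>D\<close>, multiplied by \<open>cis t ^ D\<close>, becomes an algebraic
  polynomial of degree at most \<open>2 * D\<close> in \<open>cis t\<close>.\<close>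

definition trig_poly :: "nat \<Rightarrow> (real \<Rightarrow> real) \<Rightarrow> bool" where
  "trig_poly D f \<longleftrightarrow>
    (\<exists>p::complex poly. degree p \<le> 2 * D \<and> (\<forall>t. of_real (f t) * cis t ^ D = poly p (cis t)))"

lemma trig_poly_const: "trig_poly 0 (\<lambda>_. c)"
  unfolding trig_poly_def by (rule exI[of _ "[:of_real c:]"]) simp

lemma trig_poly_mono:
  assumes "trig_poly D f" "D \<le> E"
  shows "trig_poly E f"
proof -
  obtain p where p: "degree p \<le> 2 * D" "\<And>t. of_real (f t) * cis t ^ D = poly p (cis t)"
    using assms by (auto simp: trig_poly_def)
  have "degree (p * monom 1 (E - D)) \<le> 2 * E"
    using degree_mult_le[of p "monom 1 (E - D)"] degree_monom_le[of "1::complex" "E - D"] p(1) assms(2)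
    by linarith
  moreover have "of_real (f t) * cis t ^ E = poly (p * monom 1 (E - D)) (cis t)" for t
    using assms(2) p(2)[of t, symmetric] by (simp add: poly_monom mult.assoc power_add[symmetric])
  ultimately show ?thesis unfolding trig_poly_def by blast
qed

lemma trig_poly_add:
  assumes "trig_poly D f" "trig_poly D g"
  shows "trig_poly D (\<lambda>t. f t + g t)"
proof -
  obtain p q where "degree p \<le> 2 * D" "\<And>t. of_real (f t) * cis t ^ D = poly p (cis t)"
    "degree q \<le> 2 * D" "\<And>t. of_real (g t) * cis t ^ D = poly q (cis t)"
    using assms by (auto simp: trig_poly_def)
  then show ?thesis unfolding trig_poly_def
    by (intro exI[of _ "p + q"]) (auto simp: degree_add_le ring_distribs)
qed

lemma trig_poly_mult:
  assumes "trig_poly D f" "trig_poly E g"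
  shows "trig_poly (D + E) (\<lambda>t. f t * g t)"
proof -
  obtain p q where pq: "degree p \<le> 2 * D" "\<And>t. of_real (f t) * cis t ^ D = poly p (cis t)"
    "degree q \<le> 2 * E" "\<And>t. of_real (g t) * cis t ^ E = poly q (cis t)"
    using assms by (auto simp: trig_poly_def)
  have "degree (p * q) \<le> 2 * (D + E)"
    by (rule order_trans[OF degree_mult_le]) (use pq(1,3) in simp)
  moreover have "of_real (f t * g t) * cis t ^ (D + E) = poly (p * q) (cis t)" for t
    unfolding poly_mult pq(2,4)[symmetric] by (simp add: power_add)
  ultimately show ?thesis unfolding trig_poly_def by blast
qed

lemma trig_poly_sum:
  assumes "\<And>i. i \<in> A \<Longrightarrow> trig_poly D (f i)"
  shows "trig_poly D (\<lambda>t. \<Sum>i\<in>A. f i t)"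
  using assms
proof (induction A rule: infinite_finite_induct)
  case (insert x A)
  then show ?case by (simp add: trig_poly_add)
qed (auto intro: trig_poly_mono[OF trig_poly_const])

lemma trig_poly_prod:
  assumes "\<And>i. i \<in> A \<Longrightarrow> trig_poly D (f i)" "finite A"
  shows "trig_poly (card A * D) (\<lambda>t. \<Prod>i\<in>A. f i t)"
  using assms(2,1)
proof (induction A rule: finite_induct)
  case empty
  then show ?case by (simp add: trig_poly_const)
next
  case (insert x A)
  then show ?case using trig_poly_mult[of D "f x" "card A * D" "\<lambda>t. \<Prod>i\<in>A. f i t"] by simp
qed

lemma trig_poly_harmonic: "trig_poly l (\<lambda>t. A + B * cos (real l * t) + C * sin (real l * t))"
proof -
  \<comment> \<open>Euler's formulas: after multiplication by \<open>cis t ^ l\<close> the two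
    exponentials sit at the powers 2 l and 0.\<close>
  define p :: "complex poly" where "p = monom (of_real A) l + monom (Complex (B / 2) (- C / 2)) (2 * l)
    + monom (Complex (B / 2) (C / 2)) 0"
  have "degree p \<le> 2 * l"
    unfolding p_def by (intro degree_add_le order_trans[OF degree_monom_le]) auto
  moreover have "of_real (A + B * cos (real l * t) + C * sin (real l * t)) * cis t ^ l = poly p (cis t)" for t
  proof -
    define x where "x = real l * t"
    have "(sin x)\<^sup>2 = 1 - (cos x)\<^sup>2" by (rule sin_squared_eq)
    then have one: "sin x * sin x = 1 - cos x * cos x" by (simp add: power2_eq_square)
    have oB: "B * (sin x * sin x) = B - B * (cos x * cos x)" by (simp add: one algebra_simps)
    have oC: "C * (sin x * sin x) = C - C * (cos x * cos x)" by (simp add: one algebra_simps)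
    have "Re (of_real (A + B * cos x + C * sin x) * cis x)
        = Re (of_real A * cis x + Complex (B / 2) (- C / 2) * (cis x * cis x) + Complex (B / 2) (C / 2))"
      using oB oC by (simp add: algebra_simps; linarith)
    moreover have "Im (of_real (A + B * cos x + C * sin x) * cis x)
        = Im (of_real A * cis x + Complex (B / 2) (- C / 2) * (cis x * cis x) + Complex (B / 2) (C / 2))"
      using oB oC by (simp add: algebra_simps; linarith)
    ultimately have "of_real (A + B * cos x + C * sin x) * cis x
        = of_real A * cis x + Complex (B / 2) (- C / 2) * (cis x * cis x) + Complex (B / 2) (C / 2)"
      by (rule complex_eqI)
    moreover have "cis t ^ l = cis x" unfolding x_def by (rule Complex.DeMoivre)
    ultimately show ?thesis
      by (simp add: p_def poly_monom mult_2 power_add x_def[symmetric])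
  qed
  ultimately show ?thesis unfolding trig_poly_def by blast
qed

section \<open>A crude Bernstein inequality\<close>

lemma coeff_bound_unit_circle:
  fixes p :: "complex poly"
  assumes "\<And>z. cmod z = 1 \<Longrightarrow> cmod (poly p z) \<le> B"
  shows "cmod (coeff p k) \<le> 2 ^ k * B"
  using assms
proof (induction k arbitrary: p B)
  case 0
  have "cmod ((deriv ^^ 0) (poly p) 0) \<le> fact 0 * B / 1 ^ 0"
    by (rule Cauchy_inequality) (use 0 in \<open>auto intro!: holomorphic_intros continuous_intros\<close>)
  then show ?case by (simp add: poly_0_coeff_0)
next
  case (Suc k)
  obtain c q where p: "p = pCons c q" by (cases p)
  have "cmod ((deriv ^^ 0) (poly p) 0) \<le> fact 0 * B / 1 ^ 0"
    by (rule Cauchy_inequality) (use Suc.prems in \<open>auto intro!: holomorphic_intros continuous_intros\<close>)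
  then have c: "cmod c \<le> B" by (simp add: p)
  \<comment> \<open>Peel off the constant term: on the unit circle q has the modulus of p - c, at
    most twice the bound for p. Hence the factor 2 per coefficient.\<close>
  have "cmod (poly q z) \<le> 2 * B" if "cmod z = 1" for z
  proof -
    have "cmod (poly q z) = cmod (poly p z - c)" using that by (simp add: p norm_mult)
    also have "\<dots> \<le> 2 * B" using Suc.prems[OF that] c norm_triangle_ineq4[of "poly p z" c] by linarith
    finally show ?thesis .
  qed
  from Suc.IH[OF this] show ?case by (simp add: p)
qed

text \<open>The sum bounds the coefficients of the derivative of the algebraic polynomial, and the
  last D comes from differentiating the factor \<open>cis t ^ D\<close> away. Bernstein's sharp
  constant is D; here only the dependence on the degree alone matters.\<close>

definition bernstein :: "nat \<Rightarrow> real" where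
  "bernstein D = (\<Sum>k\<le>2*D. real (Suc k) * 2 ^ Suc k) + real D"

lemma bernstein_nonneg: "bernstein D \<ge> 0"
  by (auto simp: bernstein_def intro!: add_nonneg_nonneg sum_nonneg)

text \<open>f extends to the entire function G(z) = p(exp(iz)) exp(-iDz), whose complex derivative
  restricts to the derivative of f.\<close>

lemma trig_poly_deriv:
  assumes "trig_poly D f"
  obtains f' where "trig_poly D f'" "\<And>t. (f has_real_derivative f' t) (at t)"
    "\<And>S t. (\<And>t. \<bar>f t\<bar> \<le> S) \<Longrightarrow> \<bar>f' t\<bar> \<le> bernstein D * S"
proof -
  obtain p where p: "degree p \<le> 2 * D" "\<And>t. of_real (f t) * cis t ^ D = poly p (cis t)"
    using assms by (auto simp: trig_poly_def)
  define G where "G z = poly p (exp (\<i> * z)) * exp (- (\<i> * of_nat D * z))" for z :: complex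
  define G' where "G' z = poly (pderiv p) (exp (\<i> * z)) * (\<i> * exp (\<i> * z)) * exp (- (\<i> * of_nat D * z))
    - \<i> * of_nat D * G z" for z :: complex
  have dG: "(G has_field_derivative G' z) (at z)" for z
    unfolding G_def G'_def
    by (rule derivative_eq_intros DERIV_chain2[OF poly_DERIV] refl | simp add: algebra_simps)+
  have cis: "exp (\<i> * of_real t) = cis t" for t by (simp add: cis_conv_exp)
  have cisD: "exp (- (\<i> * of_nat D * of_real t)) * cis t ^ D = 1" for t
    by (simp add: cis_conv_exp exp_of_nat_mult[symmetric] exp_add[symmetric] mult_ac)
  have Gf: "G (of_real t) = of_real (f t)" for t
    using p(2)[of t, symmetric] cisD[of t] by (simp add: G_def cis) (metis mult.assoc mult.commute mult.right_neutral)
  define f' where "f' t = Re (G' (of_real t))" for t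
  have dv: "((\<lambda>t. of_real (f t)) has_vector_derivative G' (of_real t)) (at t)" for t
    using has_vector_derivative_real_field[OF dG[of "of_real t"]] by (simp add: Gf)
  have "((\<lambda>t. Re (of_real (f t))) has_vector_derivative Re (G' (of_real t))) (at t)" for t
    by (rule bounded_linear.has_vector_derivative[OF bounded_linear_Re dv])
  then have df: "(f has_real_derivative f' t) (at t)" for t
    by (simp add: has_real_derivative_iff_has_vector_derivative f'_def)
  \<comment> \<open>G is real on the real axis, so its derivative there is real too.\<close>
  have "((\<lambda>t. Im (of_real (f t))) has_vector_derivative Im (G' (of_real t))) (at t)" for t
    by (rule bounded_linear.has_vector_derivative[OF bounded_linear_Im dv])
  then have "((\<lambda>t. 0) has_vector_derivative Im (G' (of_real t))) (at t)" for t by simp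
  then have "Im (G' (of_real t)) = 0" for t
    using vector_derivative_unique_at[OF _ has_vector_derivative_const] by blast
  then have G'f': "G' (of_real t) = of_real (f' t)" for t by (simp add: f'_def complex_eq_iff)
  \<comment> \<open>The derivative of G times \<open>cis t ^ D\<close>, read as a polynomial in z =
    \<open>cis t\<close>: i z p'(z) - i D p(z).\<close>
  define q where "q = smult \<i> (pCons 0 (pderiv p)) - smult (\<i> * of_nat D) p"
  have qid: "of_real (f' t) * cis t ^ D = poly q (cis t)" for t
  proof -
    have "of_real (f' t) * cis t ^ D
      = poly (pderiv p) (cis t) * (\<i> * cis t) * (exp (- (\<i> * of_nat D * of_real t)) * cis t ^ D)
        - \<i> * of_nat D * (of_real (f t) * cis t ^ D)"
      unfolding G'f'[symmetric] G'_def by (simp add: Gf cis algebra_simps)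
    also have "\<dots> = poly q (cis t)" unfolding cisD p(2) by (simp add: q_def algebra_simps)
    finally show ?thesis .
  qed
  have degq: "degree q \<le> 2 * D"
  proof -
    have "degree (pCons 0 (pderiv p)) \<le> 2 * D"
    proof (cases "degree p = 0")
      case True
      then have "pderiv p = 0" by (simp add: pderiv_eq_0_iff)
      then show ?thesis by simp
    next
      case False
      then show ?thesis using p(1) degree_pCons_le[of 0 "pderiv p"] degree_pderiv[of p] by linarith
    qed
    then show ?thesis unfolding q_def using p(1)
      by (intro degree_diff_le order_trans[OF degree_smult_le]) auto
  qed
  have bound: "\<bar>f' t\<bar> \<le> bernstein D * S" if S: "\<And>t. \<bar>f t\<bar> \<le> S" for S t
  proof -
    have pS: "cmod (poly p z) \<le> S" if "cmod z = 1" for z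
    proof -
      obtain s where "z = cis s" using \<open>cmod z = 1\<close> by (metis complex_norm_eq_1_exp cis_conv_exp)
      then show ?thesis using p(2)[of s, symmetric] S[of s] by (simp add: norm_mult norm_power)
    qed
    have S0: "S \<ge> 0" using S[of 0] by linarith
    have cf: "cmod (coeff (pderiv p) k) \<le> real (Suc k) * 2 ^ Suc k * S" for k
      using coeff_bound_unit_circle[OF pS, of "Suc k"] S0
      by (simp add: coeff_pderiv norm_mult mult_left_mono del: of_nat_Suc power_Suc)
    have "poly (pderiv p) (cis t) = (\<Sum>k\<le>2*D. coeff (pderiv p) k * cis t ^ k)"
      unfolding poly_altdef
      by (rule sum.mono_neutral_left) (use p(1) degree_pderiv[of p] in \<open>auto intro: coeff_eq_0\<close>)
    also have "cmod \<dots> \<le> (\<Sum>k\<le>2*D. real (Suc k) * 2 ^ Suc k * S)"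
      using cf by (intro sum_norm_le) (simp add: norm_mult norm_power del: of_nat_Suc power_Suc)
    finally have 1: "cmod (poly (pderiv p) (cis t)) \<le> (\<Sum>k\<le>2*D. real (Suc k) * 2 ^ Suc k) * S"
      by (simp add: sum_distrib_right)
    have "\<bar>f' t\<bar> = cmod (poly q (cis t))"
      unfolding qid[symmetric] by (simp add: norm_mult norm_power)
    also have "\<dots> \<le> cmod (poly (pderiv p) (cis t)) + real D * cmod (poly p (cis t))"
    proof -
      have "poly q (cis t) = \<i> * (cis t * poly (pderiv p) (cis t)) - \<i> * of_nat D * poly p (cis t)"
        by (simp add: q_def algebra_simps)
      then show ?thesis
        using norm_triangle_ineq4[of "\<i> * (cis t * poly (pderiv p) (cis t))" "\<i> * of_nat D * poly p (cis t)"]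
        by (simp only: norm_mult) simp
    qed
    also have "\<dots> \<le> bernstein D * S"
      using 1 pS[of "cis t"] by (simp add: bernstein_def ring_distribs add_mono mult_left_mono)
    finally show ?thesis .
  qed
  have "trig_poly D f'" unfolding trig_poly_def using degq qid by blast
  then show ?thesis using that df bound by blast
qed

lemma trig_poly_periodic:
  assumes "trig_poly D f"
  shows "f (t + 2 * pi) = f t"
proof -
  obtain p where p: "\<And>t. of_real (f t) * cis t ^ D = poly p (cis t)"
    using assms by (auto simp: trig_poly_def)
  have "cis (t + 2 * pi) = cis t" by (simp add: cis_mult[symmetric])
  then have "of_real (f (t + 2 * pi)) * cis t ^ D = of_real (f t) * cis t ^ D"
    using p[of t] p[of "t + 2 * pi"] by simp
  moreover have "cis t ^ D \<noteq> 0" by simp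
  ultimately show ?thesis by (metis mult_right_cancel of_real_eq_iff)
qed

section \<open>Small values on the circle and smoothness under shifts\<close>

lemma borel_measurable_cis [measurable]: "cis \<in> borel_measurable borel"
  by (intro borel_measurable_continuous_onI continuous_intros)

lemma sin_ge_half:
  assumes "0 \<le> x" "x \<le> (1::real)"
  shows "x / 2 \<le> sin x"
proof -
  have "x / 2 - sin x \<le> 0 / 2 - sin 0"
  proof (rule DERIV_nonpos_imp_nonincreasing[OF assms(1)])
    fix t assume t: "0 \<le> t" "t \<le> x"
    have "cos (pi / 3) \<le> cos t"
      using t assms pi_gt3 by (intro cos_monotone_0_pi_le) auto
    then have "1 / 2 - cos t \<le> 0" by (simp add: cos_60)
    moreover have "((\<lambda>t. t / 2 - sin t) has_real_derivative 1 / 2 - cos t) (at t)"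
      by (auto intro!: derivative_eq_intros)
    ultimately show "\<exists>y. ((\<lambda>t. t / 2 - sin t) has_real_derivative y) (at t) \<and> y \<le> 0" by blast
  qed
  then show ?thesis by simp
qed

lemma cmod_cis_diff: "cmod (cis t - cis s) = 2 * \<bar>sin ((t - s) / 2)\<bar>"
proof -
  have "(cmod (cis t - cis s))\<^sup>2 = ((cos t)\<^sup>2 + (sin t)\<^sup>2) + ((cos s)\<^sup>2 + (sin s)\<^sup>2) - 2 * cos (t - s)"
    by (simp only: cmod_power2 minus_complex.sel cis.sel cos_diff power2_diff) (simp add: algebra_simps)
  also have "\<dots> = 2 - 2 * cos (2 * ((t - s) / 2))"
  proof -
    have "2 * ((t - s) / 2) = t - s" by simp
    then show ?thesis by (simp only: sin_cos_squared_add2)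
  qed
  also have "\<dots> = (2 * \<bar>sin ((t - s) / 2)\<bar>)\<^sup>2"
    by (simp only: cos_double_sin) (simp add: power_mult_distrib)
  finally show ?thesis by (rule power2_eq_imp_eq) auto
qed

text \<open>Cut the period into 7 unit intervals, as 2 \<pi> < 7. In one of them two times near
  \<open>z\<close> are joined by a chord shorter than 2 \<delta>, hence are less than 4 \<delta>
  apart. Each interval contributes at most 8 \<delta>, and 56 = 7 * 8.\<close>

lemma emeasure_arc_le:
  assumes "\<delta> > 0"
  shows "emeasure lborel {t\<in>{0..2*pi}. cmod (cis t - z) < \<delta>} \<le> ennreal (56 * \<delta>)"
proof -
  define E where "E k = {t\<in>{real k..real k + 1}. cmod (cis t - z) < \<delta>}" for k
  have mE: "E k \<in> sets lborel" for k
    unfolding E_def by simp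
  have one: "emeasure lborel (E k) \<le> ennreal (8 * \<delta>)" for k
  proof (cases "E k = {}")
    case False
    then obtain s where s: "s \<in> E k" by auto
    have "E k \<subseteq> {s - 4 * \<delta>..s + 4 * \<delta>}"
    proof
      fix t assume t: "t \<in> E k"
      have "cmod (cis t - cis s) < 2 * \<delta>"
        using norm_triangle_ineq4[of "cis t - z" "cis s - z"] s t by (auto simp: E_def)
      moreover have "\<bar>t - s\<bar> / 2 \<le> 2 * \<bar>sin ((t - s) / 2)\<bar>"
      proof -
        have "\<bar>t - s\<bar> \<le> 1" using s t by (auto simp: E_def)
        then have "(\<bar>t - s\<bar> / 2) / 2 \<le> sin (\<bar>t - s\<bar> / 2)" by (intro sin_ge_half) auto
        also have "\<dots> \<le> \<bar>sin ((t - s) / 2)\<bar>"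
          using sin_minus[of "(t - s) / 2"] by (cases "t \<ge> s") (simp_all add: minus_divide_left)
        finally show ?thesis by simp
      qed
      ultimately show "t \<in> {s - 4 * \<delta>..s + 4 * \<delta>}"
        unfolding cmod_cis_diff by (auto simp: abs_le_iff abs_if split: if_splits)
    qed
    then have "emeasure lborel (E k) \<le> emeasure lborel {s - 4 * \<delta>..s + 4 * \<delta>}"
      by (rule emeasure_mono) simp
    then show ?thesis using assms by simp
  qed simp
  have "{t\<in>{0..2*pi}. cmod (cis t - z) < \<delta>} \<subseteq> (\<Union>k<7. E k)"
  proof
    fix t assume t: "t \<in> {t\<in>{0..2*pi}. cmod (cis t - z) < \<delta>}"
    have "t < 7" using t pi_less_4 pi_approx by auto
    then have "nat \<lfloor>t\<rfloor> < 7" "t \<in> E (nat \<lfloor>t\<rfloor>)"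
      using t by (auto simp: E_def le_nat_floor nat_less_iff floor_less_iff)
    then show "t \<in> (\<Union>k<7. E k)" by blast
  qed
  then have "emeasure lborel {t\<in>{0..2*pi}. cmod (cis t - z) < \<delta>} \<le> emeasure lborel (\<Union>k<7. E k)"
    using mE by (intro emeasure_mono) auto
  also have "\<dots> \<le> (\<Sum>k<7. emeasure lborel (E k))"
    using mE by (intro emeasure_subadditive_finite) auto
  also have "\<dots> \<le> (\<Sum>k<7::nat. ennreal (8 * \<delta>))" by (intro sum_mono one)
  also have "\<dots> = ennreal (56 * \<delta>)"
    by (subst sum_ennreal) (use assms in auto)
  finally show ?thesis .
qed

text \<open>Off the \<open>\<delta>\<close>-neighbourhoods of the roots of the associated algebraic polynomial, each linear
  factor loses at most the factor \<open>\<delta> / 3\<close> against its value at any other point of the circle.\<close>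

lemma trig_poly_small_set:
  assumes "trig_poly D g" "0 < \<delta>" "\<delta> \<le> 1" "S \<le> \<bar>g t0\<bar>"
  shows "emeasure lborel {t\<in>{0..2*pi}. \<bar>g t\<bar> < (\<delta> / 3) ^ (2 * D) * S} \<le> ennreal (112 * real D * \<delta>)"
    (is "emeasure lborel ?E \<le> _")
proof -
  obtain p where p: "degree p \<le> 2 * D" "\<And>t. of_real (g t) * cis t ^ D = poly p (cis t)"
    using assms(1) by (auto simp: trig_poly_def)
  obtain r where r: "smult (lead_coeff p) (\<Prod>i<degree p. [:-r i, 1:]) = p"
    using complex_poly_decompose' by blast
  have val: "\<bar>g t\<bar> = cmod (lead_coeff p) * (\<Prod>i<degree p. cmod (cis t - r i))" for t
  proof -
    have "\<bar>g t\<bar> = cmod (poly p (cis t))"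
      unfolding p(2)[symmetric] by (simp add: norm_mult norm_power)
    also have "\<dots> = cmod (poly (smult (lead_coeff p) (\<Prod>i<degree p. [:-r i, 1:])) (cis t))"
      by (simp only: r)
    also have "\<dots> = cmod (lead_coeff p) * (\<Prod>i<degree p. cmod (cis t - r i))"
      by (simp add: norm_mult poly_prod prod_norm[symmetric])
    finally show ?thesis .
  qed
  have "?E \<subseteq> (\<Union>i<degree p. {t\<in>{0..2*pi}. cmod (cis t - r i) < \<delta>})"
  proof
    fix t assume t: "t \<in> ?E"
    show "t \<in> (\<Union>i<degree p. {t\<in>{0..2*pi}. cmod (cis t - r i) < \<delta>})"
    proof (rule ccontr)
      assume "\<not> ?thesis"
      then have far: "\<delta> \<le> cmod (cis t - r i)" if "i < degree p" for i
        using t that by force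
      \<comment> \<open>Two points of the circle are at distance at most 2, and the distance from
        \<open>cis t\<close> to the root is at least \<delta>; with \<delta> at most 1 this gives 2
        + 1 = 3.\<close>
      have "(\<delta> / 3) * cmod (cis t0 - r i) \<le> cmod (cis t - r i)" if "i < degree p" for i
      proof -
        have "cmod (cis t0 - r i) \<le> cmod (cis t0 - cis t) + cmod (cis t - r i)"
          using norm_triangle_ineq[of "cis t0 - cis t" "cis t - r i"] by simp
        also have "cmod (cis t0 - cis t) \<le> 2"
          using norm_triangle_ineq4[of "cis t0" "cis t"] by simp
        finally have "cmod (cis t0 - r i) * \<delta> \<le> (2 + cmod (cis t - r i)) * \<delta>"
          using assms by (intro mult_right_mono) auto
        also have "\<dots> \<le> 2 * cmod (cis t - r i) + cmod (cis t - r i) * 1"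
          using far[OF that] assms by (simp only: ring_distribs) (intro add_mono mult_left_mono, auto)
        finally show ?thesis by (simp add: mult_ac)
      qed
      then have "(\<Prod>i<degree p. (\<delta> / 3) * cmod (cis t0 - r i)) \<le> (\<Prod>i<degree p. cmod (cis t - r i))"
        using assms by (intro prod_mono) auto
      then have "cmod (lead_coeff p) * ((\<delta> / 3) ^ degree p * (\<Prod>i<degree p. cmod (cis t0 - r i))) \<le> \<bar>g t\<bar>"
        unfolding val[of t] prod.distrib by (intro mult_left_mono) auto
      then have "(\<delta> / 3) ^ degree p * \<bar>g t0\<bar> \<le> \<bar>g t\<bar>"
        unfolding val[of t0] by (simp add: mult_ac)
      moreover have "(\<delta> / 3) ^ (2 * D) * \<bar>g t0\<bar> \<le> (\<delta> / 3) ^ degree p * \<bar>g t0\<bar>"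
        using assms p(1) by (intro mult_right_mono power_decreasing) auto
      moreover have "(\<delta> / 3) ^ (2 * D) * S \<le> (\<delta> / 3) ^ (2 * D) * \<bar>g t0\<bar>"
        using assms by (intro mult_left_mono) auto
      ultimately show False using t by auto
    qed
  qed
  then have "emeasure lborel ?E \<le> emeasure lborel (\<Union>i<degree p. {t\<in>{0..2*pi}. cmod (cis t - r i) < \<delta>})"
    by (intro emeasure_mono) measurable
  also have "\<dots> \<le> (\<Sum>i<degree p. emeasure lborel {t\<in>{0..2*pi}. cmod (cis t - r i) < \<delta>})"
    by (intro emeasure_subadditive_finite) auto
  also have "\<dots> \<le> (\<Sum>i<degree p. ennreal (56 * \<delta>))" by (intro sum_mono emeasure_arc_le assms)
  also have "\<dots> = ennreal (real (degree p) * (56 * \<delta>))"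
    by (subst sum_ennreal) (use assms in auto)
  \<comment> \<open>There are at most 2 D roots, each costing 56 \<delta>.\<close>
  also have "\<dots> \<le> ennreal (112 * real D * \<delta>)"
  proof (rule ennreal_leI)
    have "real (degree p) * (56 * \<delta>) \<le> real (2 * D) * (56 * \<delta>)"
      using p(1) assms by (intro mult_right_mono) (auto simp del: of_nat_mult)
    then show "real (degree p) * (56 * \<delta>) \<le> 112 * real D * \<delta>" by simp
  qed
  finally show ?thesis .
qed

text \<open>Integration by parts against \<open>f' / (f'\<^sup>2 + \<beta>\<^sup>2)\<close>, with \<open>\<beta>\<close> proportional to \<open>sup \<bar>f'\<bar>\<close>, trades
  the smoothness of \<open>\<phi>\<close> for the factor \<open>y\<close>; the error is supported where \<open>f'\<close> is small.\<close>

lemma trig_poly_shift_bound: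
  assumes f: "trig_poly D f" and osc: "s \<in> {0..2*pi}" "t \<in> {0..2*pi}" "\<kappa> \<le> \<bar>f s - f t\<bar>" and "\<kappa> > 0"
    and \<delta>: "0 < \<delta>" "\<delta> \<le> 1"
    and \<phi>: "continuous_on UNIV \<phi>" "\<And>x::real. \<bar>\<phi> x\<bar> \<le> 1"
  defines "b \<equiv> (\<delta> / 3) ^ (2 * D + 1)"
  shows "\<bar>LINT u:{0..2*pi}|lborel. \<phi> (f u) - \<phi> (f u + y)\<bar>
    \<le> 2 * (112 * real D * \<delta>) + 2 * pi * (2 * \<delta> + \<bar>y\<bar> * bernstein D * (2 * pi) / (b\<^sup>2 * \<kappa>))"
proof -
  obtain f1 where f1: "trig_poly D f1" "\<And>u. (f has_real_derivative f1 u) (at u)"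
    using trig_poly_deriv[OF f] by metis
  obtain f2 where f2: "trig_poly D f2" "\<And>u. (f1 has_real_derivative f2 u) (at u)"
    "\<And>S u. (\<And>u. \<bar>f1 u\<bar> \<le> S) \<Longrightarrow> \<bar>f2 u\<bar> \<le> bernstein D * S"
    using trig_poly_deriv[OF f1(1)] by metis
  have cont: "continuous_on A f" "continuous_on A f1" for A
    using f1(2) f2(2) by (meson DERIV_isCont continuous_at_imp_continuous_on)+
  obtain f3 where f3: "\<And>u. (f2 has_real_derivative f3 u) (at u)"
    using trig_poly_deriv[OF f2(1)] by metis
  have cont2: "continuous_on A f2" for A
    using f3 by (meson DERIV_isCont continuous_at_imp_continuous_on)
  have "\<exists>x\<in>{0..2*pi}. \<forall>u\<in>{0..2*pi}. \<bar>f1 u\<bar> \<le> \<bar>f1 x\<bar>"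
    by (rule continuous_attains_sup) (auto intro!: continuous_intros cont)
  then obtain t0 where t0: "t0 \<in> {0..2*pi}" "\<And>u. u \<in> {0..2*pi} \<Longrightarrow> \<bar>f1 u\<bar> \<le> \<bar>f1 t0\<bar>"
    by blast
  define S where "S = \<bar>f1 t0\<bar>"
  have S: "\<bar>f1 u\<bar> \<le> S" if "u \<in> {0..2*pi}" for u using t0 that by (simp add: S_def)
  \<comment> \<open>The Bernstein bound needs a supremum over the whole line, which periodicity
    reduces to one period.\<close>
  have Sall: "\<bar>f1 u\<bar> \<le> S" for u
  proof -
    define k where "k = \<lfloor>u / (2 * pi)\<rfloor>"
    have per: "f1 (v + 2 * pi) = f1 v" for v by (rule trig_poly_periodic[OF f1(1)])
    have pn: "f1 (v + real n * (2 * pi)) = f1 v" for v n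
    proof (induction n)
      case (Suc n)
      then show ?case using per[of "v + real n * (2 * pi)"] by (simp add: algebra_simps)
    qed simp
    have "f1 (v + of_int j * (2 * pi)) = f1 v" for v j
    proof (cases "j \<ge> 0")
      case True
      then show ?thesis using pn[of v "nat j"] by simp
    next
      case False
      then show ?thesis using pn[of "v + of_int j * (2 * pi)" "nat (- j)"] by (simp add: algebra_simps)
    qed
    from this[of "u - of_int k * (2 * pi)" k] have "f1 u = f1 (u - of_int k * (2 * pi))" by simp
    moreover have "u - of_int k * (2 * pi) \<in> {0..2*pi}"
    proof -
      have "of_int k \<le> u / (2 * pi)" "u / (2 * pi) \<le> of_int k + 1"
        unfolding k_def by linarith+
      then have "of_int k * (2 * pi) \<le> u" "u \<le> (of_int k + 1) * (2 * pi)"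
        by (simp_all add: pos_le_divide_eq pos_divide_le_eq)
      then show ?thesis by (simp add: algebra_simps)
    qed
    ultimately show ?thesis using S by metis
  qed
  have \<kappa>S: "\<kappa> / (2 * pi) \<le> S"
  proof -
    have "\<bar>f s - f t\<bar> \<le> S * \<bar>s - t\<bar>"
    proof -
      have "norm (f s - f t) \<le> S * norm (s - t)"
        by (rule field_differentiable_bound[of UNIV f f1]) (use f1(2) Sall in auto)
      then show ?thesis by simp
    qed
    also have "\<dots> \<le> S * (2 * pi)"
      using osc by (intro mult_left_mono) (auto simp: S_def)
    finally show ?thesis using osc by (simp add: divide_simps mult_ac)
  qed
  have Spos: "S > 0" using \<kappa>S \<open>\<kappa> > 0\<close> by (smt (verit) divide_pos_pos pi_gt_zero)
  have b: "b > 0" using \<delta> by (simp add: b_def)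
  \<comment> \<open>\<open>b\<close> has one factor \<delta> / 3 more than the threshold in
    \<open>trig_poly_small_set\<close>, so off the exceptional set \<beta> is at most \<delta> / 3
    times the modulus of f'.\<close>
  define \<beta> where "\<beta> = b * S"
  have \<beta>: "\<beta> > 0" using b Spos by (simp add: \<beta>_def)
  obtain \<Phi> where \<Phi>: "\<And>x. (\<Phi> has_real_derivative \<phi> x) (at x)"
  proof -
    have "\<exists>F. \<forall>x::real. -\<infinity> < ereal x \<longrightarrow> ereal x < \<infinity> \<longrightarrow> (F has_vector_derivative \<phi> x) (at x)"
      by (rule einterval_antiderivative) (use \<phi>(1) in \<open>auto simp: continuous_on_eq_continuous_at\<close>)
    then show ?thesis using that by (auto simp: has_real_derivative_iff_has_vector_derivative)
  qed
  \<comment> \<open>An antiderivative of the difference under study. Because \<phi> is bounded by 1,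
    it is bounded by the size of the shift, whatever the modulus of continuity of \<phi>.\<close>
  define \<Psi> where "\<Psi> x = \<Phi> x - \<Phi> (x + y)" for x
  have d\<Psi>: "(\<Psi> has_real_derivative \<phi> x - \<phi> (x + y)) (at x)" for x
    unfolding \<Psi>_def by (auto intro!: derivative_eq_intros \<Phi> DERIV_chain2[OF \<Phi>])
  have \<Psi>: "\<bar>\<Psi> x\<bar> \<le> \<bar>y\<bar>" for x
  proof -
    have "norm (\<Phi> x - \<Phi> (x + y)) \<le> 1 * norm (x - (x + y))"
      by (rule field_differentiable_bound[of UNIV \<Phi> \<phi>]) (use \<Phi> \<phi>(2) in auto)
    then show ?thesis by (simp add: \<Psi>_def)
  qed
  \<comment> \<open>The quotient is a regularised 1 / f': up to the remainder \<open>R\<close>,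
    \<open>G\<close> differentiates to \<psi>, damped where f' is small against \<beta>.\<close>
  define G where "G u = \<Psi> (f u) * (f1 u / ((f1 u)\<^sup>2 + \<beta>\<^sup>2))" for u
  define R where "R u = \<Psi> (f u) * (f2 u * (\<beta>\<^sup>2 - (f1 u)\<^sup>2) / ((f1 u)\<^sup>2 + \<beta>\<^sup>2)\<^sup>2)" for u
  define \<psi> where "\<psi> u = \<phi> (f u) - \<phi> (f u + y)" for u
  define G' where "G' u = \<psi> u * ((f1 u)\<^sup>2 / ((f1 u)\<^sup>2 + \<beta>\<^sup>2)) + R u" for u
  have den: "(f1 u)\<^sup>2 + \<beta>\<^sup>2 > 0" for u using \<beta> by (intro add_nonneg_pos) auto
  have dG: "(G has_real_derivative G' u) (at u)" for u
  proof -
    have 1: "((\<lambda>u. \<Psi> (f u)) has_real_derivative \<psi> u * f1 u) (at u)"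
      unfolding \<psi>_def using DERIV_chain2[OF d\<Psi> f1(2)] by simp
    have 2: "((\<lambda>u. f1 u / ((f1 u)\<^sup>2 + \<beta>\<^sup>2)) has_real_derivative
        (f2 u * ((f1 u)\<^sup>2 + \<beta>\<^sup>2) - f1 u * (2 * f1 u * f2 u)) / ((f1 u)\<^sup>2 + \<beta>\<^sup>2)\<^sup>2) (at u)"
      using den[of u] by (auto intro!: derivative_eq_intros f2(2) simp: power2_eq_square)
    have "\<psi> u * f1 u * (f1 u / ((f1 u)\<^sup>2 + \<beta>\<^sup>2))
        + (f2 u * ((f1 u)\<^sup>2 + \<beta>\<^sup>2) - f1 u * (2 * f1 u * f2 u)) / ((f1 u)\<^sup>2 + \<beta>\<^sup>2)\<^sup>2 * \<Psi> (f u) = G' u"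
      by (simp add: G'_def R_def power2_eq_square[of "f1 u"] algebra_simps)
    then show ?thesis unfolding G_def using DERIV_mult[OF 1 2] by simp
  qed
  have contG': "continuous_on A G'" for A
  proof -
    have "continuous_on UNIV \<Psi>" using d\<Psi> by (meson DERIV_isCont continuous_at_imp_continuous_on)
    then have "continuous_on A (\<lambda>u. \<Psi> (f u))"
      by (rule continuous_on_compose2) (use cont in auto)
    moreover have "continuous_on A (\<lambda>u. \<phi> (f u))" "continuous_on A (\<lambda>u. \<phi> (f u + y))"
      by (rule continuous_on_compose2[OF \<phi>(1)]; use cont in \<open>auto intro!: continuous_intros\<close>)+
    ultimately show ?thesis unfolding G'_def R_def \<psi>_def
      using den by (intro continuous_intros cont cont2) (auto simp: less_imp_neq[symmetric])
  qed
  have cont\<psi>: "continuous_on A \<psi>" for A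
    unfolding \<psi>_def by (intro continuous_intros continuous_on_compose2[OF \<phi>(1)] cont) auto
  have intG': "set_integrable lborel {0..2*pi} G'" and int\<psi>: "set_integrable lborel {0..2*pi} \<psi>"
    unfolding set_integrable_def by (rule borel_integrable_compact[OF compact_Icc contG'] borel_integrable_compact[OF compact_Icc cont\<psi>])+
  \<comment> \<open>By periodicity there are no boundary terms, so \<open>G'\<close> may be
    subtracted from \<psi> without changing its integral.\<close>
  have zero: "(LINT u:{0..2*pi}|lborel. G' u) = 0"
  proof -
    have "(\<integral>u. indicator {0..2*pi} u *\<^sub>R G' u \<partial>lborel) = G (2 * pi) - G 0"
      by (rule integral_FTC_atLeastAtMost)
        (use dG contG' in \<open>auto simp: has_real_derivative_iff_has_vector_derivative[symmetric] intro: has_field_derivative_at_within\<close>)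
    also have "\<dots> = 0"
      using trig_poly_periodic[OF f, of 0] trig_poly_periodic[OF f1(1), of 0] by (simp add: G_def)
    finally show ?thesis by (simp add: set_lebesgue_integral_def)
  qed
  define E where "E = {u\<in>{0..2*pi}. \<bar>f1 u\<bar> < (\<delta> / 3) ^ (2 * D) * S}"
  have mE: "E \<in> sets lborel"
  proof -
    have [measurable]: "f1 \<in> borel_measurable borel" by (intro borel_measurable_continuous_onI cont)
    show ?thesis unfolding E_def by simp
  qed
  have emE: "emeasure lborel E \<le> ennreal (112 * real D * \<delta>)"
    unfolding E_def by (rule trig_poly_small_set[OF f1(1) \<delta>, where ?t0.0 = t0]) (simp add: S_def)
  then have E_fin: "emeasure lborel E < \<infinity>" using le_less_trans by fastforce
  have measE: "measure lborel E \<le> 112 * real D * \<delta>"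
    unfolding measure_def using emE \<delta> by (intro enn2real_leI) auto
  define K where "K = 2 * \<delta> + \<bar>y\<bar> * bernstein D * (2 * pi) / (b\<^sup>2 * \<kappa>)"
  have Rb: "\<bar>R u\<bar> \<le> \<bar>y\<bar> * bernstein D * (2 * pi) / (b\<^sup>2 * \<kappa>)" for u
  proof -
    have "\<bar>\<beta>\<^sup>2 - (f1 u)\<^sup>2\<bar> \<le> (f1 u)\<^sup>2 + \<beta>\<^sup>2" by (auto simp: abs_le_iff)
    then have "\<bar>\<beta>\<^sup>2 - (f1 u)\<^sup>2\<bar> * \<beta>\<^sup>2 \<le> ((f1 u)\<^sup>2 + \<beta>\<^sup>2) * ((f1 u)\<^sup>2 + \<beta>\<^sup>2)"
      by (intro mult_mono) auto
    then have q: "\<bar>\<beta>\<^sup>2 - (f1 u)\<^sup>2\<bar> / ((f1 u)\<^sup>2 + \<beta>\<^sup>2)\<^sup>2 \<le> 1 / \<beta>\<^sup>2"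
      using den[of u] \<beta> by (simp add: divide_simps power2_eq_square)
    have "\<bar>R u\<bar> = \<bar>\<Psi> (f u)\<bar> * (\<bar>f2 u\<bar> * (\<bar>\<beta>\<^sup>2 - (f1 u)\<^sup>2\<bar> / ((f1 u)\<^sup>2 + \<beta>\<^sup>2)\<^sup>2))"
      by (simp add: R_def abs_mult)
    also have "\<dots> \<le> \<bar>y\<bar> * ((bernstein D * S) * (1 / \<beta>\<^sup>2))"
      using \<Psi> f2(3)[OF Sall] q bernstein_nonneg[of D] Spos by (intro mult_mono) auto
    also have "\<dots> = \<bar>y\<bar> * bernstein D / b\<^sup>2 * (1 / S)"
      using Spos by (simp add: \<beta>_def power2_eq_square)
    also have "\<dots> \<le> \<bar>y\<bar> * bernstein D / b\<^sup>2 * (2 * pi / \<kappa>)"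
    proof (intro mult_left_mono)
      have "\<kappa> \<le> S * (2 * pi)" using \<kappa>S by (simp add: divide_simps mult_ac)
      then show "1 / S \<le> 2 * pi / \<kappa>" using Spos \<open>\<kappa> > 0\<close> by (simp add: divide_simps mult_ac)
    qed (use bernstein_nonneg[of D] in auto)
    finally show ?thesis by (simp add: mult_ac)
  qed
  have pw: "\<bar>\<psi> u - G' u\<bar> \<le> 2 * indicator E u + K" if u: "u \<in> {0..2*pi}" for u
  proof -
    have eq: "\<psi> u - G' u = \<psi> u * (\<beta>\<^sup>2 / ((f1 u)\<^sup>2 + \<beta>\<^sup>2)) - R u"
    proof -
      have "\<beta>\<^sup>2 / ((f1 u)\<^sup>2 + \<beta>\<^sup>2) + (f1 u)\<^sup>2 / ((f1 u)\<^sup>2 + \<beta>\<^sup>2) = 1"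
        using den[of u] by (metis add.commute add_divide_distrib divide_self less_irrefl)
      then have "\<psi> u = \<psi> u * (\<beta>\<^sup>2 / ((f1 u)\<^sup>2 + \<beta>\<^sup>2) + (f1 u)\<^sup>2 / ((f1 u)\<^sup>2 + \<beta>\<^sup>2))" by simp
      then show ?thesis unfolding G'_def distrib_left by linarith
    qed
    have \<psi>2: "\<bar>\<psi> u\<bar> \<le> 2" using \<phi>(2)[of "f u"] \<phi>(2)[of "f u + y"] unfolding \<psi>_def by linarith
    have "\<beta>\<^sup>2 / ((f1 u)\<^sup>2 + \<beta>\<^sup>2) \<le> indicator E u + \<delta>"
    proof (cases "u \<in> E")
      case True
      have "\<beta>\<^sup>2 / ((f1 u)\<^sup>2 + \<beta>\<^sup>2) \<le> 1" using den[of u] by (simp add: divide_simps)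
      then show ?thesis using True \<delta> by simp
    next
      case False
      then have big: "(\<delta> / 3) ^ (2 * D) * S \<le> \<bar>f1 u\<bar>" using u by (auto simp: E_def)
      have "\<beta> = \<delta> / 3 * ((\<delta> / 3) ^ (2 * D) * S)" by (simp add: \<beta>_def b_def)
      also have "\<dots> \<le> \<delta> / 3 * \<bar>f1 u\<bar>" using big \<delta> by (intro mult_left_mono) auto
      finally have "\<beta>\<^sup>2 \<le> (\<delta> / 3 * \<bar>f1 u\<bar>)\<^sup>2" using \<beta> by (intro power_mono) auto
      also have "\<dots> = (\<delta> * \<delta> / 9) * (f1 u)\<^sup>2" by (simp add: power2_eq_square)
      also have "\<dots> \<le> \<delta> * (f1 u)\<^sup>2" using \<delta> by (intro mult_right_mono) auto
      also have "\<dots> \<le> \<delta> * ((f1 u)\<^sup>2 + \<beta>\<^sup>2)" using \<delta> by (intro mult_left_mono) auto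
      finally show ?thesis using den[of u] False by (simp add: divide_simps)
    qed
    then have "\<bar>\<psi> u\<bar> * (\<beta>\<^sup>2 / ((f1 u)\<^sup>2 + \<beta>\<^sup>2)) \<le> 2 * (indicator E u + \<delta>)"
      using \<psi>2 den[of u] by (intro mult_mono) auto
    then have "\<bar>\<psi> u * (\<beta>\<^sup>2 / ((f1 u)\<^sup>2 + \<beta>\<^sup>2))\<bar> \<le> 2 * indicator E u + 2 * \<delta>"
      using den[of u] by (simp add: abs_mult)
    then show ?thesis using Rb[of u] abs_triangle_ineq4[of "\<psi> u * (\<beta>\<^sup>2 / ((f1 u)\<^sup>2 + \<beta>\<^sup>2))" "R u"]
      unfolding eq K_def by linarith
  qed
  have intE: "integrable lborel (indicator E :: real \<Rightarrow> real)"
    using mE E_fin by (simp add: integrable_indicator_iff)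
  have EI: "set_integrable lborel {0..2*pi} (\<lambda>u. 2 * indicator E u + K :: real)"
  proof -
    have "(\<lambda>u. indicator {0..2*pi} u *\<^sub>R (2 * indicator E u + K)) = (\<lambda>u. 2 * indicator E u + K * indicator {0..2*pi} u :: real)"
      by (auto simp: E_def indicator_def)
    then show ?thesis unfolding set_integrable_def using intE by simp
  qed
  have "(LINT u:{0..2*pi}|lborel. \<psi> u) = (LINT u:{0..2*pi}|lborel. \<psi> u - G' u)"
    using set_integral_diff(2)[OF int\<psi> intG'] zero by simp
  also have "\<bar>\<dots>\<bar> \<le> (LINT u:{0..2*pi}|lborel. \<bar>\<psi> u - G' u\<bar>)"
    using set_integral_norm_bound[OF set_integral_diff(1)[OF int\<psi> intG']] by simp
  also have "\<dots> \<le> (LINT u:{0..2*pi}|lborel. 2 * indicator E u + K)"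
    by (rule set_integral_mono) (use pw EI set_integrable_abs[OF set_integral_diff(1)[OF int\<psi> intG']] in auto)
  also have "\<dots> = 2 * measure lborel E + 2 * pi * K"
  proof -
    have "(\<lambda>u. indicator {0..2*pi} u *\<^sub>R (2 * indicator E u + K)) = (\<lambda>u. 2 * indicator E u + K * indicator {0..2*pi} u :: real)"
      by (auto simp: E_def indicator_def)
    then show ?thesis unfolding set_lebesgue_integral_def using intE by simp
  qed
  also have "\<dots> \<le> 2 * (112 * real D * \<delta>) + 2 * pi * K" using measE by (simp add: mult_ac)
  finally show ?thesis unfolding \<psi>_def K_def .
qed

text \<open>The point is uniformity: h is fixed before f, \<phi> and y, so it serves every sample of
  a random trigonometric polynomial.\<close>

lemma trig_poly_shift_smooth:
  fixes \<kappa> e :: real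
  assumes "\<kappa> > 0" "e > 0"
  obtains h where "h > 0"
    "\<And>f s t (\<phi> :: real \<Rightarrow> real) y. \<lbrakk>trig_poly D f; s \<in> {0..2*pi}; t \<in> {0..2*pi}; \<kappa> \<le> \<bar>f s - f t\<bar>;
      continuous_on UNIV \<phi>; \<And>x. \<bar>\<phi> x\<bar> \<le> 1; \<bar>y\<bar> \<le> h\<rbrakk>
      \<Longrightarrow> \<bar>LINT u:{0..2*pi}|lborel. \<phi> (f u) - \<phi> (f u + y)\<bar> \<le> e"
proof -
  \<comment> \<open>c - 1 is the coefficient of \<delta> in the bound. First \<delta> spends half of
    e; this fixes b and then L, and the shift spends the other half.\<close>
  define c where "c = 2 * (112 * real D) + 4 * pi + 1"
  have c: "c > 0" by (simp add: c_def add_nonneg_pos)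
  define \<delta> where "\<delta> = min 1 (e / (2 * c))"
  have \<delta>: "0 < \<delta>" "\<delta> \<le> 1" "\<delta> * c \<le> e / 2"
    using assms c by (auto simp: \<delta>_def min_def field_simps)
  define b where "b = (\<delta> / 3) ^ (2 * D + 1)"
  have b: "b > 0" using \<delta> by (simp add: b_def)
  define L where "L = 2 * pi * (bernstein D * (2 * pi) / (b\<^sup>2 * \<kappa>)) + 1"
  have L: "L > 0" using bernstein_nonneg[of D] assms b by (simp add: L_def add_nonneg_pos)
  show ?thesis
  proof (rule that[of "e / (2 * L)"])
    show "e / (2 * L) > 0" using assms L by simp
    fix f s t y and \<phi> :: "real \<Rightarrow> real"
    assume *: "trig_poly D f" "s \<in> {0..2*pi}" "t \<in> {0..2*pi}" "\<kappa> \<le> \<bar>f s - f t\<bar>"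
      "continuous_on UNIV \<phi>" "\<And>x. \<bar>\<phi> x\<bar> \<le> 1" "\<bar>y\<bar> \<le> e / (2 * L)"
    have "\<bar>LINT u:{0..2*pi}|lborel. \<phi> (f u) - \<phi> (f u + y)\<bar>
      \<le> 2 * (112 * real D * \<delta>) + 2 * pi * (2 * \<delta> + \<bar>y\<bar> * bernstein D * (2 * pi) / (b\<^sup>2 * \<kappa>))"
      unfolding b_def by (rule trig_poly_shift_bound[OF *(1-4) assms(1) \<delta>(1,2) *(5,6)])
    also have "\<dots> = \<delta> * (c - 1) + \<bar>y\<bar> * (L - 1)"
      by (simp add: c_def L_def algebra_simps)
    also have "\<dots> \<le> \<delta> * c + \<bar>y\<bar> * L" using \<delta> by (intro add_mono mult_left_mono) auto
    also have "\<bar>y\<bar> * L \<le> e / (2 * L) * L" using *(7) L by (intro mult_right_mono) auto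
    finally show "\<bar>LINT u:{0..2*pi}|lborel. \<phi> (f u) - \<phi> (f u + y)\<bar> \<le> e"
      using \<delta>(3) L by simp
  qed
qed

section \<open>Twisting the disc\<close>

definition rot :: "real \<Rightarrow> real \<times> real \<Rightarrow> real \<times> real" where
  "rot \<theta> z = (cos \<theta> * fst z - sin \<theta> * snd z, sin \<theta> * fst z + cos \<theta> * snd z)"

lemma rot_rot: "rot a (rot b z) = rot (a + b) z"
  by (simp add: rot_def cos_add sin_add algebra_simps)

lemma norm_rot: "(fst (rot \<theta> z))\<^sup>2 + (snd (rot \<theta> z))\<^sup>2 = (fst z)\<^sup>2 + (snd z)\<^sup>2"
proof -
  have "(fst (rot \<theta> z))\<^sup>2 + (snd (rot \<theta> z))\<^sup>2 = ((sin \<theta>)\<^sup>2 + (cos \<theta>)\<^sup>2) * ((fst z)\<^sup>2 + (snd z)\<^sup>2)"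
    unfolding rot_def fst_conv snd_conv by algebra
  then show ?thesis by simp
qed

lemma measurable_rot [measurable]: "rot \<theta> \<in> borel \<Otimes>\<^sub>M borel \<rightarrow>\<^sub>M borel \<Otimes>\<^sub>M borel"
  unfolding rot_def by measurable

lemma nn_integral_shear_fst:
  fixes g :: "real \<times> real \<Rightarrow> ennreal"
  assumes [measurable]: "g \<in> borel_measurable (borel \<Otimes>\<^sub>M borel)"
  shows "(\<integral>\<^sup>+z. g (fst z + c * snd z, snd z) \<partial>(lborel \<Otimes>\<^sub>M lborel)) = (\<integral>\<^sup>+z. g z \<partial>(lborel \<Otimes>\<^sub>M lborel))"
proof -
  have "(\<integral>\<^sup>+z. g (fst z + c * snd z, snd z) \<partial>(lborel \<Otimes>\<^sub>M lborel))
    = (\<integral>\<^sup>+y. \<integral>\<^sup>+x. g (c * y + 1 * x, y) \<partial>lborel \<partial>lborel)"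
    by (subst lborel_pair.nn_integral_snd[symmetric]) (simp_all add: add.commute)
  also have "\<dots> = (\<integral>\<^sup>+y. \<integral>\<^sup>+x. g (x, y) \<partial>lborel \<partial>lborel)"
  proof (rule nn_integral_cong)
    fix y :: real
    show "(\<integral>\<^sup>+x. g (c * y + 1 * x, y) \<partial>lborel) = (\<integral>\<^sup>+x. g (x, y) \<partial>lborel)"
      using nn_integral_real_affine[of "\<lambda>x. g (x, y)" 1 "c * y"] by simp
  qed
  also have "\<dots> = (\<integral>\<^sup>+z. g z \<partial>(lborel \<Otimes>\<^sub>M lborel))"
    by (rule lborel_pair.nn_integral_snd) simp
  finally show ?thesis .
qed

lemma nn_integral_shear_snd:
  fixes g :: "real \<times> real \<Rightarrow> ennreal"
  assumes [measurable]: "g \<in> borel_measurable (borel \<Otimes>\<^sub>M borel)"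
  shows "(\<integral>\<^sup>+z. g (fst z, snd z + c * fst z) \<partial>(lborel \<Otimes>\<^sub>M lborel)) = (\<integral>\<^sup>+z. g z \<partial>(lborel \<Otimes>\<^sub>M lborel))"
proof -
  have "(\<integral>\<^sup>+z. g (fst z, snd z + c * fst z) \<partial>(lborel \<Otimes>\<^sub>M lborel))
    = (\<integral>\<^sup>+x. \<integral>\<^sup>+y. g (x, c * x + 1 * y) \<partial>lborel \<partial>lborel)"
    by (subst lborel.nn_integral_fst[symmetric]) (simp_all add: add.commute)
  also have "\<dots> = (\<integral>\<^sup>+x. \<integral>\<^sup>+y. g (x, y) \<partial>lborel \<partial>lborel)"
  proof (rule nn_integral_cong)
    fix x :: real
    show "(\<integral>\<^sup>+y. g (x, c * x + 1 * y) \<partial>lborel) = (\<integral>\<^sup>+y. g (x, y) \<partial>lborel)"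
      using nn_integral_real_affine[of "\<lambda>y. g (x, y)" 1 "c * x"] by simp
  qed
  also have "\<dots> = (\<integral>\<^sup>+z. g z \<partial>(lborel \<Otimes>\<^sub>M lborel))"
    by (rule lborel.nn_integral_fst) simp
  finally show ?thesis .
qed

text \<open>A rotation through an angle that is not an odd multiple of \<open>\<pi>\<close> is a product of three shears.\<close>

lemma nn_integral_rot_aux:
  fixes g :: "real \<times> real \<Rightarrow> ennreal"
  assumes [measurable]: "g \<in> borel_measurable (borel \<Otimes>\<^sub>M borel)" and c: "cos (\<theta> / 2) \<noteq> 0"
  shows "(\<integral>\<^sup>+z. g (rot \<theta> z) \<partial>(lborel \<Otimes>\<^sub>M lborel)) = (\<integral>\<^sup>+z. g z \<partial>(lborel \<Otimes>\<^sub>M lborel))"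
proof -
  define k where "k = - tan (\<theta> / 2)"
  have \<theta>: "2 * (\<theta> / 2) = \<theta>" by simp
  have s: "sin \<theta> = 2 * sin (\<theta> / 2) * cos (\<theta> / 2)" using sin_double[of "\<theta> / 2"] unfolding \<theta> .
  have co: "cos \<theta> = 2 * (cos (\<theta> / 2))\<^sup>2 - 1" using cos_double_cos[of "\<theta> / 2"] unfolding \<theta> .
  have "k * sin \<theta> = - 2 * (sin (\<theta> / 2))\<^sup>2"
    using c by (simp add: k_def tan_def s power2_eq_square)
  then have 1: "1 + k * sin \<theta> = cos \<theta>"
    using sin_squared_eq[of "\<theta> / 2"] unfolding co by linarith
  have "k * (1 + cos \<theta>) = - sin \<theta>"
    unfolding s co using c by (simp add: k_def tan_def power2_eq_square)
  then have 2: "2 * k + k * k * sin \<theta> = - sin \<theta>"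
    unfolding 1[symmetric] by (simp add: algebra_simps)
  define S where "S z = (fst z + k * snd z, snd z)" for z :: "real \<times> real"
  define S' where "S' z = (fst z, snd z + sin \<theta> * fst z)" for z :: "real \<times> real"
  have "rot \<theta> z = S (S' (S z))" for z
  proof (rule prod_eqI)
    have "fst (S (S' (S z))) = (1 + k * sin \<theta>) * fst z + (2 * k + k * k * sin \<theta>) * snd z"
      by (simp add: S_def S'_def algebra_simps)
    then show "fst (rot \<theta> z) = fst (S (S' (S z)))" unfolding 1 2 by (simp add: rot_def)
    have "snd (S (S' (S z))) = sin \<theta> * fst z + (1 + k * sin \<theta>) * snd z"
      by (simp add: S_def S'_def algebra_simps)
    then show "snd (rot \<theta> z) = snd (S (S' (S z)))" unfolding 1 by (simp add: rot_def)
  qed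
  moreover have [measurable]: "S \<in> borel \<Otimes>\<^sub>M borel \<rightarrow>\<^sub>M borel \<Otimes>\<^sub>M borel" "S' \<in> borel \<Otimes>\<^sub>M borel \<rightarrow>\<^sub>M borel \<Otimes>\<^sub>M borel"
    unfolding S_def S'_def by measurable
  ultimately have "(\<integral>\<^sup>+z. g (rot \<theta> z) \<partial>(lborel \<Otimes>\<^sub>M lborel)) = (\<integral>\<^sup>+z. g (S (S' (S z))) \<partial>(lborel \<Otimes>\<^sub>M lborel))"
    by simp
  also have "\<dots> = (\<integral>\<^sup>+z. g (S (S' z)) \<partial>(lborel \<Otimes>\<^sub>M lborel))"
    using nn_integral_shear_fst[of "\<lambda>z. g (S (S' z))" k] by (simp add: S_def[symmetric])
  also have "\<dots> = (\<integral>\<^sup>+z. g (S z) \<partial>(lborel \<Otimes>\<^sub>M lborel))"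
    using nn_integral_shear_snd[of "\<lambda>z. g (S z)" "sin \<theta>"] by (simp add: S'_def[symmetric])
  also have "\<dots> = (\<integral>\<^sup>+z. g z \<partial>(lborel \<Otimes>\<^sub>M lborel))"
    using nn_integral_shear_fst[of g k] by (simp add: S_def[symmetric])
  finally show ?thesis .
qed

lemma nn_integral_rot:
  fixes g :: "real \<times> real \<Rightarrow> ennreal"
  assumes [measurable]: "g \<in> borel_measurable (borel \<Otimes>\<^sub>M borel)"
  shows "(\<integral>\<^sup>+z. g (rot \<theta> z) \<partial>(lborel \<Otimes>\<^sub>M lborel)) = (\<integral>\<^sup>+z. g z \<partial>(lborel \<Otimes>\<^sub>M lborel))"
proof (cases "cos (\<theta> / 2) = 0")
  case False
  then show ?thesis by (intro nn_integral_rot_aux) auto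
next
  case True
  have c: "cos ((\<theta> / 2) / 2) \<noteq> 0"
  proof
    assume "cos ((\<theta> / 2) / 2) = 0"
    then have "cos (2 * ((\<theta> / 2) / 2)) = -1" by (subst cos_double_cos) simp
    then show False using True by simp
  qed
  have "(\<integral>\<^sup>+z. g (rot \<theta> z) \<partial>(lborel \<Otimes>\<^sub>M lborel)) = (\<integral>\<^sup>+z. g (rot (\<theta> / 2) (rot (\<theta> / 2) z)) \<partial>(lborel \<Otimes>\<^sub>M lborel))"
    by (simp add: rot_rot)
  also have "\<dots> = (\<integral>\<^sup>+z. g (rot (\<theta> / 2) z) \<partial>(lborel \<Otimes>\<^sub>M lborel))"
    by (rule nn_integral_rot_aux[OF _ c]) simp
  also have "\<dots> = (\<integral>\<^sup>+z. g z \<partial>(lborel \<Otimes>\<^sub>M lborel))"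
    by (rule nn_integral_rot_aux[OF _ c]) simp
  finally show ?thesis .
qed

section \<open>The joint law of \<open>U\<close> and an independent copy, and its invariance under
  twists\<close>

definition square_law :: "(real \<times> real) measure" where
  "square_law = uniform_measure (lborel \<Otimes>\<^sub>M lborel) ({-1..1} \<times> {-1..1})"

lemma emeasure_square: "emeasure (lborel \<Otimes>\<^sub>M lborel) ({-1..1::real} \<times> {-1..1::real}) = 4"
  by (subst lborel.emeasure_pair_measure_Times) (auto simp flip: ennreal_mult)

lemma sets_square_law [measurable_cong, simp]: "sets square_law = sets (borel \<Otimes>\<^sub>M borel)"
  by (simp add: square_law_def cong: sets_pair_measure_cong)

lemma space_square_law [simp]: "space square_law = UNIV"
  by (simp add: square_law_def space_pair_measure)

lemma prob_space_square_law: "prob_space square_law"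
  unfolding square_law_def by (rule prob_space_uniform_measure) (simp_all add: emeasure_square)

lemma nn_integral_square_law:
  fixes g :: "real \<times> real \<Rightarrow> ennreal"
  assumes [measurable]: "g \<in> borel_measurable (borel \<Otimes>\<^sub>M borel)"
  shows "(\<integral>\<^sup>+z. g z \<partial>square_law)
    = (\<integral>\<^sup>+z. g z * indicator ({-1..1} \<times> {-1..1}) z \<partial>(lborel \<Otimes>\<^sub>M lborel)) / 4"
  unfolding square_law_def by (subst nn_integral_uniform_measure) (simp_all add: emeasure_square)

lemma nn_integral_square_law_fst:
  assumes [measurable]: "g \<in> borel_measurable borel"
  shows "(\<integral>\<^sup>+z. g (fst z) \<partial>square_law) = (\<integral>\<^sup>+x. g x \<partial>uniform_measure lborel {-1..1})"
proof -
  have "(\<integral>\<^sup>+z. g (fst z) * indicator ({-1..1} \<times> {-1..1::real}) z \<partial>(lborel \<Otimes>\<^sub>M lborel))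
    = (\<integral>\<^sup>+x. \<integral>\<^sup>+y. g x * indicator {-1..1} x * indicator {-1..1::real} y \<partial>lborel \<partial>lborel)"
    by (subst lborel.nn_integral_fst[symmetric]) (simp_all add: indicator_times mult.assoc)
  also have "\<dots> = (\<integral>\<^sup>+x. g x * indicator {-1..1} x \<partial>lborel) * 2"
    by (simp add: nn_integral_cmult nn_integral_multc)
  finally have "(\<integral>\<^sup>+z. g (fst z) \<partial>square_law) = (\<integral>\<^sup>+x. g x * indicator {-1..1} x \<partial>lborel) * 2 / 4"
    by (subst nn_integral_square_law) simp_all
  also have "\<dots> = (\<integral>\<^sup>+x. g x * indicator {-1..1} x \<partial>lborel) / 2"
  proof -
    have "x * 2 / 4 = x / (2::ennreal)" for x
    proof -
      have "x * 2 / 4 = x * (2 / 4)" by (simp add: ennreal_times_divide)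
      also have "(2::ennreal) / 4 = 1 / 2"
        using divide_ennreal[of 2 4] divide_ennreal[of 1 2] by simp
      finally show ?thesis by (simp add: ennreal_times_divide)
    qed
    then show ?thesis .
  qed
  also have "\<dots> = (\<integral>\<^sup>+x. g x \<partial>uniform_measure lborel {-1..1})"
    by (subst nn_integral_uniform_measure) simp_all
  finally show ?thesis .
qed

text \<open>The disc is cut into the \<open>m\<close> annuli \<open>j \<le> m * \<bar>z\<bar>\<^sup>2 < j + 1\<close>, and the \<open>j\<close>-th one is turned by the
  angle \<open>\<theta> j\<close>; the corners of the square stay fixed.\<close>

definition annulus :: "nat \<Rightarrow> real \<times> real \<Rightarrow> nat" where
  "annulus m z = nat \<lfloor>real m * ((fst z)\<^sup>2 + (snd z)\<^sup>2)\<rfloor>"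

definition twist :: "nat \<Rightarrow> (nat \<Rightarrow> real) \<Rightarrow> real \<times> real \<Rightarrow> real \<times> real" where
  "twist m \<theta> z = (if annulus m z < m then rot (\<theta> (annulus m z)) z else z)"

lemma annulus_rot [simp]: "annulus m (rot \<theta> z) = annulus m z"
  by (simp add: annulus_def norm_rot)

lemma measurable_annulus [measurable]: "annulus m \<in> borel \<Otimes>\<^sub>M borel \<rightarrow>\<^sub>M count_space UNIV"
  unfolding annulus_def by measurable

lemma annulus_less_imp:
  assumes "annulus m z < m"
  shows "z \<in> {-1..1} \<times> {-1..1}"
proof -
  have "\<lfloor>real m * ((fst z)\<^sup>2 + (snd z)\<^sup>2)\<rfloor> < int m"
    using assms unfolding annulus_def by linarith
  then have "real m * ((fst z)\<^sup>2 + (snd z)\<^sup>2) < real m * 1" by linarith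
  then have "(fst z)\<^sup>2 + (snd z)\<^sup>2 < 1" by (rule mult_left_less_imp_less) simp
  moreover have "0 \<le> (fst z)\<^sup>2" "0 \<le> (snd z)\<^sup>2" by auto
  ultimately have "(fst z)\<^sup>2 \<le> 1" "(snd z)\<^sup>2 \<le> 1" by linarith+
  then have "\<bar>fst z\<bar> \<le> 1" "\<bar>snd z\<bar> \<le> 1" by (auto simp: abs_square_le_1)
  then show ?thesis by (cases z) (auto simp: abs_le_iff)
qed

lemma measurable_twist [measurable]: "twist m \<theta> \<in> borel \<Otimes>\<^sub>M borel \<rightarrow>\<^sub>M borel \<Otimes>\<^sub>M borel"
  unfolding twist_def rot_def by measurable

text \<open>Split the square into the annuli and the rest. Each annulus is mapped to itself by its
  rotation, so the integral does not depend on the angles; with zero angles the twist is the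
  identity.\<close>

lemma nn_integral_twist:
  fixes g :: "real \<times> real \<Rightarrow> ennreal"
  assumes [measurable]: "g \<in> borel_measurable (borel \<Otimes>\<^sub>M borel)"
  shows "(\<integral>\<^sup>+z. g (twist m \<theta> z) \<partial>square_law) = (\<integral>\<^sup>+z. g z \<partial>square_law)"
proof -
  let ?L = "lborel \<Otimes>\<^sub>M lborel :: (real \<times> real) measure"
  let ?Q = "{-1..1} \<times> {-1..1} :: (real \<times> real) set"
  define k where "k j z = g z * indicator {z. annulus m z = j} z" for j z
  define r where "r z = g z * indicator (?Q \<inter> {z. \<not> annulus m z < m}) z" for z
  have [measurable]: "k j \<in> borel_measurable (borel \<Otimes>\<^sub>M borel)" for j unfolding k_def by measurable
  have [measurable]: "r \<in> borel_measurable (borel \<Otimes>\<^sub>M borel)" unfolding r_def by measurable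
  have split: "g (if annulus m z < m then rot (\<theta> (annulus m z)) z else z) * indicator ?Q z
      = (\<Sum>j<m. k j (rot (\<theta> j) z)) + r z" for \<theta> z
  proof (cases "annulus m z < m")
    case True
    have "(\<Sum>j<m. k j (rot (\<theta> j) z)) = (\<Sum>j<m. if j = annulus m z then g (rot (\<theta> j) z) else 0)"
      by (intro sum.cong) (auto simp: k_def)
    also have "\<dots> = g (rot (\<theta> (annulus m z)) z)" using True by (simp add: sum.delta)
    finally show ?thesis using True annulus_less_imp[OF True] by (simp add: r_def)
  next
    case False
    then have "(\<Sum>j<m. k j (rot (\<theta> j) z)) = 0" by (intro sum.neutral) (auto simp: k_def)
    then show ?thesis using False by (auto simp: r_def indicator_def)
  qed
  have int: "(\<integral>\<^sup>+z. g (twist m \<theta> z) \<partial>square_law) = ((\<Sum>j<m. \<integral>\<^sup>+z. k j z \<partial>?L) + (\<integral>\<^sup>+z. r z \<partial>?L)) / 4" for \<theta>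
  proof -
    have "(\<integral>\<^sup>+z. g (twist m \<theta> z) \<partial>square_law) = (\<integral>\<^sup>+z. (\<Sum>j<m. k j (rot (\<theta> j) z)) + r z \<partial>?L) / 4"
      by (subst nn_integral_square_law) (simp_all add: split twist_def)
    also have "(\<integral>\<^sup>+z. (\<Sum>j<m. k j (rot (\<theta> j) z)) + r z \<partial>?L)
        = (\<Sum>j<m. \<integral>\<^sup>+z. k j (rot (\<theta> j) z) \<partial>?L) + (\<integral>\<^sup>+z. r z \<partial>?L)"
      by (subst nn_integral_add) (simp_all add: nn_integral_sum)
    finally show ?thesis by (simp add: nn_integral_rot)
  qed
  have "twist m (\<lambda>_. 0) z = z" for z by (simp add: twist_def rot_def)
  then show ?thesis using int[of \<theta>] int[of "\<lambda>_. 0"] by simp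
qed

text \<open>\<open>snd z\<close> is the amplitude of the sine term when the annulus turns. Were its
  second moment zero, it would vanish almost everywhere on a nonempty open part of the
  annulus.\<close>

lemma annulus_second_moment_pos:
  assumes "j < m"
  shows "0 < (\<integral>z. (if annulus m z = j then (snd z)\<^sup>2 else 0) \<partial>square_law)"
proof -
  let ?f = "\<lambda>z. if annulus m z = j then (snd z)\<^sup>2 else 0 :: real"
  interpret prob_space square_law by (rule prob_space_square_law)
  have bd: "norm (?f z) \<le> 1" for z
    using annulus_less_imp[of m z] assms by (auto simp: abs_square_le_1 abs_le_iff mem_Times_iff)
  have int: "integrable square_law ?f"
    by (rule integrable_const_bound[of _ 1]) (use bd in auto)
  have "(\<integral>z. ?f z \<partial>square_law) \<noteq> 0"
  proof
    assume "(\<integral>z. ?f z \<partial>square_law) = 0"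
    then have "AE z in square_law. ?f z = 0"
      using int by (subst (asm) integral_nonneg_eq_0_iff_AE) auto
    then have ae: "AE z in lborel \<Otimes>\<^sub>M lborel. z \<in> {-1..1} \<times> {-1..1} \<longrightarrow> ?f z = 0"
      unfolding square_law_def by (subst (asm) AE_uniform_measure) (simp_all add: emeasure_square)
    define O' where "O' = {z :: real \<times> real. real j < real m * ((fst z)\<^sup>2 + (snd z)\<^sup>2) \<and>
      real m * ((fst z)\<^sup>2 + (snd z)\<^sup>2) < real j + 1 \<and> snd z \<noteq> 0}"
    have op: "open O'" unfolding O'_def
      by (intro open_Collect_conj open_Collect_less open_Collect_neq continuous_intros)
    \<comment> \<open>The point on the vertical axis at the middle squared radius of the
      annulus.\<close>
    have "(0, sqrt ((real j + 1 / 2) / real m)) \<in> O'"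
      using assms by (auto simp: O'_def)
    then have ne: "O' \<noteq> {}" by auto
    have "?f z \<noteq> 0 \<and> z \<in> {-1..1} \<times> {-1..1}" if "z \<in> O'" for z
    proof -
      have "\<lfloor>real m * ((fst z)\<^sup>2 + (snd z)\<^sup>2)\<rfloor> = int j"
        using that by (auto simp: O'_def floor_eq_iff)
      then have "annulus m z = j" by (simp add: annulus_def)
      then show ?thesis using annulus_less_imp[of m z] that assms by (auto simp: O'_def)
    qed
    with ae have "AE z in lborel. z \<notin> O'"
      unfolding lborel_prod[symmetric] by (auto elim!: eventually_mono)
    then have "O' \<in> null_sets lborel"
      using op by (subst (asm) AE_iff_null_sets[symmetric]) auto
    then have "negligible O'" by (simp add: negligible_iff_null_sets null_sets_completionI)
    then show False using op ne open_not_negligible by blast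
  qed
  moreover have "0 \<le> (\<integral>z. ?f z \<partial>square_law)" by (intro integral_nonneg_AE) auto
  ultimately show ?thesis by linarith
qed

text \<open>A sample point \<open>(z, e, v)\<close> of one coordinate carries the variables \<open>U = fst z\<close>, \<open>\<epsilon> = e\<close> and
  \<open>V = v\<close> of the class \<open>\<C>(p, \<alpha>)\<close>; \<open>snd z\<close> is an auxiliary independent copy of \<open>U\<close>.\<close>

definition curve :: "nat \<Rightarrow> real \<Rightarrow> real \<Rightarrow> (nat \<Rightarrow> real) \<Rightarrow> (real \<times> real) \<times> (real \<times> real) \<Rightarrow> real" where
  "curve m \<alpha> x0 \<theta> w = (if fst (snd w) = 1 then \<alpha> * fst (twist m \<theta> (fst w)) + x0
    else fst (snd w) * (\<alpha> * fst (fst w) + x0) + (1 - fst (snd w)) * snd (snd w))"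

lemma measurable_curve [measurable]:
  "curve m \<alpha> x0 \<theta> \<in> borel_measurable ((borel \<Otimes>\<^sub>M borel) \<Otimes>\<^sub>M (borel \<Otimes>\<^sub>M borel))"
  unfolding curve_def by measurable

text \<open>\<tau> is the joint law of \<epsilon> and V. Given these, the twist preserves the law of
  the square, whose first marginal is that of U, so the law of the curve is the same for all angles.
  \<open>x0\<close> and \<tau> are fixed before m and the angles.\<close>

lemma class_C_coupling:
  assumes "class_C M p \<alpha> X"
  obtains x0 and \<tau> :: "(real \<times> real) measure" where "prob_space \<tau>"
    "sets \<tau> = sets (borel \<Otimes>\<^sub>M borel)" "measure \<tau> {ev. fst ev = 1} = p"
    "\<And>m \<theta>. distr (square_law \<Otimes>\<^sub>M \<tau>) borel (curve m \<alpha> x0 \<theta>) = distr M borel X"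
proof -
  obtain x0 and P :: "(real \<times> real \<times> real) measure" and U \<epsilon> V where
    P: "prob_space P" "prob_space.indep_vars P (\<lambda>_. borel) (\<lambda>k. [U, \<epsilon>, V] ! k) {..<3}"
    and U: "distr P borel U = uniform_measure lborel {-1..1}"
    and \<epsilon>: "measure P {\<omega> \<in> space P. \<epsilon> \<omega> = 1} = p"
    and X: "distr M borel X = distr P borel (\<lambda>\<omega>. \<epsilon> \<omega> * (\<alpha> * U \<omega> + x0) + (1 - \<epsilon> \<omega>) * V \<omega>)"
    using assms unfolding class_C_def by blast
  interpret P: prob_space P by (rule P(1))
  have rv: "[U, \<epsilon>, V] ! k \<in> borel_measurable P" if "k < 3" for k
    using P(2) that unfolding P.indep_vars_def2 by auto
  have [measurable]: "U \<in> borel_measurable P" "\<epsilon> \<in> borel_measurable P" "V \<in> borel_measurable P"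
    using rv[of 0] rv[of 1] rv[of 2] by (simp_all add: numeral_2_eq_2)
  define \<tau> where "\<tau> = distr P (borel \<Otimes>\<^sub>M borel) (\<lambda>\<omega>. (\<epsilon> \<omega>, V \<omega>))"
  interpret \<tau>: prob_space \<tau> unfolding \<tau>_def by (rule P.prob_space_distr) measurable
  have sets_\<tau> [measurable_cong, simp]: "sets \<tau> = sets (borel \<Otimes>\<^sub>M borel)" by (simp add: \<tau>_def)
  interpret S: prob_space square_law by (rule prob_space_square_law)
  interpret Un: prob_space "uniform_measure lborel {-1..1::real}"
    unfolding U[symmetric] by (rule P.prob_space_distr) measurable
  interpret S\<tau>: pair_sigma_finite square_law \<tau> ..
  interpret U\<tau>: pair_sigma_finite "uniform_measure lborel {-1..1::real}" \<tau> ..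
  let ?r = "\<lambda>\<omega>. restrict (\<lambda>k. ([U, \<epsilon>, V] ! k) \<omega>) {0}"
  let ?s = "\<lambda>\<omega>. restrict (\<lambda>k. ([U, \<epsilon>, V] ! k) \<omega>) {1, 2}"
  \<comment> \<open>Grouping the index sets {0} and {1, 2} turns the independence of three variables
    into that of U and the pair (\<epsilon>, V).\<close>
  have "P.indep_var (PiM {0} (\<lambda>_. borel)) ?r (PiM {1, 2} (\<lambda>_. borel)) ?s"
    by (rule P.indep_var_restrict[OF P(2)]) auto
  then have "distr P (PiM {0} (\<lambda>_. borel)) ?r \<Otimes>\<^sub>M distr P (PiM {1, 2} (\<lambda>_. borel)) ?s
      = distr P (PiM {0} (\<lambda>_. borel) \<Otimes>\<^sub>M PiM {1, 2} (\<lambda>_. borel)) (\<lambda>\<omega>. (?r \<omega>, ?s \<omega>))"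
    and [measurable]: "?r \<in> P \<rightarrow>\<^sub>M PiM {0} (\<lambda>_. borel)" "?s \<in> P \<rightarrow>\<^sub>M PiM {1, 2} (\<lambda>_. borel)"
    unfolding P.indep_var_distribution_eq by blast+
  note pair = this(1)
  have \<tau>_s: "\<tau> = distr (distr P (PiM {1, 2} (\<lambda>_. borel)) ?s) (borel \<Otimes>\<^sub>M borel) (\<lambda>f. (f 1, f 2))"
    unfolding \<tau>_def by (subst distr_distr) (measurable, simp add: o_def)
  have U_r: "uniform_measure lborel {-1..1} = distr (distr P (PiM {0} (\<lambda>_. borel)) ?r) borel (\<lambda>f. f 0)"
    unfolding U[symmetric] by (subst distr_distr) (measurable, simp add: o_def)
  have joint: "uniform_measure lborel {-1..1} \<Otimes>\<^sub>M \<tau>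
      = distr P (borel \<Otimes>\<^sub>M (borel \<Otimes>\<^sub>M borel)) (\<lambda>\<omega>. (U \<omega>, \<epsilon> \<omega>, V \<omega>))"
  proof -
    have "sigma_finite_measure (distr (distr P (PiM {1, 2} (\<lambda>_. borel)) ?s) (borel \<Otimes>\<^sub>M borel) (\<lambda>f. (f 1, f 2)))"
      unfolding \<tau>_s[symmetric] by (rule \<tau>.sigma_finite_measure)
    then have "uniform_measure lborel {-1..1} \<Otimes>\<^sub>M \<tau>
      = distr (distr P (PiM {0} (\<lambda>_. borel)) ?r \<Otimes>\<^sub>M distr P (PiM {1, 2} (\<lambda>_. borel)) ?s)
          (borel \<Otimes>\<^sub>M (borel \<Otimes>\<^sub>M borel)) (\<lambda>(f, g). (f 0, g 1, g 2))"
      unfolding \<tau>_s U_r by (intro pair_measure_distr) measurable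
    also have "\<dots> = distr P (borel \<Otimes>\<^sub>M (borel \<Otimes>\<^sub>M borel)) (\<lambda>\<omega>. (U \<omega>, \<epsilon> \<omega>, V \<omega>))"
      unfolding pair by (subst distr_distr) (measurable, simp add: o_def)
    finally show ?thesis .
  qed
  show ?thesis
  proof
    show "prob_space \<tau>" by unfold_locales
    show "sets \<tau> = sets (borel \<Otimes>\<^sub>M borel)" by simp
    have "measure \<tau> {ev. fst ev = 1} = measure P ((\<lambda>\<omega>. (\<epsilon> \<omega>, V \<omega>)) -` {ev. fst ev = 1} \<inter> space P)"
    proof -
      have "{ev \<in> space (borel \<Otimes>\<^sub>M borel). fst ev = (1::real)} \<in> sets (borel \<Otimes>\<^sub>M (borel :: real measure))"
        by measurable
      then have "{ev :: real \<times> real. fst ev = 1} \<in> sets (borel \<Otimes>\<^sub>M borel)" by (simp add: space_pair_measure)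
      then show ?thesis unfolding \<tau>_def by (intro measure_distr) auto
    qed
    also have "\<dots> = p" unfolding \<epsilon>[symmetric] by (rule arg_cong[of _ _ "measure P"]) auto
    finally show "measure \<tau> {ev. fst ev = 1} = p" .
    fix m \<theta>
    show "distr (square_law \<Otimes>\<^sub>M \<tau>) borel (curve m \<alpha> x0 \<theta>) = distr M borel X"
    proof (rule measure_eqI)
      show "sets (distr (square_law \<Otimes>\<^sub>M \<tau>) borel (curve m \<alpha> x0 \<theta>)) = sets (distr M borel X)" by simp
      fix A assume "A \<in> sets (distr (square_law \<Otimes>\<^sub>M \<tau>) borel (curve m \<alpha> x0 \<theta>))"
      then have A [measurable]: "A \<in> sets borel" by simp
      define b where "b u ev = fst ev * (\<alpha> * u + x0) + (1 - fst ev) * snd ev" for u :: real and ev :: "real \<times> real"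
      have [measurable]: "(\<lambda>w. b (fst w) (snd w)) \<in> borel_measurable (borel \<Otimes>\<^sub>M (borel \<Otimes>\<^sub>M borel))"
        unfolding b_def by measurable
      have "emeasure (distr (square_law \<Otimes>\<^sub>M \<tau>) borel (curve m \<alpha> x0 \<theta>)) A
          = (\<integral>\<^sup>+w. indicator A w \<partial>distr (square_law \<Otimes>\<^sub>M \<tau>) borel (curve m \<alpha> x0 \<theta>))"
        by simp
      also have "\<dots> = (\<integral>\<^sup>+w. indicator A (curve m \<alpha> x0 \<theta> w) \<partial>(square_law \<Otimes>\<^sub>M \<tau>))"
        by (subst nn_integral_distr) measurable
      also have "\<dots> = (\<integral>\<^sup>+ev. \<integral>\<^sup>+z. indicator A (curve m \<alpha> x0 \<theta> (z, ev)) \<partial>square_law \<partial>\<tau>)"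
        by (rule S\<tau>.nn_integral_snd[symmetric]) measurable
      also have "\<dots> = (\<integral>\<^sup>+ev. \<integral>\<^sup>+u. indicator A (b u ev) \<partial>uniform_measure lborel {-1..1} \<partial>\<tau>)"
      proof (rule nn_integral_cong)
        fix ev :: "real \<times> real"
        have [measurable]: "(\<lambda>u. b u ev) \<in> borel_measurable borel" unfolding b_def by measurable
        have "(\<integral>\<^sup>+z. indicator A (curve m \<alpha> x0 \<theta> (z, ev)) \<partial>square_law) = (\<integral>\<^sup>+z. indicator A (b (fst z) ev) \<partial>square_law)"
        proof (cases "fst ev = 1")
          \<comment> \<open>The twist acts only for \<epsilon> = 1; otherwise the curve is the
            original mixture, constant in the angles.\<close>
          case True
          have "(\<integral>\<^sup>+z. indicator A (b (fst (twist m \<theta> z)) ev) \<partial>square_law) = (\<integral>\<^sup>+z. indicator A (b (fst z) ev) \<partial>square_law)"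
            by (rule nn_integral_twist[of "\<lambda>z. indicator A (b (fst z) ev)"]) measurable
          then show ?thesis using True by (simp add: curve_def b_def)
        qed (simp add: curve_def b_def)
        also have "\<dots> = (\<integral>\<^sup>+u. indicator A (b u ev) \<partial>uniform_measure lborel {-1..1})"
          by (rule nn_integral_square_law_fst[of "\<lambda>u. indicator A (b u ev)"]) measurable
        finally show "(\<integral>\<^sup>+z. indicator A (curve m \<alpha> x0 \<theta> (z, ev)) \<partial>square_law)
            = (\<integral>\<^sup>+u. indicator A (b u ev) \<partial>uniform_measure lborel {-1..1})" .
      qed
      also have "\<dots> = (\<integral>\<^sup>+w. indicator A (b (fst w) (snd w)) \<partial>(uniform_measure lborel {-1..1} \<Otimes>\<^sub>M \<tau>))"
        using U\<tau>.nn_integral_snd[of "\<lambda>w. indicator A (b (fst w) (snd w))"] by simp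
      also have "\<dots> = (\<integral>\<^sup>+\<omega>. indicator A (b (U \<omega>) (\<epsilon> \<omega>, V \<omega>)) \<partial>P)"
        unfolding joint by (subst nn_integral_distr) simp_all
      also have "\<dots> = (\<integral>\<^sup>+x. indicator A x \<partial>distr M borel X)"
        unfolding X b_def by (subst nn_integral_distr) simp_all
      finally show "emeasure (distr (square_law \<Otimes>\<^sub>M \<tau>) borel (curve m \<alpha> x0 \<theta>)) A = emeasure (distr M borel X) A"
        by simp
    qed
  qed
qed

section \<open>Low influences\<close>

text \<open>Chebyshev's inequality: weight products over disjoint sets are uncorrelated, and small
  influences leave little mass on pairs of sets that meet. The variance is at most d t, and
  deviating by half the mean \<open>\<mu> ^ d\<close> gives the factor 4.\<close>

lemma second_moment_concentration:
  fixes K :: "nat \<Rightarrow> 'a measure" and w :: "nat \<Rightarrow> 'a \<Rightarrow> real" and c :: "nat set \<Rightarrow> real"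
  assumes I: "I = {1..N}" and K: "\<And>i. prob_space (K i)"
    and w [measurable]: "\<And>i. i \<in> I \<Longrightarrow> w i \<in> borel_measurable (K i)"
    and w01: "\<And>i x. i \<in> I \<Longrightarrow> 0 \<le> w i x \<and> w i x \<le> 1"
    and mean: "\<And>i. i \<in> I \<Longrightarrow> (\<integral>x. w i x \<partial>K i) = \<mu>" and "\<mu> > 0"
    and c0: "\<And>S. c S \<ge> 0" and c1: "(\<Sum>S\<in>ksets d N. c S) = 1"
    and infl: "\<And>i. i \<in> I \<Longrightarrow> (\<Sum>T\<in>{T\<in>ksets d N. i \<in> T}. c T) \<le> t"
  shows "measure (PiM I K) {\<omega>\<in>space (PiM I K). (\<Sum>S\<in>ksets d N. c S * (\<Prod>i\<in>S. w i (\<omega> i))) \<le> \<mu> ^ d / 2}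
    \<le> 4 * real d * t / (\<mu> ^ d)\<^sup>2"
proof -
  interpret product_prob_space K I
    by (rule product_prob_spaceI) (rule K)
  have fI: "finite I" by (simp add: I)
  have sub: "S \<subseteq> I" "finite S" "card S = d" if "S \<in> ksets d N" for S
    using ksetsD[OF that] by (auto simp: I)
  define W where "W A \<omega> = (\<Prod>i\<in>A. w i (\<omega> i))" for A \<omega>
  have Wm [measurable]: "W A \<in> borel_measurable (PiM I K)" if "A \<subseteq> I" for A
    unfolding W_def
  proof (intro borel_measurable_prod)
    fix i assume "i \<in> A"
    then have "i \<in> I" using that by auto
    then show "(\<lambda>\<omega>. w i (\<omega> i)) \<in> borel_measurable (PiM I K)"
      by (intro measurable_compose[OF measurable_component_singleton[of i I K] w[of i]])
  qed
  have W01: "0 \<le> W A \<omega> \<and> W A \<omega> \<le> 1" if "A \<subseteq> I" for A \<omega>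
    unfolding W_def using w01 that by (auto intro!: prod_nonneg prod_le_1)
  have iw: "integrable (K i) (w i)" if "i \<in> I" for i
    using that w01 by (intro M.integrable_const_bound[where B = 1]) auto
  have EW: "(\<integral>\<omega>. W A \<omega> \<partial>PiM I K) = \<mu> ^ card A" if A: "A \<subseteq> I" for A
  proof -
    have "(\<integral>\<omega>. W A \<omega> \<partial>PiM I K) = (\<integral>\<omega>. (\<Prod>i\<in>I. (\<lambda>x. if i \<in> A then w i x else 1) (\<omega> i)) \<partial>PiM I K)"
    proof (rule arg_cong[of _ _ "integral\<^sup>L (PiM I K)"], rule ext)
      fix \<omega>
      have "W A \<omega> = (\<Prod>i\<in>I. if i \<in> A then w i (\<omega> i) else 1)"
        unfolding W_def using A fI by (simp add: prod.If_cases Int_absorb1)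
      then show "W A \<omega> = (\<Prod>i\<in>I. (\<lambda>x. if i \<in> A then w i x else 1) (\<omega> i))" by simp
    qed
    also have "\<dots> = (\<Prod>i\<in>I. \<integral>x. (if i \<in> A then w i x else 1) \<partial>K i)"
    proof (rule product_integral_prod[OF fI])
      fix i assume "i \<in> I"
      then show "integrable (K i) (\<lambda>x. if i \<in> A then w i x else 1)"
        using iw[of i] by (cases "i \<in> A") simp_all
    qed
    also have "\<dots> = (\<Prod>i\<in>I. if i \<in> A then \<mu> else 1)"
      using mean by (intro prod.cong) (auto simp: M.prob_space)
    also have "\<dots> = \<mu> ^ card A" using A fI by (simp add: prod.If_cases Int_absorb1)
    finally show ?thesis .
  qed
  have iW2: "integrable (PiM I K) (\<lambda>\<omega>. W A \<omega> * W B \<omega>)" if "A \<subseteq> I" "B \<subseteq> I" for A B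
    by (rule P.integrable_const_bound[of _ 1]) (use W01 that in \<open>auto simp: abs_mult intro!: mult_le_one\<close>)
  have iW: "integrable (PiM I K) (W A)" if "A \<subseteq> I" for A
    by (rule P.integrable_const_bound[of _ 1]) (use W01 that in auto)
  define v where "v \<omega> = (\<Sum>S\<in>ksets d N. c S * W S \<omega>)" for \<omega>
  have vm [measurable]: "v \<in> borel_measurable (PiM I K)"
    unfolding v_def by (intro borel_measurable_sum borel_measurable_times Wm sub) auto
  have Ev: "P.expectation v = \<mu> ^ d"
  proof -
    have "P.expectation v = (\<Sum>S\<in>ksets d N. c S * \<mu> ^ d)"
      unfolding v_def using sub by (subst Bochner_Integration.integral_sum) (auto simp: iW EW)
    then show ?thesis by (simp add: sum_distrib_right[symmetric] c1)
  qed
  have v2: "(v \<omega>)\<^sup>2 = (\<Sum>S\<in>ksets d N. \<Sum>T\<in>ksets d N. (c S * c T) * (W S \<omega> * W T \<omega>))" for \<omega>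
    by (simp add: v_def power2_eq_square sum_product mult_ac)
  have iv2: "integrable (PiM I K) (\<lambda>\<omega>. (v \<omega>)\<^sup>2)"
    unfolding v2 by (intro Bochner_Integration.integrable_sum integrable_mult_right iW2 sub)
  have iv: "integrable (PiM I K) v"
    unfolding v_def by (intro Bochner_Integration.integrable_sum integrable_mult_right iW sub)
  have "P.expectation (\<lambda>\<omega>. (v \<omega>)\<^sup>2)
      = (\<Sum>S\<in>ksets d N. \<Sum>T\<in>ksets d N. (c S * c T) * (\<integral>\<omega>. W S \<omega> * W T \<omega> \<partial>PiM I K))"
    unfolding v2 using sub
    by (subst Bochner_Integration.integral_sum)
       (auto intro!: Bochner_Integration.integrable_sum integrable_mult_right iW2 sum.cong
         simp: Bochner_Integration.integral_sum iW2)
  \<comment> \<open>For disjoint sets independence gives the product of the means; otherwise the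
    weights are simply bounded by 1.\<close>
  also have "\<dots> \<le> (\<Sum>S\<in>ksets d N. \<Sum>T\<in>ksets d N. (c S * c T) * ((\<mu> ^ d)\<^sup>2 + (if S \<inter> T = {} then 0 else 1)))"
  proof (intro sum_mono mult_left_mono)
    fix S T assume S: "S \<in> ksets d N" and T: "T \<in> ksets d N"
    show "(\<integral>\<omega>. W S \<omega> * W T \<omega> \<partial>PiM I K) \<le> (\<mu> ^ d)\<^sup>2 + (if S \<inter> T = {} then 0 else 1)"
    proof (cases "S \<inter> T = {}")
      case True
      have "(\<lambda>\<omega>. W S \<omega> * W T \<omega>) = W (S \<union> T)"
        unfolding W_def using sub[OF S] sub[OF T] True by (simp add: prod.union_disjoint)
      then show ?thesis
        using EW[of "S \<union> T"] sub[OF S] sub[OF T] True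
        by (simp add: card_Un_disjoint power_add power2_eq_square)
    next
      case False
      have "(\<integral>\<omega>. W S \<omega> * W T \<omega> \<partial>PiM I K) \<le> (\<integral>\<omega>. 1 \<partial>PiM I K)"
        by (rule integral_mono) (use iW2 sub S T W01 in \<open>auto intro!: mult_le_one\<close>)
      then show ?thesis using False by (simp add: P.prob_space add_increasing)
    qed
  qed (use c0 in auto)
  also have "\<dots> = (\<mu> ^ d)\<^sup>2 + (\<Sum>S\<in>ksets d N. c S * (\<Sum>T\<in>ksets d N. if S \<inter> T = {} then 0 else c T))"
  proof -
    have "(\<Sum>S\<in>ksets d N. \<Sum>T\<in>ksets d N. (c S * c T) * (\<mu> ^ d)\<^sup>2) = (\<mu> ^ d)\<^sup>2"
      by (simp add: sum_distrib_right[symmetric] sum_distrib_left[symmetric] c1)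
    moreover have "(\<Sum>S\<in>ksets d N. \<Sum>T\<in>ksets d N. (c S * c T) * (if S \<inter> T = {} then 0 else 1))
        = (\<Sum>S\<in>ksets d N. c S * (\<Sum>T\<in>ksets d N. if S \<inter> T = {} then 0 else c T))"
      unfolding sum_distrib_left by (intro sum.cong) auto
    ultimately show ?thesis unfolding distrib_left sum.distrib by simp
  qed
  also have "(\<Sum>S\<in>ksets d N. c S * (\<Sum>T\<in>ksets d N. if S \<inter> T = {} then 0 else c T)) \<le> (\<Sum>S\<in>ksets d N. c S * (real d * t))"
  proof (intro sum_mono mult_left_mono c0)
    fix S assume S: "S \<in> ksets d N"
    \<comment> \<open>A set that meets \<open>S\<close> contains one of its d elements, and each
      element has influence at most t.\<close>
    have "(\<Sum>T\<in>ksets d N. if S \<inter> T = {} then 0 else c T) \<le> (\<Sum>T\<in>ksets d N. \<Sum>i\<in>S. if i \<in> T then c T else 0)"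
    proof (intro sum_mono)
      fix T
      show "(if S \<inter> T = {} then 0 else c T) \<le> (\<Sum>i\<in>S. if i \<in> T then c T else 0)"
      proof (cases "S \<inter> T = {}")
        case False
        then obtain i where i: "i \<in> S" "i \<in> T" by auto
        then have "c T \<le> (\<Sum>i\<in>S. if i \<in> T then c T else 0)"
          using member_le_sum[of i S "\<lambda>i. if i \<in> T then c T else 0"] c0 sub[OF S] by auto
        then show ?thesis using False by simp
      qed (auto intro!: sum_nonneg c0)
    qed
    also have "\<dots> = (\<Sum>i\<in>S. \<Sum>T\<in>{T\<in>ksets d N. i \<in> T}. c T)"
      by (subst sum.swap) (simp add: sum.inter_filter)
    also have "\<dots> \<le> (\<Sum>i\<in>S. t)" using sub[OF S] by (intro sum_mono infl) auto
    also have "\<dots> = real d * t" using sub[OF S] by simp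
    finally show "(\<Sum>T\<in>ksets d N. if S \<inter> T = {} then 0 else c T) \<le> real d * t" .
  qed
  also have "\<dots> = real d * t" by (simp add: sum_distrib_right[symmetric] c1)
  finally have var: "P.variance v \<le> real d * t"
    using P.variance_eq[OF iv iv2] by (simp add: Ev)
  have "measure (PiM I K) {\<omega>\<in>space (PiM I K). v \<omega> \<le> \<mu> ^ d / 2}
      \<le> measure (PiM I K) {\<omega>\<in>space (PiM I K). \<mu> ^ d / 2 \<le> \<bar>v \<omega> - P.expectation v\<bar>}"
    unfolding Ev by (intro P.finite_measure_mono) (auto simp: abs_if field_simps)
  also have "\<dots> \<le> P.variance v / (\<mu> ^ d / 2)\<^sup>2"
    using \<open>\<mu> > 0\<close> by (intro P.Chebyshev_inequality iv2) auto
  also have "\<dots> \<le> real d * t / (\<mu> ^ d / 2)\<^sup>2"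
    using var by (intro divide_right_mono) auto
  also have "\<dots> = 4 * real d * t / (\<mu> ^ d)\<^sup>2" by (simp add: power_divide)
  finally show ?thesis by (simp add: v_def W_def)
qed

section \<open>From weak convergence to total variation\<close>

lemma (in real_distribution) borel_sandwich:
  assumes A: "A \<in> sets borel" and "\<delta> > 0"
  obtains C U where "compact C" "open U" "C \<subseteq> A" "A \<subseteq> U" "measure M (U - C) \<le> \<delta>"
proof -
  have fin: "emeasure M (space M) \<noteq> \<infinity>" by (simp add: emeasure_space_1)
  have "\<exists>C. compact C \<and> C \<subseteq> A \<and> measure M A - \<delta> / 2 \<le> measure M C"
  proof (cases "measure M A \<le> \<delta> / 2")
    case True
    then show ?thesis by (intro exI[of _ "{}"]) simp
  next
    case False
    then have "ennreal (measure M A - \<delta> / 2) < emeasure M A"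
      using \<open>\<delta> > 0\<close> by (simp add: emeasure_eq_measure ennreal_less_iff)
    also have "\<dots> = (SUP C\<in>{C. C \<subseteq> A \<and> compact C}. emeasure M C)"
      by (rule inner_regular[OF events_eq_borel fin A])
    finally obtain C where "C \<subseteq> A" "compact C" "ennreal (measure M A - \<delta> / 2) < emeasure M C"
      unfolding less_SUP_iff by auto
    then show ?thesis using False by (auto simp: emeasure_eq_measure ennreal_less_iff)
  qed
  then obtain C where C: "compact C" "C \<subseteq> A" "measure M A - \<delta> / 2 \<le> measure M C" by auto
  have "(INF U\<in>{U. A \<subseteq> U \<and> open U}. emeasure M U) = emeasure M A"
    by (rule outer_regular[OF events_eq_borel fin A, symmetric])
  also have "\<dots> < ennreal (measure M A + \<delta> / 2)"
    using \<open>\<delta> > 0\<close> by (simp add: emeasure_eq_measure ennreal_less_iff)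
  finally obtain U where U: "A \<subseteq> U" "open U" "emeasure M U < ennreal (measure M A + \<delta> / 2)"
    unfolding INF_less_iff by auto
  have "measure M (U - C) = measure M U - measure M C"
    using C U by (intro finite_measure_Diff) (auto simp: events_eq_borel intro: borel_compact)
  also have "measure M U < measure M A + \<delta> / 2"
    using U(3) by (simp add: emeasure_eq_measure ennreal_less_iff del: ennreal_plus)
  then have "measure M U - measure M C \<le> \<delta>" using C(3) by linarith
  finally show ?thesis using that C U by blast
qed

text \<open>A Urysohn function replaces the indicator of \<open>A\<close> with small error under
  both laws. This reduces total variation to continuous test functions, the ones for which the
  integration by parts has an antiderivative.\<close>

lemma measure_diff_le_of_continuous:
  assumes M: "real_distribution M" and N: "real_distribution N" and A: "A \<in> sets borel"
    and e: "\<And>\<phi>. continuous_on UNIV \<phi> \<Longrightarrow> (\<And>x. \<bar>\<phi> x\<bar> \<le> 1)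
      \<Longrightarrow> \<bar>(\<integral>x. \<phi> x \<partial>M) - (\<integral>x. \<phi> x \<partial>N)\<bar> \<le> e"
  shows "\<bar>measure M A - measure N A\<bar> \<le> e"
proof (rule field_le_epsilon)
  fix \<delta> :: real assume \<delta>: "\<delta> > 0"
  interpret M: real_distribution M by (rule M)
  interpret N: real_distribution N by (rule N)
  obtain C1 U1 where 1: "compact C1" "open U1" "C1 \<subseteq> A" "A \<subseteq> U1" "measure M (U1 - C1) \<le> \<delta> / 2"
    using M.borel_sandwich[OF A] \<delta> by (metis half_gt_zero)
  obtain C2 U2 where 2: "compact C2" "open U2" "C2 \<subseteq> A" "A \<subseteq> U2" "measure N (U2 - C2) \<le> \<delta> / 2"
    using N.borel_sandwich[OF A] \<delta> by (metis half_gt_zero)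
  \<comment> \<open>The union of the inner sets and the intersection of the outer ones are good for
    both laws at once.\<close>
  define C U where "C = C1 \<union> C2" and "U = U1 \<inter> U2"
  have CU: "closed C" "closed (- U)" "C \<inter> - U = {}" "C \<subseteq> A" "A \<subseteq> U"
    using 1 2 compact_imp_closed by (auto simp: C_def U_def intro!: closed_Un)
  obtain \<phi> :: "real \<Rightarrow> real" where \<phi>: "continuous_on UNIV \<phi>" "\<And>x. \<phi> x \<in> closed_segment 1 0"
    "\<And>x. x \<in> C \<Longrightarrow> \<phi> x = 1" "\<And>x. x \<in> - U \<Longrightarrow> \<phi> x = 0"
    using Urysohn[OF CU(1-3)] by metis
  have \<phi>01: "0 \<le> \<phi> x \<and> \<phi> x \<le> 1" for x using \<phi>(2)[of x] by (auto simp: closed_segment_eq_real_ivl)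
  have [measurable]: "\<phi> \<in> borel_measurable borel" by (intro borel_measurable_continuous_onI \<phi>)
  have UC: "U - C \<in> sets borel" using CU(1,2) by (auto simp: closed_def)
  have pw: "\<bar>\<phi> x - indicator A x\<bar> \<le> indicator (U - C) x" for x
    using \<phi>01[of x] \<phi>(3,4)[of x] CU by (auto simp: indicator_def)
  have approx: "\<bar>(\<integral>x. \<phi> x \<partial>L) - measure L A\<bar> \<le> \<delta> / 2"
    if L: "real_distribution L" and "measure L (U - C) \<le> \<delta> / 2" for L
  proof -
    interpret L: real_distribution L by (rule L)
    have i1: "integrable L \<phi>"
      by (rule L.integrable_const_bound[of _ 1]) (use \<phi>01 in auto)
    have i2: "integrable L (indicator A :: real \<Rightarrow> real)" using A by (simp add: L.emeasure_eq_measure)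
    have i3: "integrable L (indicator (U - C) :: real \<Rightarrow> real)" using UC by (simp add: L.emeasure_eq_measure)
    have "(\<integral>x. \<phi> x \<partial>L) - measure L A = (\<integral>x. \<phi> x - indicator A x \<partial>L)"
      using i1 i2 A by simp
    also have "\<bar>\<dots>\<bar> \<le> (\<integral>x. \<bar>\<phi> x - indicator A x\<bar> \<partial>L)" by (rule integral_abs_bound)
    also have "\<dots> \<le> (\<integral>x. indicator (U - C) x \<partial>L)"
      by (rule integral_mono) (use i1 i2 i3 pw in auto)
    also have "\<dots> = measure L (U - C)" using UC by simp
    finally show ?thesis using that by linarith
  qed
  have "measure M (U - C) \<le> measure M (U1 - C1)" "measure N (U - C) \<le> measure N (U2 - C2)"
    using 1 2 by (auto intro!: M.finite_measure_mono N.finite_measure_mono simp: U_def C_def borel_compact)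
  then have "\<bar>(\<integral>x. \<phi> x \<partial>M) - measure M A\<bar> \<le> \<delta> / 2" "\<bar>(\<integral>x. \<phi> x \<partial>N) - measure N A\<bar> \<le> \<delta> / 2"
    using approx[OF M] approx[OF N] 1(5) 2(5) by linarith+
  moreover have "\<bar>(\<integral>x. \<phi> x \<partial>M) - (\<integral>x. \<phi> x \<partial>N)\<bar> \<le> e"
    using \<phi>01 by (intro e \<phi>) (auto simp: abs_le_iff intro: order_trans[of _ 0])
  ultimately show "\<bar>measure M A - measure N A\<bar> \<le> e + \<delta>" by linarith
qed

text \<open>\<open>measure M {u - h<..u} / h\<close> is the density of the convolution of \<open>M\<close> with the uniform law on \<open>[0, h]\<close>.\<close>

lemma (in real_distribution) nn_integral_window:
  assumes [measurable]: "A \<in> sets borel"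
  shows "(\<integral>\<^sup>+u. indicator A u * emeasure M {u - h<..u} \<partial>lborel)
    = (\<integral>\<^sup>+y. indicator {0..<h} y * emeasure M {x. x + y \<in> A} \<partial>lborel)"
proof -
  interpret pair_sigma_finite M lborel ..
  have "(\<integral>\<^sup>+y. indicator {0..<h} y * emeasure M {x. x + y \<in> A} \<partial>lborel)
    = (\<integral>\<^sup>+y. \<integral>\<^sup>+x. indicator {0..<h} y * indicator A (x + y) \<partial>M \<partial>lborel)"
  proof (rule nn_integral_cong)
    fix y :: real
    have m: "{x. x + y \<in> A} \<in> sets borel"
      using measurable_sets[of "\<lambda>x. x + y" borel borel A] by (simp add: vimage_def)
    have "(\<integral>\<^sup>+x. indicator A (x + y) \<partial>M) = (\<integral>\<^sup>+x. indicator {x. x + y \<in> A} x \<partial>M)"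
      by (intro nn_integral_cong) (simp add: indicator_def)
    also have "\<dots> = emeasure M {x. x + y \<in> A}" using m by simp
    finally show "indicator {0..<h} y * emeasure M {x. x + y \<in> A}
        = (\<integral>\<^sup>+x. indicator {0..<h} y * indicator A (x + y) \<partial>M)"
      by (simp add: nn_integral_cmult)
  qed
  also have "\<dots> = (\<integral>\<^sup>+x. \<integral>\<^sup>+y. indicator {0..<h} y * indicator A (x + y) \<partial>lborel \<partial>M)"
    using Fubini[of "\<lambda>(x, y). indicator {0..<h} y * indicator A (x + y)"] by simp
  also have "\<dots> = (\<integral>\<^sup>+x. \<integral>\<^sup>+u. indicator {0..<h} (u - x) * indicator A u \<partial>lborel \<partial>M)"
  proof (rule nn_integral_cong)
    fix x :: real
    show "(\<integral>\<^sup>+y. indicator {0..<h} y * indicator A (x + y) \<partial>lborel)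
        = (\<integral>\<^sup>+u. indicator {0..<h} (u - x) * indicator A u \<partial>lborel)"
      using nn_integral_real_affine[of "\<lambda>u. indicator {0..<h} (u - x) * indicator A u" 1 x] by simp
  qed
  also have "\<dots> = (\<integral>\<^sup>+u. \<integral>\<^sup>+x. indicator {0..<h} (u - x) * indicator A u \<partial>M \<partial>lborel)"
    using Fubini[of "\<lambda>(x, u). indicator {0..<h} (u - x) * indicator A u"] by simp
  also have "\<dots> = (\<integral>\<^sup>+u. indicator A u * emeasure M {u - h<..u} \<partial>lborel)"
  proof (rule nn_integral_cong)
    fix u :: real
    have "(\<integral>\<^sup>+x. indicator {0..<h} (u - x) * indicator A u \<partial>M) = (\<integral>\<^sup>+x. indicator A u * indicator {u - h<..u} x \<partial>M)"
      by (intro nn_integral_cong) (auto simp: indicator_def)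
    also have "\<dots> = indicator A u * emeasure M {u - h<..u}" by (simp add: nn_integral_cmult)
    finally show "(\<integral>\<^sup>+x. indicator {0..<h} (u - x) * indicator A u \<partial>M) = indicator A u * emeasure M {u - h<..u}" .
  qed
  finally show ?thesis by simp
qed

lemma (in real_distribution) measurable_window [measurable]:
  "(\<lambda>u. measure M {u - h<..u}) \<in> borel_measurable borel"
proof (cases "h > 0")
  case True
  have "mono (cdf M)" using cdf_nondecreasing by (auto intro: monoI)
  then have [measurable]: "cdf M \<in> borel_measurable borel" by (rule borel_measurable_mono)
  have "measure M {u - h<..u} = cdf M u - cdf M (u - h)" for u
    using True by (subst cdf_diff_eq) auto
  then show ?thesis by simp
next
  case False
  then have "{u - h<..u} = {}" for u by auto
  then show ?thesis by simp
qed

lemma (in real_distribution) integrable_window: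
  assumes "h > 0"
  shows "integrable lborel (\<lambda>u. measure M {u - h<..u})"
    and "(\<integral>\<^sup>+u. ennreal (measure M {u - h<..u}) \<partial>lborel) = ennreal h"
proof -
  have "(\<integral>\<^sup>+u. ennreal (measure M {u - h<..u}) \<partial>lborel) = (\<integral>\<^sup>+y. indicator {0..<h} y * emeasure M UNIV \<partial>lborel)"
    using nn_integral_window[of UNIV h] by (simp add: emeasure_eq_measure)
  also have "\<dots> = (\<integral>\<^sup>+y. indicator {0..<h} y \<partial>lborel)"
    using emeasure_space_1 by simp
  also have "\<dots> = ennreal h" using assms by simp
  finally show *: "(\<integral>\<^sup>+u. ennreal (measure M {u - h<..u}) \<partial>lborel) = ennreal h" .
  show "integrable lborel (\<lambda>u. measure M {u - h<..u})"
    by (rule integrableI_bounded) (simp_all add: *)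
qed

text \<open>Smoothing averages the shifted laws over y in [0, h), and each of them differs from the
  original on \<open>A\<close> by at most e. Everything is multiplied by h to avoid
  division.\<close>

lemma (in real_distribution) measure_window_approx:
  assumes A [measurable]: "A \<in> sets borel" and "h > 0"
    and e: "\<And>y. \<bar>y\<bar> \<le> h \<Longrightarrow> \<bar>measure M A - measure M {x. x + y \<in> A}\<bar> \<le> e"
  shows "\<bar>h * measure M A - (\<integral>u. indicator A u * measure M {u - h<..u} \<partial>lborel)\<bar> \<le> e * h"
proof -
  define B where "B y = measure M {x. x + y \<in> A}" for y
  have Bm [measurable]: "B \<in> borel_measurable borel"
  proof -
    have m: "{w \<in> space (lborel \<Otimes>\<^sub>M M). fst w + snd w \<in> A} \<in> sets (lborel \<Otimes>\<^sub>M M)"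
      by measurable
    have "(\<lambda>y. emeasure M (Pair y -` {w \<in> space (lborel \<Otimes>\<^sub>M M). fst w + snd w \<in> A})) \<in> borel_measurable lborel"
      by (rule measurable_emeasure_Pair) (rule m)
    then have "(\<lambda>y. enn2real (emeasure M (Pair y -` {w \<in> space (lborel \<Otimes>\<^sub>M M). fst w + snd w \<in> A}))) \<in> borel_measurable lborel"
      by measurable
    then show ?thesis
      unfolding B_def by (simp add: space_pair_measure vimage_def add.commute measure_def)
  qed
  have int: "(\<integral>u. indicator A u * measure M {u - h<..u} \<partial>lborel) = (\<integral>y. indicator {0..<h} y * B y \<partial>lborel)"
  proof -
    have "(\<integral>u. indicator A u * measure M {u - h<..u} \<partial>lborel)
      = enn2real (\<integral>\<^sup>+u. indicator A u * emeasure M {u - h<..u} \<partial>lborel)"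
      by (subst integral_eq_nn_integral) (auto simp: emeasure_eq_measure ennreal_mult ennreal_indicator)
    also have "\<dots> = (\<integral>y. indicator {0..<h} y * B y \<partial>lborel)"
      unfolding nn_integral_window[OF A]
      by (subst integral_eq_nn_integral) (auto simp: B_def emeasure_eq_measure ennreal_mult ennreal_indicator)
    finally show ?thesis .
  qed
  have i1: "integrable lborel (\<lambda>y. indicator {0..<h} y * c :: real)" for c
    using \<open>h > 0\<close> by simp
  have B: "measure M A - e \<le> B y \<and> B y \<le> measure M A + e" if "y \<in> {0..<h}" for y
    using e[of y] that by (auto simp: B_def abs_le_iff)
  have iB: "integrable lborel (\<lambda>y. indicator {0..<h} y * B y)"
    by (rule Bochner_Integration.integrable_bound[OF i1[of 1]]) (auto simp: B_def indicator_def)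
  have c: "(\<integral>y. indicator {0..<h} y * c \<partial>lborel) = h * c" for c :: real
    using \<open>h > 0\<close> by simp
  have "(\<integral>y. indicator {0..<h} y * (measure M A - e) \<partial>lborel) \<le> (\<integral>y. indicator {0..<h} y * B y \<partial>lborel)"
    by (rule integral_mono[OF i1 iB]) (use B in \<open>auto simp: indicator_def\<close>)
  moreover have "(\<integral>y. indicator {0..<h} y * B y \<partial>lborel) \<le> (\<integral>y. indicator {0..<h} y * (measure M A + e) \<partial>lborel)"
    by (rule integral_mono[OF iB i1]) (use B in \<open>auto simp: indicator_def\<close>)
  ultimately show ?thesis unfolding c int by (auto simp: abs_le_iff algebra_simps)
qed

text \<open>The windows converge pointwise unless an endpoint is an atom of the limit, which
  excludes countably many u. All windows have integral h, so Scheffe's lemma upgrades this to L1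
  convergence.\<close>

lemma weak_conv_window_L1:
  assumes \<mu>: "\<And>n. real_distribution (\<mu> n)" and \<nu>: "real_distribution \<nu>" and conv: "weak_conv_m \<mu> \<nu>" and "h > 0"
  shows "(\<lambda>n. \<integral>\<^sup>+u. ennreal \<bar>measure (\<mu> n) {u - h<..u} - measure \<nu> {u - h<..u}\<bar> \<partial>lborel) \<longlonglongrightarrow> 0"
proof -
  interpret \<mu>: real_distribution "\<mu> n" for n by (rule \<mu>)
  interpret \<nu>: real_distribution \<nu> by (rule \<nu>)
  have "(\<lambda>n. \<integral>\<^sup>+u. norm (measure (\<mu> n) {u - h<..u} - measure \<nu> {u - h<..u}) \<partial>lborel) \<longlonglongrightarrow> 0"
  proof (rule Scheffe_lemma2)
    define D where "D = {x. measure \<nu> {x} > 0}"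
    have D: "countable D" unfolding D_def by (rule \<nu>.countable_atoms)
    have "AE u in lborel. u \<notin> D \<union> (\<lambda>x. x + h) ` D"
      using D by (intro AE_not_in countable_imp_null_set_lborel) auto
    then show "AE u in lborel. (\<lambda>n. measure (\<mu> n) {u - h<..u}) \<longlonglongrightarrow> measure \<nu> {u - h<..u}"
    proof (rule AE_mp, intro AE_I2 impI)
      fix u assume u: "u \<notin> D \<union> (\<lambda>x. x + h) ` D"
      have "u - h \<notin> D"
      proof
        assume "u - h \<in> D"
        then have "u - h + h \<in> (\<lambda>x. x + h) ` D" by (rule imageI)
        then show False using u by simp
      qed
      then have "measure \<nu> {u} = 0" "measure \<nu> {u - h} = 0"
        using u by (auto simp: D_def zero_less_measure_iff)
      then have "isCont (cdf \<nu>) u" "isCont (cdf \<nu>) (u - h)" by (simp_all add: \<nu>.isCont_cdf)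
      then have "(\<lambda>n. cdf (\<mu> n) u - cdf (\<mu> n) (u - h)) \<longlonglongrightarrow> cdf \<nu> u - cdf \<nu> (u - h)"
        using conv unfolding weak_conv_m_def weak_conv_def by (intro tendsto_diff) auto
      then show "(\<lambda>n. measure (\<mu> n) {u - h<..u}) \<longlonglongrightarrow> measure \<nu> {u - h<..u}"
        using \<open>h > 0\<close> by (simp add: \<mu>.cdf_diff_eq \<nu>.cdf_diff_eq)
    qed
  qed (use \<mu>.integrable_window[OF \<open>h > 0\<close>] \<nu>.integrable_window[OF \<open>h > 0\<close>] in auto)
  then show ?thesis by simp
qed

text \<open>The laws convolved with a short uniform law converge in total variation by Scheffe's lemma.\<close>

lemma tv_conv_of_shift_smooth:
  assumes \<mu>: "\<And>n. real_distribution (\<mu> n)" and \<nu>: "real_distribution \<nu>" and conv: "weak_conv_m \<mu> \<nu>"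
    and smooth: "\<And>e. e > 0 \<Longrightarrow> \<exists>h>0. \<exists>n0. \<forall>n\<ge>n0. \<forall>\<phi> y.
      continuous_on UNIV \<phi> \<longrightarrow> (\<forall>x::real. \<bar>\<phi> x\<bar> \<le> (1::real)) \<longrightarrow> \<bar>y\<bar> \<le> h \<longrightarrow>
      \<bar>(\<integral>x. \<phi> x \<partial>\<mu> n) - (\<integral>x. \<phi> (x + y) \<partial>\<mu> n)\<bar> \<le> e"
  shows "\<And>e. e > 0 \<Longrightarrow> \<exists>n0. \<forall>n\<ge>n0. \<forall>A\<in>sets borel. \<bar>measure (\<mu> n) A - measure \<nu> A\<bar> \<le> e"
    and "absolutely_continuous lborel \<nu>"
proof -
  interpret \<mu>: real_distribution "\<mu> n" for n by (rule \<mu>)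
  interpret \<nu>: real_distribution \<nu> by (rule \<nu>)
  have shift: "\<bar>measure L A - measure L {x. x + y \<in> A}\<bar> \<le> e"
    if L: "real_distribution L" and A: "A \<in> sets borel"
      and e: "\<And>\<phi>. continuous_on UNIV \<phi> \<Longrightarrow> (\<And>x::real. \<bar>\<phi> x\<bar> \<le> (1::real))
        \<Longrightarrow> \<bar>(\<integral>x. \<phi> x \<partial>L) - (\<integral>x. \<phi> (x + y) \<partial>L)\<bar> \<le> e" for L A y e
  proof -
    interpret L: real_distribution L by (rule L)
    have "\<bar>measure L A - measure (distr L borel (\<lambda>x. x + y)) A\<bar> \<le> e"
    proof (rule measure_diff_le_of_continuous[OF L _ A])
      show "real_distribution (distr L borel (\<lambda>x. x + y))" by simp
      fix \<phi> :: "real \<Rightarrow> real" assume \<phi>: "continuous_on UNIV \<phi>" "\<And>x. \<bar>\<phi> x\<bar> \<le> 1"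
      have [measurable]: "\<phi> \<in> borel_measurable borel" by (intro borel_measurable_continuous_onI \<phi>)
      show "\<bar>(\<integral>x. \<phi> x \<partial>L) - (\<integral>x. \<phi> x \<partial>distr L borel (\<lambda>x. x + y))\<bar> \<le> e"
        by (subst integral_distr) (use e[OF \<phi>] in auto)
    qed
    also have "measure (distr L borel (\<lambda>x. x + y)) A = measure L {x. x + y \<in> A}"
      using A by (subst measure_distr) (auto simp: vimage_def)
    finally show ?thesis .
  qed
  have key: "\<exists>h>0. \<exists>n0. (\<forall>n\<ge>n0. \<forall>A\<in>sets borel.
        \<bar>h * measure (\<mu> n) A - (\<integral>u. indicator A u * measure (\<mu> n) {u - h<..u} \<partial>lborel)\<bar> \<le> e * h)
      \<and> (\<forall>A\<in>sets borel. \<bar>h * measure \<nu> A - (\<integral>u. indicator A u * measure \<nu> {u - h<..u} \<partial>lborel)\<bar> \<le> e * h)"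
    if "e > 0" for e
  proof -
    obtain h n0 where h: "h > 0" and n0: "\<And>n \<phi> y. \<lbrakk>n \<ge> n0; continuous_on UNIV \<phi>; \<And>x. \<bar>\<phi> x\<bar> \<le> 1; \<bar>y\<bar> \<le> h\<rbrakk>
        \<Longrightarrow> \<bar>(\<integral>x. \<phi> x \<partial>\<mu> n) - (\<integral>x. \<phi> (x + y) \<partial>\<mu> n)\<bar> \<le> e"
      using smooth[OF \<open>e > 0\<close>] by metis
    \<comment> \<open>For continuous bounded \<phi> the shift estimate survives the weak limit, with
      the same h.\<close>
    have lim: "\<bar>(\<integral>x. \<phi> x \<partial>\<nu>) - (\<integral>x. \<phi> (x + y) \<partial>\<nu>)\<bar> \<le> e"
      if \<phi>: "continuous_on UNIV \<phi>" "\<And>x::real. \<bar>\<phi> x\<bar> \<le> 1" and y: "\<bar>y\<bar> \<le> h" for \<phi> :: "real \<Rightarrow> real" and y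
    proof (rule tendsto_upperbound[of _ _ sequentially])
      have 1: "isCont \<phi> x" for x using \<phi>(1) by (simp add: continuous_on_eq_continuous_at)
      have 2: "isCont (\<lambda>x. \<phi> (x + y)) x" for x
        using 1 by (intro continuous_intros isCont_o2[of _ "\<lambda>x. x + y"]) auto
      show "(\<lambda>n. \<bar>(\<integral>x. \<phi> x \<partial>\<mu> n) - (\<integral>x. \<phi> (x + y) \<partial>\<mu> n)\<bar>) \<longlonglongrightarrow> \<bar>(\<integral>x. \<phi> x \<partial>\<nu>) - (\<integral>x. \<phi> (x + y) \<partial>\<nu>)\<bar>"
        by (intro tendsto_intros weak_conv_imp_integral_bdd_continuous_conv[OF \<mu> \<nu> conv, where B = 1])
           (use 1 2 \<phi>(2) in auto)
      show "\<forall>\<^sub>F n in sequentially. \<bar>(\<integral>x. \<phi> x \<partial>\<mu> n) - (\<integral>x. \<phi> (x + y) \<partial>\<mu> n)\<bar> \<le> e"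
        using n0[OF _ \<phi> y] by (auto simp: eventually_sequentially)
    qed simp
    show ?thesis
    proof (intro exI[of _ h] conjI exI[of _ n0] allI impI ballI)
      fix n and A :: "real set" assume nA: "n \<ge> n0" "A \<in> sets borel"
      show "\<bar>h * measure (\<mu> n) A - (\<integral>u. indicator A u * measure (\<mu> n) {u - h<..u} \<partial>lborel)\<bar> \<le> e * h"
        by (rule \<mu>.measure_window_approx[OF nA(2) h]) (rule shift[OF \<mu> nA(2)], rule n0[OF nA(1)], auto)
    next
      fix A :: "real set" assume A: "A \<in> sets borel"
      show "\<bar>h * measure \<nu> A - (\<integral>u. indicator A u * measure \<nu> {u - h<..u} \<partial>lborel)\<bar> \<le> e * h"
        by (rule \<nu>.measure_window_approx[OF A h]) (rule shift[OF \<nu> A], rule lim, auto)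
    qed (rule h)
  qed
  show "\<exists>n0. \<forall>n\<ge>n0. \<forall>A\<in>sets borel. \<bar>measure (\<mu> n) A - measure \<nu> A\<bar> \<le> e" if "e > 0" for e
  proof -
    \<comment> \<open>One third each for smoothing \<open>\<mu> n\<close>, smoothing \<nu>, and the
      L1 distance of the smoothed laws.\<close>
    have "e / 3 > 0" using \<open>e > 0\<close> by simp
    from key[OF this] obtain h n0 where h: "h > 0" and
      n0: "\<And>n A. \<lbrakk>n \<ge> n0; A \<in> sets borel\<rbrakk> \<Longrightarrow> \<bar>h * measure (\<mu> n) A - (\<integral>u. indicator A u * measure (\<mu> n) {u - h<..u} \<partial>lborel)\<bar> \<le> e / 3 * h"
      and \<nu>h: "\<And>A. A \<in> sets borel \<Longrightarrow> \<bar>h * measure \<nu> A - (\<integral>u. indicator A u * measure \<nu> {u - h<..u} \<partial>lborel)\<bar> \<le> e / 3 * h"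
      by blast
    have "\<forall>\<^sub>F n in sequentially. (\<integral>\<^sup>+u. ennreal \<bar>measure (\<mu> n) {u - h<..u} - measure \<nu> {u - h<..u}\<bar> \<partial>lborel) < ennreal (e / 3 * h)"
      using weak_conv_window_L1[OF \<mu> \<nu> conv h] \<open>e > 0\<close> h by (intro order_tendstoD) auto
    then obtain n1 where n1: "\<And>n. n \<ge> n1 \<Longrightarrow>
        (\<integral>\<^sup>+u. ennreal \<bar>measure (\<mu> n) {u - h<..u} - measure \<nu> {u - h<..u}\<bar> \<partial>lborel) < ennreal (e / 3 * h)"
      unfolding eventually_sequentially by blast
    have "\<bar>measure (\<mu> n) A - measure \<nu> A\<bar> \<le> e" if n: "n \<ge> max n0 n1" and A [measurable]: "A \<in> sets borel" for n A
    proof -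
      let ?f = "\<lambda>u. measure (\<mu> n) {u - h<..u}" and ?g = "\<lambda>u. measure \<nu> {u - h<..u}"
      have fg: "integrable lborel ?f" "integrable lborel ?g"
        by (rule \<mu>.integrable_window[OF h] \<nu>.integrable_window[OF h])+
      have Afg: "integrable lborel (\<lambda>u. indicator A u * ?f u)" "integrable lborel (\<lambda>u. indicator A u * ?g u)"
        by (rule Bochner_Integration.integrable_bound[OF fg(1)] Bochner_Integration.integrable_bound[OF fg(2)]; auto simp: indicator_def)+
      have "\<bar>(\<integral>u. indicator A u * ?f u \<partial>lborel) - (\<integral>u. indicator A u * ?g u \<partial>lborel)\<bar>
          = \<bar>\<integral>u. indicator A u * ?f u - indicator A u * ?g u \<partial>lborel\<bar>"
        using Afg by simp
      also have "\<dots> \<le> (\<integral>u. \<bar>indicator A u * ?f u - indicator A u * ?g u\<bar> \<partial>lborel)" by (rule integral_abs_bound)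
      also have "\<dots> \<le> (\<integral>u. \<bar>?f u - ?g u\<bar> \<partial>lborel)"
        by (rule integral_mono) (use Afg fg in \<open>auto simp: indicator_def\<close>)
      also have "\<dots> = enn2real (\<integral>\<^sup>+u. ennreal \<bar>?f u - ?g u\<bar> \<partial>lborel)"
        by (subst integral_eq_nn_integral) auto
      also have "\<dots> \<le> e / 3 * h"
        using n1[of n] n \<open>e > 0\<close> h by (intro enn2real_leI) auto
      finally have "\<bar>h * measure (\<mu> n) A - h * measure \<nu> A\<bar> \<le> e / 3 * h + e / 3 * h + e / 3 * h"
        using n0[of n A] \<nu>h[OF A] n A by linarith
      then have "h * \<bar>measure (\<mu> n) A - measure \<nu> A\<bar> \<le> h * e"
        using h by (simp add: abs_mult right_diff_distrib[symmetric] mult.commute)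
      then show ?thesis using h by simp
    qed
    then show ?thesis by blast
  qed
  show "absolutely_continuous lborel \<nu>"
    unfolding absolutely_continuous_def
  proof
    fix A :: "real set" assume A: "A \<in> null_sets lborel"
    then have Ab: "A \<in> sets borel" by (auto simp: null_sets_def)
    have "measure \<nu> A \<le> 0 + e" if "e > 0" for e
    proof -
      obtain h where h: "h > 0" "\<bar>h * measure \<nu> A - (\<integral>u. indicator A u * measure \<nu> {u - h<..u} \<partial>lborel)\<bar> \<le> e * h"
        using key[OF \<open>e > 0\<close>] Ab by blast
      \<comment> \<open>The smoothed law has a density, so it gives the null set no mass; only the
        smoothing error is left, and it is arbitrarily small.\<close>
      have "(\<integral>u. indicator A u * measure \<nu> {u - h<..u} \<partial>lborel) = 0"
        using AE_not_in[OF A] by (intro integral_eq_zero_AE) (auto elim!: eventually_mono)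
      then have "h * measure \<nu> A \<le> h * e" using h by (simp add: mult.commute abs_le_iff)
      then show ?thesis using h by simp
    qed
    then have "measure \<nu> A \<le> 0" by (rule field_le_epsilon)
    then show "A \<in> null_sets \<nu>"
      using Ab by (intro null_setsI) (auto simp: \<nu>.emeasure_eq_measure measure_le_0_iff)
  qed
qed

section \<open>Random curves of constant law\<close>

text \<open>Take distinct odd primes \<open>q j\<close>, frequencies \<open>l k = (\<Prod>i\<noteq>k. q i)\<close> and times \<open>s j = 2 * pi / q j\<close>.\<close>

lemma separating_frequencies:
  obtains l :: "nat \<Rightarrow> nat" and s :: "nat \<Rightarrow> real" where
    "\<And>j. s j \<in> {0..2*pi}" "\<And>j. j < m \<Longrightarrow> sin (real (l j) * s j) \<noteq> 0"
    "\<And>j k. \<lbrakk>j < m; k < m; j \<noteq> k\<rbrakk> \<Longrightarrow> cos (real (l k) * s j) = 1 \<and> sin (real (l k) * s j) = 0"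
proof -
  \<comment> \<open>The sine also vanishes at odd multiples of \<pi>, so \<open>q j\<close> must not
    divide twice \<open>l j\<close>; hence the prime 2 is left out.\<close>
  define P where "P = {p :: nat. prime p} - {2}"
  have inf: "infinite P" unfolding P_def using primes_infinite by simp
  define q where "q = enumerate P"
  have q: "prime (q j)" "q j \<noteq> 2" for j
    using enumerate_in_set[OF inf, of j] by (auto simp: q_def P_def)
  have q_inj: "q i \<noteq> q j" if "i \<noteq> j" for i j
    using that enumerate_mono[OF _ inf] unfolding q_def by (metis less_irrefl nat_neq_iff)
  have q1: "q j \<ge> 1" for j using prime_gt_0_nat[OF q(1)[of j]] by linarith
  define l where "l k = (\<Prod>i\<in>{..<m} - {k}. q i)" for k
  define s where "s j = 2 * pi / real (q j)" for j
  show ?thesis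
  proof (rule that)
    fix j
    show "s j \<in> {0..2*pi}"
      using q1[of j] by (auto simp: s_def divide_simps intro: mult_left_mono[of 1 "real (q j)" pi, simplified])
  next
    fix j assume "j < m"
    show "sin (real (l j) * s j) \<noteq> 0"
    proof
      assume "sin (real (l j) * s j) = 0"
      then obtain i :: int where "real (l j) * (2 * pi / real (q j)) = of_int i * pi"
        unfolding s_def sin_zero_iff_int2 by blast
      then have "real (l j) * 2 = of_int i * real (q j)"
        using q1[of j] by (simp add: divide_simps)
      then have "int (l j) * 2 = i * int (q j)"
        by (metis of_int_eq_iff of_int_mult of_int_numeral of_int_of_nat_eq)
      then have "int (q j) dvd int (2 * l j)" by (metis dvd_triv_right mult.commute of_nat_mult of_nat_numeral)
      then have "q j dvd 2 * l j" by (simp only: of_nat_dvd_iff)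
      then have "q j dvd 2 \<or> q j dvd l j" using q(1) prime_dvd_mult_iff by blast
      then show False
      proof
        assume "q j dvd 2"
        then show False using q[of j] primes_dvd_imp_eq two_is_prime_nat by blast
      next
        assume "q j dvd l j"
        then obtain i where "i \<in> {..<m} - {j}" "q j dvd q i"
          unfolding l_def using prime_dvd_prod_iff[of "{..<m} - {j}" "q j" q] q(1)[of j] by auto
        then show False using q q_inj[of i j] primes_dvd_imp_eq by (metis DiffD2 insertI1)
      qed
    qed
  next
    fix j k assume jk: "j < m" "k < m" "j \<noteq> k"
    then have "q j dvd l k" unfolding l_def by (intro dvd_prodI) auto
    then obtain c where "l k = q j * c" by blast
    then have "real (l k) * s j = 2 * pi * real c"
      using q1[of j] by (simp add: s_def)
    then show "cos (real (l k) * s j) = 1 \<and> sin (real (l k) * s j) = 0"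
      using cos_int_2pin[of "int c"] sin_int_2pin[of "int c"] by simp
  qed
qed

section \<open>Homogeneous sums along the curves\<close>

lemma hom_poly_restrict:
  "hom_poly d N a (restrict x {1..N}) = hom_poly d N a x"
  unfolding hom_poly_def
  by (intro sum.cong refl arg_cong2[of _ _ _ _ "(*)"] arg_cong[of _ _ prod_list] map_cong)
     (auto simp: index_tuples_def)

lemma measurable_hom_poly [measurable]:
  assumes "vanishes_on_diagonals d N a"
  shows "hom_poly d N a \<in> borel_measurable (PiM {1..N} (\<lambda>_. borel))"
proof -
  have "(\<lambda>x. \<Sum>S\<in>ksets d N. set_coeff a S * (\<Prod>i\<in>S. x i)) \<in> borel_measurable (PiM {1..N} (\<lambda>_. borel :: real measure))"
  proof (intro borel_measurable_sum borel_measurable_times borel_measurable_prod borel_measurable_const)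
    fix S i assume "S \<in> ksets d N" "i \<in> S"
    then have "i \<in> {1..N}" using ksetsD by blast
    then show "(\<lambda>x. x i) \<in> borel_measurable (PiM {1..N} (\<lambda>_. borel :: real measure))" by simp
  qed
  then show ?thesis
    by (subst measurable_cong[OF hom_poly_eq_sum_ksets[OF assms]])
qed

text \<open>\<open>curve_freq D l i k\<close> is the angular velocity of the \<open>i\<close>-th coordinate in the \<open>k\<close>-th annulus.\<close>

definition curve_freq :: "(nat \<Rightarrow> nat set) \<Rightarrow> (nat \<Rightarrow> nat) \<Rightarrow> nat \<Rightarrow> nat \<Rightarrow> real" where
  "curve_freq D l i k = sg (D k) i * real (l k)"

text \<open>Joint measurability in sample point and time, for Fubini over one period.\<close>

lemma measurable_curve_time [measurable]:
  "(\<lambda>(w, t). curve m \<alpha> x0 (\<lambda>k. c k * t) w)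
    \<in> borel_measurable (((borel \<Otimes>\<^sub>M borel) \<Otimes>\<^sub>M (borel \<Otimes>\<^sub>M borel)) \<Otimes>\<^sub>M borel)"
proof -
  have [measurable]: "(\<lambda>z. c (annulus m z)) \<in> borel_measurable (borel \<Otimes>\<^sub>M borel)"
    by (rule measurable_compose[OF measurable_annulus]) simp
  show ?thesis unfolding curve_def twist_def rot_def by measurable
qed

text \<open>A crude common bound for all frequencies. It depends on neither annulus, orientation nor
  number of coordinates, so the chaos has degree at most d times it for every n.\<close>

definition curve_trig_bound :: "nat \<Rightarrow> (nat \<Rightarrow> nat) \<Rightarrow> nat" where
  "curve_trig_bound m l = (\<Sum>k<m. l k)"

text \<open>A moving coordinate is one harmonic whose orientation only flips the sine term; any
  other coordinate is constant in time.\<close>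

lemma trig_poly_curve:
  "trig_poly (curve_trig_bound m l) (\<lambda>t. curve m \<alpha> x0 (\<lambda>k. curve_freq D l i k * t) w)"
proof (cases "fst (snd w) = 1 \<and> annulus m (fst w) < m")
  case True
  define k where "k = annulus m (fst w)"
  have "curve m \<alpha> x0 (\<lambda>k. curve_freq D l i k * t) w
      = x0 + \<alpha> * fst (fst w) * cos (real (l k) * t) + (- \<alpha> * snd (fst w) * sg (D k) i) * sin (real (l k) * t)" for t
    using True by (auto simp: curve_def twist_def rot_def k_def curve_freq_def sg_def algebra_simps)
  then have "trig_poly (l k) (\<lambda>t. curve m \<alpha> x0 (\<lambda>k. curve_freq D l i k * t) w)"
    by (simp only: trig_poly_harmonic)
  moreover have "l k \<le> curve_trig_bound m l"
    unfolding curve_trig_bound_def using True by (intro member_le_sum) (auto simp: k_def)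
  ultimately show ?thesis by (rule trig_poly_mono)
next
  case False
  then have "curve m \<alpha> x0 (\<lambda>k. curve_freq D l i k * t) w = curve m \<alpha> x0 (\<lambda>k. curve_freq D l i k * 0) w" for t
    by (auto simp: curve_def twist_def)
  then have "(\<lambda>t. curve m \<alpha> x0 (\<lambda>k. curve_freq D l i k * t) w) = (\<lambda>_. curve m \<alpha> x0 (\<lambda>k. curve_freq D l i k * 0) w)"
    by blast
  then show ?thesis using trig_poly_mono[OF trig_poly_const] by simp
qed

lemma trig_poly_hom_poly_curve:
  assumes "vanishes_on_diagonals d N a"
  shows "trig_poly (d * curve_trig_bound m l)
    (\<lambda>t. hom_poly d N a (\<lambda>i. curve m \<alpha> (x0 i) (\<lambda>k. curve_freq D l i k * t) (\<omega> i)))"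
  unfolding hom_poly_eq_sum_ksets[OF assms]
proof (rule trig_poly_sum)
  fix S assume S: "S \<in> ksets d N"
  have "trig_poly (card S * curve_trig_bound m l)
      (\<lambda>t. \<Prod>i\<in>S. curve m \<alpha> (x0 i) (\<lambda>k. curve_freq D l i k * t) (\<omega> i))"
    using ksetsD[OF S] by (intro trig_poly_prod trig_poly_curve) auto
  from trig_poly_mult[OF trig_poly_const this, of "set_coeff a S"]
  show "trig_poly (d * curve_trig_bound m l)
      (\<lambda>t. set_coeff a S * (\<Prod>i\<in>S. curve m \<alpha> (x0 i) (\<lambda>k. curve_freq D l i k * t) (\<omega> i)))"
    using ksetsD[OF S] by simp
qed

text \<open>Up to a factor common to all coordinates, the squared coefficient of the random sign
  when annulus j alone has moved.\<close>

definition active_weight :: "nat \<Rightarrow> nat \<Rightarrow> (real \<times> real) \<times> (real \<times> real) \<Rightarrow> real" where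
  "active_weight m j w = (if fst (snd w) = 1 \<and> annulus m (fst w) = j then (snd (fst w))\<^sup>2 else 0)"

lemma measurable_active_weight [measurable]:
  "active_weight m j \<in> borel_measurable ((borel \<Otimes>\<^sub>M borel) \<Otimes>\<^sub>M (borel \<Otimes>\<^sub>M borel))"
  unfolding active_weight_def by measurable

lemma active_weight_bounds:
  assumes "j < m"
  shows "0 \<le> active_weight m j w \<and> active_weight m j w \<le> 1"
  using annulus_less_imp[of m "fst w"] assms
  by (auto simp: active_weight_def abs_square_le_1 abs_le_iff mem_Times_iff)

lemma integral_active_weight:
  assumes "prob_space \<tau>" and [measurable_cong]: "sets \<tau> = sets (borel \<Otimes>\<^sub>M borel)" and "j < m"
  shows "(\<integral>w. active_weight m j w \<partial>(square_law \<Otimes>\<^sub>M \<tau>))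
    = measure \<tau> {ev. fst ev = 1} * (\<integral>z. (if annulus m z = j then (snd z)\<^sup>2 else 0) \<partial>square_law)"
proof -
  interpret S: prob_space square_law by (rule prob_space_square_law)
  interpret T: prob_space \<tau> by (rule assms(1))
  interpret pair_prob_space square_law \<tau> ..
  have [simp]: "space \<tau> = UNIV" using sets_eq_imp_space_eq[OF assms(2)] by (simp add: space_pair_measure)
  have set: "{ev. fst ev = 1} \<in> sets \<tau>"
  proof -
    have "{ev \<in> space \<tau>. fst ev = 1} \<in> sets \<tau>" by measurable
    then show ?thesis by simp
  qed
  have int: "integrable (square_law \<Otimes>\<^sub>M \<tau>) (active_weight m j)"
    by (rule integrable_const_bound[of _ 1]) (use active_weight_bounds[OF \<open>j < m\<close>] in auto)
  have "(\<integral>w. active_weight m j w \<partial>(square_law \<Otimes>\<^sub>M \<tau>)) = (\<integral>z. \<integral>ev. active_weight m j (z, ev) \<partial>\<tau> \<partial>square_law)"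
    using integral_fst'[OF int] by simp
  also have "\<dots> = (\<integral>z. measure \<tau> {ev. fst ev = 1} * (if annulus m z = j then (snd z)\<^sup>2 else 0) \<partial>square_law)"
  proof (rule Bochner_Integration.integral_cong[OF refl])
    fix z
    have "active_weight m j (z, ev) = indicator {ev. fst ev = 1} ev * (if annulus m z = j then (snd z)\<^sup>2 else 0)" for ev
      by (auto simp: active_weight_def indicator_def)
    then show "(\<integral>ev. active_weight m j (z, ev) \<partial>\<tau>) = measure \<tau> {ev. fst ev = 1} * (if annulus m z = j then (snd z)\<^sup>2 else 0)"
      using set by simp
  qed
  finally show ?thesis by simp
qed

text \<open>The other annuli have made whole turns. In annulus j, cosine is even and sine odd, so
  the coordinate is affine in its sign, with coefficients that serve all orientations.\<close>

lemma curve_at_separating_time: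
  assumes "j < m" and sep: "\<And>k. k < m \<Longrightarrow> k \<noteq> j \<Longrightarrow> cos (real (l k) * s) = 1 \<and> sin (real (l k) * s) = 0"
  obtains u v where "\<And>D. curve m \<alpha> x0 (\<lambda>k. curve_freq D l i k * s) w = u + v * sg (D j) i"
    "v\<^sup>2 = (\<alpha> * sin (real (l j) * s))\<^sup>2 * active_weight m j w"
proof (cases "fst (snd w) = 1 \<and> annulus m (fst w) = j")
  case True
  show ?thesis
  proof (rule that)
    show "curve m \<alpha> x0 (\<lambda>k. curve_freq D l i k * s) w
      = (\<alpha> * fst (fst w) * cos (real (l j) * s) + x0) + (- \<alpha> * snd (fst w) * sin (real (l j) * s)) * sg (D j) i" for D
      using True \<open>j < m\<close> by (auto simp: curve_def twist_def rot_def curve_freq_def sg_def algebra_simps)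
    show "(- \<alpha> * snd (fst w) * sin (real (l j) * s))\<^sup>2 = (\<alpha> * sin (real (l j) * s))\<^sup>2 * active_weight m j w"
      using True by (simp add: active_weight_def power_mult_distrib)
  qed
next
  case False
  show ?thesis
  proof (rule that)
    show "curve m \<alpha> x0 (\<lambda>k. curve_freq D l i k * s) w = curve m \<alpha> x0 (\<lambda>_. 0) w + 0 * sg (D j) i" for D
    proof (cases "annulus m (fst w) < m \<and> fst (snd w) = 1")
      case True
      then have "cos (real (l (annulus m (fst w))) * s) = 1 \<and> sin (real (l (annulus m (fst w))) * s) = 0"
        using False sep by auto
      then show ?thesis using True
        by (auto simp: curve_def twist_def rot_def curve_freq_def sg_def)
    qed (auto simp: curve_def twist_def)
    show "0\<^sup>2 = (\<alpha> * sin (real (l j) * s))\<^sup>2 * active_weight m j w"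
      using False by (auto simp: active_weight_def)
  qed
qed

declare One_nat_def [simp del] \<comment> \<open>keeps the index set \<open>{1..N}\<close> in one form\<close>

lemma anticoncentration_rate_pos: "0 < 1 - 1 / (4 * 9 ^ d :: real)"
proof -
  have "(1::real) \<le> 9 ^ d" by simp
  then have "(1::real) / (4 * 9 ^ d) \<le> 1 / 4" by (simp add: divide_simps)
  then show ?thesis by linarith
qed

section \<open>Product laws\<close>

lemma indep_vars_PiM_coordinates:
  assumes K: "\<And>i. i \<in> I \<Longrightarrow> prob_space (K i)" and "I \<noteq> {}"
  shows "prob_space.indep_vars (PiM I K) K (\<lambda>i \<omega>. \<omega> i) I"
proof -
  interpret R: prob_space "PiM I K" by (rule prob_space_PiM) (rule K)
  have "distr (PiM I K) (PiM I K) (\<lambda>\<omega>. \<lambda>i\<in>I. \<omega> i) = distr (PiM I K) (PiM I K) (\<lambda>\<omega>. \<omega>)"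
    by (rule distr_cong) (auto simp: space_PiM PiE_def extensional_restrict)
  also have "\<dots> = PiM I (\<lambda>i. distr (PiM I K) (K i) (\<lambda>\<omega>. \<omega> i))"
    unfolding distr_id by (intro PiM_cong refl distr_PiM_component[symmetric] K)
  finally show ?thesis
    using \<open>I \<noteq> {}\<close> by (subst R.indep_vars_iff_distr_eq_PiM') auto
qed

text \<open>By independence both joint laws are the product of the same marginals.\<close>

lemma distr_PiM_coordinatewise:
  assumes M: "prob_space M" "prob_space.indep_vars M (\<lambda>_. borel) X I" and "I \<noteq> {}"
    and K: "\<And>i. i \<in> I \<Longrightarrow> prob_space (K i)"
    and Y: "\<And>i. i \<in> I \<Longrightarrow> Y i \<in> borel_measurable (K i)"
    and law: "\<And>i. i \<in> I \<Longrightarrow> distr (K i) borel (Y i) = distr M (borel :: real measure) (X i)"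
  shows "distr (PiM I K) (PiM I (\<lambda>_. borel)) (\<lambda>\<omega>. \<lambda>i\<in>I. Y i (\<omega> i)) = distr M (PiM I (\<lambda>_. borel)) (\<lambda>x. \<lambda>i\<in>I. X i x)"
proof -
  interpret M: prob_space M by (rule M(1))
  interpret R: prob_space "PiM I K" by (rule prob_space_PiM) (rule K)
  have Xm: "X i \<in> borel_measurable M" if "i \<in> I" for i
    using M(2) that unfolding M.indep_vars_def2 by blast
  have Ym: "(\<lambda>\<omega>. Y i (\<omega> i)) \<in> borel_measurable (PiM I K)" if "i \<in> I" for i
    using that by (intro measurable_compose[OF measurable_component_singleton[of i I K] Y[of i]])
  have "R.indep_vars (\<lambda>_. borel) (\<lambda>i \<omega>. Y i (\<omega> i)) I"
    by (rule R.indep_vars_compose2[OF indep_vars_PiM_coordinates]) (use K Y \<open>I \<noteq> {}\<close> in auto)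
  then have "distr (PiM I K) (PiM I (\<lambda>_. borel)) (\<lambda>\<omega>. \<lambda>i\<in>I. Y i (\<omega> i))
      = PiM I (\<lambda>i. distr (PiM I K) borel (\<lambda>\<omega>. Y i (\<omega> i)))"
    using \<open>I \<noteq> {}\<close> Ym by (subst (asm) R.indep_vars_iff_distr_eq_PiM') auto
  also have "\<dots> = PiM I (\<lambda>i. distr M borel (X i))"
  proof (rule PiM_cong[OF refl])
    fix i assume i: "i \<in> I"
    have "distr (PiM I K) borel (\<lambda>\<omega>. Y i (\<omega> i)) = distr (distr (PiM I K) (K i) (\<lambda>\<omega>. \<omega> i)) borel (Y i)"
      using i Y by (subst distr_distr) (auto simp: o_def)
    also have "\<dots> = distr (K i) borel (Y i)"
      by (subst distr_PiM_component) (use i K in auto)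
    finally show "distr (PiM I K) borel (\<lambda>\<omega>. Y i (\<omega> i)) = distr M borel (X i)" using law[OF i] by simp
  qed
  also have "\<dots> = distr M (PiM I (\<lambda>_. borel)) (\<lambda>x. \<lambda>i\<in>I. X i x)"
    using M(2) \<open>I \<noteq> {}\<close>
    by (subst (asm) M.indep_vars_iff_distr_eq_PiM') (auto intro: Xm)
  finally show ?thesis .
qed

text \<open>\<open>\<tau> i\<close> is the law of \<open>(\<epsilon>, V)\<close> for \<open>X i\<close>, the reals \<open>t0\<close> and \<open>\<mu> j\<close> are the bound on the influences
  and the mean of the weights \<open>active_weight m j\<close>, and \<open>s0\<close> will bound the conditional variances of
  the increments at the separating times \<open>s j\<close> from below.\<close>

locale coupled_chaos = prob_space M for M :: "'a measure" +
  fixes d N m :: nat and a :: "nat list \<Rightarrow> real" and X :: "nat \<Rightarrow> 'a \<Rightarrow> real"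
    and \<alpha> :: real and x0 :: "nat \<Rightarrow> real" and \<tau> :: "nat \<Rightarrow> (real \<times> real) measure"
    and l :: "nat \<Rightarrow> nat" and s :: "nat \<Rightarrow> real" and \<mu> :: "nat \<Rightarrow> real" and t0 s0 :: real
  assumes d1: "d \<ge> 1" and N1: "N \<ge> 1"
    and diag: "vanishes_on_diagonals d N a"
    and coeffs: "(\<Sum>S\<in>ksets d N. (set_coeff a S)\<^sup>2) = 1"
    and infl: "\<And>i. i \<in> {1..N} \<Longrightarrow> (\<Sum>T\<in>{T\<in>ksets d N. i \<in> T}. (set_coeff a T)\<^sup>2) \<le> t0"
    and indep: "indep_vars (\<lambda>_. borel) X {1..N}"
    and \<tau>: "\<And>i. prob_space (\<tau> i)" "\<And>i. sets (\<tau> i) = sets (borel \<Otimes>\<^sub>M borel)"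
    and law: "\<And>i \<theta>. i \<in> {1..N} \<Longrightarrow> distr (square_law \<Otimes>\<^sub>M \<tau> i) borel (curve m \<alpha> (x0 i) \<theta>) = distr M borel (X i)"
    and mean: "\<And>i j. j < m \<Longrightarrow> (\<integral>w. active_weight m j w \<partial>(square_law \<Otimes>\<^sub>M \<tau> i)) = \<mu> j"
    and \<mu>: "\<And>j. j < m \<Longrightarrow> \<mu> j > 0"
    and s: "\<And>j. s j \<in> {0..2*pi}"
    and sep: "\<And>j k. \<lbrakk>j < m; k < m; j \<noteq> k\<rbrakk> \<Longrightarrow> cos (real (l k) * s j) = 1 \<and> sin (real (l k) * s j) = 0"
    and s0: "s0 > 0" "\<And>j. j < m \<Longrightarrow> s0 \<le> ((\<alpha> * sin (real (l j) * s j))\<^sup>2) ^ d * (\<mu> j ^ d / 2)"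
begin

abbreviation K :: "nat \<Rightarrow> ((real \<times> real) \<times> real \<times> real) measure" where
  "K i \<equiv> square_law \<Otimes>\<^sub>M \<tau> i"

abbreviation R :: "(nat \<Rightarrow> (real \<times> real) \<times> real \<times> real) measure" where
  "R \<equiv> PiM {1..N} K"

definition F :: "(nat \<Rightarrow> nat set) \<Rightarrow> (nat \<Rightarrow> (real \<times> real) \<times> real \<times> real) \<Rightarrow> real \<Rightarrow> real" where
  "F D \<omega> t = hom_poly d N a (\<lambda>i. curve m \<alpha> (x0 i) (\<lambda>k. curve_freq D l i k * t) (\<omega> i))"

text \<open>At time 0 all angles vanish, so the orientation is a dummy. The increments are measured
  from this value because the centre in the sign anticoncentration may not depend on the
  signs.\<close>

definition base :: "(nat \<Rightarrow> (real \<times> real) \<times> real \<times> real) \<Rightarrow> real" where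
  "base \<omega> = F (\<lambda>_. {}) \<omega> 0"

definition signs :: "(nat \<Rightarrow> nat set) set" where
  "signs = PiE {..<m} (\<lambda>_. Pow {1..N})"

text \<open>The samples for which no separating time exhibits the oscillation needed by the shift
  estimate.\<close>

definition bad :: "(nat \<Rightarrow> nat set) \<Rightarrow> (nat \<Rightarrow> (real \<times> real) \<times> real \<times> real) set" where
  "bad D = {\<omega>\<in>space R. \<forall>j<m. (F D \<omega> (s j) - base \<omega>)\<^sup>2 \<le> s0 / 2}"

text \<open>The sum is, up to a constant, the top degree part of the conditional variance of
  increment j; its mean is \<open>\<mu> j ^ d\<close>.\<close>

definition weak :: "nat \<Rightarrow> (nat \<Rightarrow> (real \<times> real) \<times> real \<times> real) set" where
  "weak j = {\<omega>\<in>space R. (\<Sum>S\<in>ksets d N. (set_coeff a S)\<^sup>2 * (\<Prod>i\<in>S. active_weight m j (\<omega> i))) \<le> \<mu> j ^ d / 2}"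

lemma sets_K [measurable_cong]: "sets (K i) = sets ((borel \<Otimes>\<^sub>M borel) \<Otimes>\<^sub>M (borel \<Otimes>\<^sub>M borel))"
  using \<tau>(2) by (intro sets_pair_measure_cong) auto

lemma prob_space_K: "prob_space (K i)"
proof -
  interpret S: prob_space square_law by (rule prob_space_square_law)
  interpret T: prob_space "\<tau> i" by (rule \<tau>)
  interpret pair_prob_space square_law "\<tau> i" ..
  show ?thesis by unfold_locales
qed

sublocale R: prob_space R by (rule prob_space_PiM) (rule prob_space_K)

lemma F_0: "F D \<omega> 0 = base \<omega>"
  by (simp add: F_def base_def)

lemma measurable_F: "(\<lambda>(\<omega>, t). F D \<omega> t) \<in> borel_measurable (R \<Otimes>\<^sub>M borel)"
proof -
  have "(\<lambda>(\<omega>, t). \<Sum>S\<in>ksets d N. set_coeff a S * (\<Prod>i\<in>S. curve m \<alpha> (x0 i) (\<lambda>k. curve_freq D l i k * t) (\<omega> i)))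
      \<in> borel_measurable (R \<Otimes>\<^sub>M borel)"
    unfolding split_beta'
  proof (intro borel_measurable_sum borel_measurable_times borel_measurable_prod borel_measurable_const)
    fix S i assume "S \<in> ksets d N" "i \<in> S"
    then have i [measurable]: "i \<in> {1..N}" using ksetsD by blast
    have "(\<lambda>x. (\<lambda>(w, t). curve m \<alpha> (x0 i) (\<lambda>k. curve_freq D l i k * t) w) (fst x i, snd x)) \<in> borel_measurable (R \<Otimes>\<^sub>M borel)"
      by (rule measurable_compose[OF _ measurable_curve_time]) measurable
    then show "(\<lambda>x. curve m \<alpha> (x0 i) (\<lambda>k. curve_freq D l i k * snd x) (fst x i)) \<in> borel_measurable (R \<Otimes>\<^sub>M borel)"
      by simp
  qed
  then show ?thesis unfolding F_def hom_poly_eq_sum_ksets[OF diag] .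
qed

lemma measurable_F' [measurable]: "(\<lambda>\<omega>. F D \<omega> t) \<in> borel_measurable R"
proof -
  have "(\<lambda>\<omega>. (\<lambda>(\<omega>, t). F D \<omega> t) (\<omega>, t)) \<in> borel_measurable R"
    by (rule measurable_compose[OF _ measurable_F]) measurable
  then show ?thesis by simp
qed

lemma measurable_base [measurable]: "base \<in> borel_measurable R"
  unfolding base_def by measurable

lemma sets_bad [measurable]: "bad D \<in> sets R"
  unfolding bad_def by measurable

lemma sets_weak [measurable]: "weak j \<in> sets R"
proof -
  have "(\<lambda>\<omega>. \<Sum>S\<in>ksets d N. (set_coeff a S)\<^sup>2 * (\<Prod>i\<in>S. active_weight m j (\<omega> i))) \<in> borel_measurable R"
  proof (intro borel_measurable_sum borel_measurable_times borel_measurable_prod borel_measurable_const)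
    fix S i assume "S \<in> ksets d N" "i \<in> S"
    then have i [measurable]: "i \<in> {1..N}" using ksetsD by blast
    show "(\<lambda>\<omega>. active_weight m j (\<omega> i)) \<in> borel_measurable R" by measurable
  qed
  then show ?thesis unfolding weak_def by measurable
qed

lemma prob_weak: 
  assumes "j < m"
  shows "R.prob (weak j) \<le> 4 * real d * t0 / (\<mu> j ^ d)\<^sup>2"
  unfolding weak_def
proof (rule second_moment_concentration[OF refl prob_space_K])
  show "(\<integral>w. active_weight m j w \<partial>K i) = \<mu> j" for i by (rule mean[OF assms])
qed (use active_weight_bounds[OF assms] \<mu>[OF assms] coeffs infl in \<open>auto\<close>)

lemma card_signs: "card signs = (2 ^ N) ^ m" "finite signs"
  unfolding signs_def by (auto simp: card_PiE card_Pow intro: finite_PiE)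

text \<open>For fixed positions the increment at \<open>s j\<close> depends on \<open>D j\<close>
  only. The bad patterns thus lie in a product of m sets, each a fraction at most
  \<open>1 - 1 / (4 * 9 ^ d)\<close> of all sign choices.\<close>

lemma card_bad_le:
  assumes "\<omega> \<in> space R" "\<And>j. j < m \<Longrightarrow> \<omega> \<notin> weak j"
  shows "real (card {D\<in>signs. \<omega> \<in> bad D}) \<le> (1 - 1 / (4 * 9 ^ d)) ^ m * (2 ^ N) ^ m"
proof -
  define \<rho> :: real where "\<rho> = 1 - 1 / (4 * 9 ^ d)"
  have \<rho>: "0 \<le> \<rho>" using anticoncentration_rate_pos[of d] by (simp add: \<rho>_def)
  have "\<exists>u v. \<forall>i. (\<forall>D. curve m \<alpha> (x0 i) (\<lambda>k. curve_freq D l i k * s j) (\<omega> i) = u i + v i * sg (D j) i) \<and>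
      (v i)\<^sup>2 = (\<alpha> * sin (real (l j) * s j))\<^sup>2 * active_weight m j (\<omega> i)" if "j < m" for j
  proof -
    have "\<exists>u v. (\<forall>D. curve m \<alpha> (x0 i) (\<lambda>k. curve_freq D l i k * s j) (\<omega> i) = u + v * sg (D j) i) \<and>
        v\<^sup>2 = (\<alpha> * sin (real (l j) * s j))\<^sup>2 * active_weight m j (\<omega> i)" for i
      using curve_at_separating_time[OF that, where s = "s j" and \<alpha> = \<alpha> and ?x0.0 = "x0 i" and w = "\<omega> i" and i = i and l = l]
        sep[OF that] by metis
    then show ?thesis by metis
  qed
  then obtain u v where uv: "\<And>i j D. j < m \<Longrightarrow>
      curve m \<alpha> (x0 i) (\<lambda>k. curve_freq D l i k * s j) (\<omega> i) = u j i + v j i * sg (D j) i"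
    "\<And>i j. j < m \<Longrightarrow> (v j i)\<^sup>2 = (\<alpha> * sin (real (l j) * s j))\<^sup>2 * active_weight m j (\<omega> i)"
    by metis
  define B where "B j = {E\<in>Pow {1..N}. (hom_poly d N a (\<lambda>i. u j i + v j i * sg E i) - base \<omega>)\<^sup>2 \<le> s0 / 2}" for j
  have B: "real (card (B j)) \<le> \<rho> * 2 ^ N" if "j < m" for j
    unfolding B_def \<rho>_def
  proof (rule hom_poly_sign_anticoncentration[OF diag d1 s0(1)])
    define c where "c = (\<alpha> * sin (real (l j) * s j))\<^sup>2"
    have "s0 \<le> c ^ d * (\<mu> j ^ d / 2)" using s0(2)[OF that] by (simp add: c_def)
    also have "\<dots> \<le> c ^ d * (\<Sum>S\<in>ksets d N. (set_coeff a S)\<^sup>2 * (\<Prod>i\<in>S. active_weight m j (\<omega> i)))"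
      using assms(2)[OF that] assms(1) by (intro mult_left_mono) (auto simp: weak_def c_def)
    also have "\<dots> = (\<Sum>S\<in>ksets d N. (set_coeff a S)\<^sup>2 * (\<Prod>i\<in>S. (v j i)\<^sup>2))"
      unfolding sum_distrib_left
    proof (rule sum.cong[OF refl])
      fix S assume "S \<in> ksets d N"
      then have "(\<Prod>i\<in>S. (v j i)\<^sup>2) = c ^ d * (\<Prod>i\<in>S. active_weight m j (\<omega> i))"
        using ksetsD by (simp add: uv(2)[OF that] prod.distrib c_def)
      then show "c ^ d * ((set_coeff a S)\<^sup>2 * (\<Prod>i\<in>S. active_weight m j (\<omega> i))) = (set_coeff a S)\<^sup>2 * (\<Prod>i\<in>S. (v j i)\<^sup>2)"
        by simp
    qed
    finally show "s0 \<le> (\<Sum>S\<in>ksets d N. (set_coeff a S)\<^sup>2 * (\<Prod>i\<in>S. (v j i)\<^sup>2))" .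
  qed
  have "{D\<in>signs. \<omega> \<in> bad D} \<subseteq> PiE {..<m} B"
  proof
    fix D assume "D \<in> {D\<in>signs. \<omega> \<in> bad D}"
    then have D: "D \<in> PiE {..<m} (\<lambda>_. Pow {1..N})" "\<omega> \<in> bad D" by (auto simp: signs_def)
    have "D j \<in> B j" if "j < m" for j
      using D that uv(1)[OF that, of _ D] by (auto simp: B_def bad_def F_def)
    then show "D \<in> PiE {..<m} B" using D by (auto simp: PiE_def)
  qed
  moreover have "finite (PiE {..<m} B)" by (intro finite_PiE) (auto simp: B_def)
  ultimately have "card {D\<in>signs. \<omega> \<in> bad D} \<le> card (PiE {..<m} B)" by (intro card_mono)
  then have "real (card {D\<in>signs. \<omega> \<in> bad D}) \<le> (\<Prod>j<m. real (card (B j)))"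
    by (simp add: card_PiE flip: of_nat_prod)
  also have "\<dots> \<le> (\<Prod>j<m. \<rho> * 2 ^ N)" using B by (intro prod_mono) auto
  also have "\<dots> = \<rho> ^ m * (2 ^ N) ^ m" by (simp add: power_mult_distrib)
  finally show ?thesis unfolding \<rho>_def .
qed

lemma integral_indicator_R:
  assumes "A \<in> sets R"
  shows "integrable R (indicator A :: _ \<Rightarrow> real)" "(\<integral>\<omega>. indicator A \<omega> \<partial>R) = R.prob A"
  using assms by (auto simp: R.emeasure_eq_measure intro!: integrable_real_indicator)

text \<open>Exchange the sum over orientations with the expectation over positions. Where some
  annulus is weak, all patterns are counted as bad.\<close>

lemma sum_prob_bad:
  "(\<Sum>D\<in>signs. R.prob (bad D))
    \<le> (2 ^ N) ^ m * ((1 - 1 / (4 * 9 ^ d)) ^ m + (\<Sum>j<m. R.prob (weak j)))"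
proof -
  define \<rho> :: real where "\<rho> = 1 - 1 / (4 * 9 ^ d)"
  have "(\<Sum>D\<in>signs. R.prob (bad D)) = (\<integral>\<omega>. (\<Sum>D\<in>signs. indicator (bad D) \<omega>) \<partial>R)"
    using integral_indicator_R[OF sets_bad] by (subst Bochner_Integration.integral_sum) simp_all
  also have "\<dots> \<le> (\<integral>\<omega>. (2 ^ N) ^ m * (\<rho> ^ m + (\<Sum>j<m. indicator (weak j) \<omega>)) \<partial>R)"
  proof (rule integral_mono)
    fix \<omega> assume \<omega>: "\<omega> \<in> space R"
    have "(\<Sum>D\<in>signs. indicator (bad D) \<omega> :: real) = card {D\<in>signs. \<omega> \<in> bad D}"
      using card_signs(2) by (simp add: indicator_def sum.If_cases Int_def)
    also have "\<dots> \<le> (2 ^ N) ^ m * (\<rho> ^ m + (\<Sum>j<m. indicator (weak j) \<omega>))"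
    proof (cases "\<exists>j<m. \<omega> \<in> weak j")
      case True
      then obtain j where j: "j < m" "\<omega> \<in> weak j" by auto
      have one: "1 \<le> (\<Sum>j<m. indicator (weak j) \<omega> :: real)"
        using j member_le_sum[of j "{..<m}" "\<lambda>j. indicator (weak j) \<omega> :: real"] by auto
      have \<rho>: "0 \<le> \<rho> ^ m"
        using anticoncentration_rate_pos[of d] by (simp add: \<rho>_def)
      have "card {D\<in>signs. \<omega> \<in> bad D} \<le> (2 ^ N) ^ m"
        unfolding card_signs(1)[symmetric] using card_signs(2) by (intro card_mono) auto
      then have "real (card {D\<in>signs. \<omega> \<in> bad D}) \<le> (2 ^ N) ^ m * 1"
        by (simp only: mult_1_right flip: of_nat_le_iff[where 'a = real]) simp
      also have "\<dots> \<le> (2 ^ N) ^ m * (\<rho> ^ m + (\<Sum>j<m. indicator (weak j) \<omega>))"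
        using one \<rho> by (intro mult_left_mono) (linarith, simp)
      finally show ?thesis .
    next
      case False
      then have "(\<Sum>j<m. indicator (weak j) \<omega> :: real) = 0" by (intro sum.neutral) auto
      then show ?thesis using card_bad_le[OF \<omega>] False by (simp add: \<rho>_def mult.commute)
    qed
    finally show "(\<Sum>D\<in>signs. indicator (bad D) \<omega> :: real) \<le> (2 ^ N) ^ m * (\<rho> ^ m + (\<Sum>j<m. indicator (weak j) \<omega>))" .
  qed (use integral_indicator_R[OF sets_bad] integral_indicator_R[OF sets_weak] in auto)
  also have "\<dots> = (2 ^ N) ^ m * (\<rho> ^ m + (\<Sum>j<m. R.prob (weak j)))"
  proof -
    have "(\<integral>\<omega>. \<rho> ^ m + (\<Sum>j<m. indicator (weak j) \<omega>) \<partial>R) = \<rho> ^ m + (\<Sum>j<m. R.prob (weak j))"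
      using integral_indicator_R[OF sets_weak]
      by (subst Bochner_Integration.integral_add)
        (simp_all add: R.prob_space Bochner_Integration.integral_sum)
    then show ?thesis by simp
  qed
  finally show ?thesis unfolding \<rho>_def .
qed

abbreviation Q :: "'a \<Rightarrow> real" where
  "Q \<equiv> (\<lambda>x. hom_poly d N a (\<lambda>i. X i x))"

text \<open>The left side contains neither \<open>D\<close> nor \<open>t\<close>: the law is the
  same at every time and for every orientation.\<close>

lemma integral_Q:
  assumes g [measurable]: "g \<in> borel_measurable (borel :: real measure)"
  shows "(\<integral>x. g (Q x) \<partial>M) = (\<integral>\<omega>. (g (F D \<omega> t) :: real) \<partial>R)"
proof -
  have ne: "{1..N} \<noteq> {}" using N1 by simp
  let ?P = "PiM {1..N} (\<lambda>_. borel :: real measure)"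
  let ?Y = "\<lambda>i. curve m \<alpha> (x0 i) (\<lambda>k. curve_freq D l i k * t)"
  have Xm: "X i \<in> borel_measurable M" if "i \<in> {1..N}" for i
    using indep that by (auto simp: indep_vars_def2)
  have Ym: "?Y i \<in> borel_measurable (K i)" for i by measurable
  have m1: "(\<lambda>x. \<lambda>i\<in>{1..N}. X i x) \<in> M \<rightarrow>\<^sub>M ?P"
    using Xm by (intro measurable_restrict) auto
  have m2: "(\<lambda>\<omega>. \<lambda>i\<in>{1..N}. ?Y i (\<omega> i)) \<in> R \<rightarrow>\<^sub>M ?P"
    using Ym by (intro measurable_restrict measurable_compose[OF measurable_component_singleton]) auto
  have gm: "(\<lambda>x. g (hom_poly d N a x)) \<in> borel_measurable ?P"
    using measurable_hom_poly[OF diag] by measurable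
  have "(\<integral>x. g (Q x) \<partial>M) = (\<integral>x. g (hom_poly d N a x) \<partial>distr M ?P (\<lambda>x. \<lambda>i\<in>{1..N}. X i x))"
    by (subst integral_distr[OF m1 gm]) (simp add: hom_poly_restrict)
  also have "\<dots> = (\<integral>x. g (hom_poly d N a x) \<partial>distr R ?P (\<lambda>\<omega>. \<lambda>i\<in>{1..N}. ?Y i (\<omega> i)))"
    by (subst distr_PiM_coordinatewise[OF prob_space_axioms indep ne]) (use prob_space_K Ym law in auto)
  also have "\<dots> = (\<integral>\<omega>. g (F D \<omega> t) \<partial>R)"
    by (subst integral_distr[OF m2 gm]) (simp add: hom_poly_restrict F_def)
  finally show ?thesis .
qed

text \<open>As the law is constant in time, the difference equals its average over a period, and
  Fubini lets time be integrated first. Off the bad set the times \<open>s j\<close> and 0 witness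
  the oscillation; on it the trivial bound 2 over length 2 \<pi> gives 4 \<pi>.\<close>

lemma shift_estimate_signs:
  assumes h: "\<And>f u v. \<lbrakk>trig_poly (d * curve_trig_bound m l) f; u \<in> {0..2*pi}; v \<in> {0..2*pi}; sqrt (s0 / 2) \<le> \<bar>f u - f v\<bar>\<rbrakk>
      \<Longrightarrow> \<bar>LINT t:{0..2*pi}|lborel. \<phi> (f t) - \<phi> (f t + y)\<bar> \<le> e"
    and \<phi>: "continuous_on UNIV \<phi>" "\<And>x::real. \<bar>\<phi> x\<bar> \<le> (1::real)" and "e \<ge> 0"
  shows "\<bar>(\<integral>x. \<phi> (Q x) \<partial>M) - (\<integral>x. \<phi> (Q x + y) \<partial>M)\<bar> \<le> 2 * R.prob (bad D) + e / (2 * pi)"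
proof -
  have [measurable]: "\<phi> \<in> borel_measurable borel" by (intro borel_measurable_continuous_onI \<phi>)
  define c where "c = (\<integral>x. \<phi> (Q x) \<partial>M) - (\<integral>x. \<phi> (Q x + y) \<partial>M)"
  define G where "G \<omega> t = \<phi> (F D \<omega> t) - \<phi> (F D \<omega> t + y)" for \<omega> t
  have G2: "\<bar>G \<omega> t\<bar> \<le> 2" for \<omega> t
    using \<phi>(2)[of "F D \<omega> t"] \<phi>(2)[of "F D \<omega> t + y"] unfolding G_def by linarith
  have cG: "(\<integral>\<omega>. G \<omega> t \<partial>R) = c" for t
  proof -
    have "integrable R (\<lambda>\<omega>. \<phi> (F D \<omega> t))" "integrable R (\<lambda>\<omega>. \<phi> (F D \<omega> t + y))"
      by (rule R.integrable_const_bound[of _ 1]; use \<phi>(2) in auto)+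
    then show ?thesis
      unfolding G_def c_def using integral_Q[of \<phi> D t] integral_Q[of "\<lambda>x. \<phi> (x + y)" D t] by simp
  qed
  interpret P: pair_sigma_finite R lborel ..
  have Fm: "(\<lambda>z. F D (fst z) (snd z)) \<in> borel_measurable (R \<Otimes>\<^sub>M lborel)"
    using measurable_F[of D] by (simp add: split_beta' cong: measurable_cong_sets sets_pair_measure_cong)
  have Gm: "(\<lambda>z. G (fst z) (snd z)) \<in> borel_measurable (R \<Otimes>\<^sub>M lborel)"
    unfolding G_def using Fm by measurable
  let ?g = "\<lambda>(\<omega>, t). indicator {0..2*pi} t * G \<omega> t"
  have gm: "?g \<in> borel_measurable (R \<Otimes>\<^sub>M lborel)"
    unfolding split_beta' using Gm by measurable
  have gi: "integrable (R \<Otimes>\<^sub>M lborel) ?g"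
  proof (rule Bochner_Integration.integrable_bound)
    show "integrable (R \<Otimes>\<^sub>M lborel) (\<lambda>z. 2 * indicator (space R \<times> {0..2*pi}) z :: real)"
      by (intro integrable_mult_right integrable_real_indicator)
        (auto simp: lborel.emeasure_pair_measure_Times R.emeasure_space_1)
    show "AE z in R \<Otimes>\<^sub>M lborel. norm (?g z) \<le> norm (2 * indicator (space R \<times> {0..2*pi}) z :: real)"
      using G2 by (intro AE_I2) (auto simp: indicator_def space_pair_measure split: prod.split)
  qed (rule gm)
  define J where "J \<omega> = (\<integral>t. indicator {0..2*pi} t * G \<omega> t \<partial>lborel)" for \<omega>
  have "2 * pi * c = (\<integral>t. indicator {0..2*pi} t * c \<partial>lborel)" by simp
  also have "\<dots> = (\<integral>t. \<integral>\<omega>. indicator {0..2*pi} t * G \<omega> t \<partial>R \<partial>lborel)"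
    by (simp add: cG)
  also have "\<dots> = (\<integral>\<omega>. J \<omega> \<partial>R)"
    unfolding J_def by (rule P.Fubini_integral[OF gi])
  finally have J: "2 * pi * c = (\<integral>\<omega>. J \<omega> \<partial>R)" .
  have iJ: "integrable R J"
    unfolding J_def using P.integrable_fst[OF gi] by simp
  have Jb: "\<bar>J \<omega>\<bar> \<le> 4 * pi * indicator (bad D) \<omega> + e" if \<omega>: "\<omega> \<in> space R" for \<omega>
  proof (cases "\<omega> \<in> bad D")
    case True
    have mG: "(\<lambda>t. indicator {0..2*pi} t * G \<omega> t) \<in> borel_measurable lborel"
      using measurable_Pair2[OF gm \<omega>] by simp
    have i2: "integrable lborel (\<lambda>t. indicator {0..2*pi} t * 2 :: real)" by simp
    have "\<bar>J \<omega>\<bar> \<le> (\<integral>t. \<bar>indicator {0..2*pi} t * G \<omega> t\<bar> \<partial>lborel)"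
      unfolding J_def by (rule integral_abs_bound)
    also have "\<dots> \<le> (\<integral>t. indicator {0..2*pi} t * 2 \<partial>lborel)"
      using G2 mG by (intro integral_mono i2 integrable_abs Bochner_Integration.integrable_bound[OF i2])
        (auto simp: indicator_def)
    also have "\<dots> = 4 * pi" by simp
    finally show ?thesis using True \<open>e \<ge> 0\<close> by simp
  next
    case False
    then obtain j where j: "j < m" "\<not> (F D \<omega> (s j) - base \<omega>)\<^sup>2 \<le> s0 / 2"
      using \<omega> by (auto simp: bad_def)
    then have "sqrt (s0 / 2) \<le> sqrt ((F D \<omega> (s j) - F D \<omega> 0)\<^sup>2)"
      by (intro real_sqrt_le_mono) (simp add: F_0)
    then have "sqrt (s0 / 2) \<le> \<bar>F D \<omega> (s j) - F D \<omega> 0\<bar>" by simp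
    moreover have "trig_poly (d * curve_trig_bound m l) (F D \<omega>)"
      unfolding F_def by (rule trig_poly_hom_poly_curve[OF diag])
    ultimately have "\<bar>LINT t:{0..2*pi}|lborel. \<phi> (F D \<omega> t) - \<phi> (F D \<omega> t + y)\<bar> \<le> e"
      using s by (intro h) auto
    then show ?thesis using False by (simp add: J_def G_def set_lebesgue_integral_def)
  qed
  have "2 * pi * \<bar>c\<bar> = \<bar>\<integral>\<omega>. J \<omega> \<partial>R\<bar>" unfolding J[symmetric] by (simp add: abs_mult)
  also have "\<dots> \<le> (\<integral>\<omega>. \<bar>J \<omega>\<bar> \<partial>R)" by (rule integral_abs_bound)
  also have "\<dots> \<le> (\<integral>\<omega>. 4 * pi * indicator (bad D) \<omega> + e \<partial>R)"
    using Jb iJ integral_indicator_R[OF sets_bad] by (intro integral_mono) auto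
  also have "\<dots> = 4 * pi * R.prob (bad D) + e"
    using integral_indicator_R[OF sets_bad]
    by (subst Bochner_Integration.integral_add) (simp_all add: R.prob_space)
  also have "\<dots> = 2 * pi * (2 * R.prob (bad D) + e / (2 * pi))" by (simp add: algebra_simps)
  finally show ?thesis unfolding c_def[symmetric] by simp
qed

text \<open>The left side does not depend on the orientations, so it is bounded by the average over
  all patterns of the previous estimate.\<close>

lemma shift_estimate:
  assumes h: "\<And>f u v. \<lbrakk>trig_poly (d * curve_trig_bound m l) f; u \<in> {0..2*pi}; v \<in> {0..2*pi}; sqrt (s0 / 2) \<le> \<bar>f u - f v\<bar>\<rbrakk>
      \<Longrightarrow> \<bar>LINT t:{0..2*pi}|lborel. \<phi> (f t) - \<phi> (f t + y)\<bar> \<le> e"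
    and \<phi>: "continuous_on UNIV \<phi>" "\<And>x::real. \<bar>\<phi> x\<bar> \<le> (1::real)" and "e \<ge> 0"
  shows "\<bar>(\<integral>x. \<phi> (Q x) \<partial>M) - (\<integral>x. \<phi> (Q x + y) \<partial>M)\<bar>
    \<le> 2 * ((1 - 1 / (4 * 9 ^ d)) ^ m + (\<Sum>j<m. 4 * real d * t0 / (\<mu> j ^ d)\<^sup>2)) + e / (2 * pi)"
proof -
  let ?c = "\<bar>(\<integral>x. \<phi> (Q x) \<partial>M) - (\<integral>x. \<phi> (Q x + y) \<partial>M)\<bar>"
  let ?n = "(2 ^ N) ^ m :: real"
  have n: "?n > 0" by simp
  have "?n * ?c = (\<Sum>D\<in>signs. ?c)" using card_signs by simp
  also have "\<dots> \<le> (\<Sum>D\<in>signs. 2 * R.prob (bad D) + e / (2 * pi))"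
    by (intro sum_mono shift_estimate_signs h \<phi> \<open>e \<ge> 0\<close>)
  also have "\<dots> = 2 * (\<Sum>D\<in>signs. R.prob (bad D)) + ?n * (e / (2 * pi))"
    using card_signs by (simp add: sum.distrib sum_distrib_left)
  also have "\<dots> \<le> 2 * (?n * ((1 - 1 / (4 * 9 ^ d)) ^ m + (\<Sum>j<m. R.prob (weak j)))) + ?n * (e / (2 * pi))"
    using sum_prob_bad by simp
  also have "\<dots> \<le> 2 * (?n * ((1 - 1 / (4 * 9 ^ d)) ^ m + (\<Sum>j<m. 4 * real d * t0 / (\<mu> j ^ d)\<^sup>2))) + ?n * (e / (2 * pi))"
    by (intro add_mono mult_left_mono sum_mono prob_weak) auto
  also have "\<dots> = ?n * (2 * ((1 - 1 / (4 * 9 ^ d)) ^ m + (\<Sum>j<m. 4 * real d * t0 / (\<mu> j ^ d)\<^sup>2)) + e / (2 * pi))"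
    by (simp only: distrib_left mult.left_commute)
  finally show ?thesis by (rule mult_left_le_imp_le[OF _ n])
qed

end

section \<open>Total variation convergence of the sequence\<close>

lemma measurable_prod_list_map:
  assumes "\<And>i. i \<in> set ii \<Longrightarrow> X i \<in> borel_measurable M"
  shows "(\<lambda>\<omega>. prod_list (map (\<lambda>i. X i \<omega>) ii) :: real) \<in> borel_measurable M"
  using assms by (induction ii) auto

lemma tv_dist_tendsto_0:
  assumes "\<And>n. F n \<in> borel_measurable M" "W \<in> borel_measurable M'"
    and conv: "\<And>e. e > 0 \<Longrightarrow> \<exists>n0. \<forall>n\<ge>n0. \<forall>A\<in>sets borel.
      \<bar>measure (distr M borel (F n)) A - measure (distr M' borel W) A\<bar> \<le> e"
  shows "(\<lambda>n. tv_dist M (F n) M' W) \<longlonglongrightarrow> 0"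
proof (rule LIMSEQ_I)
  fix e :: real assume "e > 0"
  then obtain n0 where n0: "\<And>n A. n \<ge> n0 \<Longrightarrow> A \<in> sets borel \<Longrightarrow>
      \<bar>measure (distr M borel (F n)) A - measure (distr M' borel W) A\<bar> \<le> e / 2"
    using conv[of "e / 2"] by auto
  have "norm (tv_dist M (F n) M' W - 0) < e" if "n \<ge> n0" for n
  proof -
    let ?\<delta> = "\<lambda>A. \<bar>measure M (F n -` A \<inter> space M) - measure M' (W -` A \<inter> space M')\<bar>"
    have \<delta>: "?\<delta> A \<le> e / 2" if "A \<in> sets borel" for A
      using n0[OF \<open>n \<ge> n0\<close> that] assms(1,2) that by (simp add: measure_distr)
    have "0 = ?\<delta> {}" by simp
    also have "\<dots> \<le> tv_dist M (F n) M' W"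
      unfolding tv_dist_def using \<delta> by (intro cSUP_upper bdd_aboveI2[where M = "e / 2"]) auto
    finally have "0 \<le> tv_dist M (F n) M' W" .
    moreover have "tv_dist M (F n) M' W \<le> e / 2"
      unfolding tv_dist_def using \<delta> by (intro cSUP_least) auto
    ultimately show ?thesis using \<open>e > 0\<close> by simp
  qed
  then show "\<exists>n0. \<forall>n\<ge>n0. norm (tv_dist M (F n) M' W - 0) < e" by blast
qed

theorem corollary1p9:
  fixes d :: nat and N :: "nat \<Rightarrow> nat" and a :: "nat \<Rightarrow> nat list \<Rightarrow> real"
    and M :: "'a measure" and X :: "nat \<Rightarrow> 'a \<Rightarrow> real" and \<alpha> p \<epsilon> :: real
    and M' :: "'b measure" and W :: "'b \<Rightarrow> real"
  assumes "d \<ge> 2"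
    and "\<And>n. n \<ge> 1 \<Longrightarrow> N n > 0"
    and "filterlim N at_top sequentially"
    and "\<And>n. n \<ge> 1 \<Longrightarrow> symmetric_coeffs d (N n) (a n)"
    and "\<And>n. n \<ge> 1 \<Longrightarrow> vanishes_on_diagonals d (N n) (a n)"
    and "\<And>n. n \<ge> 1 \<Longrightarrow> fact d * (\<Sum>ii\<in>index_tuples d (N n). (a n ii)\<^sup>2) = 1"
    and "(\<lambda>n. MAX i\<in>{1..N n}. \<Sum>jj\<in>index_tuples (d - 1) (N n). (a n (i # jj))\<^sup>2) \<longlonglongrightarrow> 0"
    and "\<alpha> > 0" and "p > 0" and "p \<le> 1" and "\<epsilon> > 0"
    and "prob_space M"
    and "class_D M X \<alpha> p (2 + \<epsilon>)"
    and "prob_space M'"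
    and "W \<in> borel_measurable M'"
    and "weak_conv_m (\<lambda>n. distr M borel (\<lambda>\<omega>. hom_poly d (N n) (a n) (\<lambda>i. X i \<omega>))) (distr M' borel W)"
  shows "(\<exists>f. distributed M' lborel W f) \<and>
    (\<lambda>n. tv_dist M (\<lambda>\<omega>. hom_poly d (N n) (a n) (\<lambda>i. X i \<omega>)) M' W) \<longlonglongrightarrow> 0"
proof -
  interpret M: prob_space M by fact
  interpret M': prob_space M' by fact
  define F where "F n \<omega> = hom_poly d (N n) (a n) (\<lambda>i. X i \<omega>)" for n \<omega>
  have C: "class_C M p \<alpha> (X i)" if "i \<ge> 1" for i
    using assms(13) that by (auto simp: class_D_def)
  have indep: "M.indep_vars (\<lambda>_. borel) X {1..}"
    using assms(13) by (auto simp: class_D_def)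
  have Xm: "X i \<in> borel_measurable M" if "i \<ge> 1" for i
    using C[OF that] by (simp add: class_C_def)
  have Fm [measurable]: "F n \<in> borel_measurable M" for n
    unfolding F_def hom_poly_def
    by (intro borel_measurable_sum borel_measurable_times borel_measurable_const measurable_prod_list_map Xm)
       (auto simp: index_tuples_def)
  \<comment> \<open>\<open>max 1 i\<close> makes \<open>x0\<close> and \<tau> total, since nothing
    is known about \<open>X 0\<close>.\<close>
  have "\<exists>x0 \<tau>. prob_space \<tau> \<and> sets \<tau> = sets (borel \<Otimes>\<^sub>M borel) \<and> measure \<tau> {ev. fst ev = 1} = p \<and>
      (\<forall>m \<theta>. distr (square_law \<Otimes>\<^sub>M \<tau>) borel (curve m \<alpha> x0 \<theta>) = distr M borel (X (max 1 i)))" for i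
    using class_C_coupling[OF C[of "max 1 i"]] by (metis max.cobounded1)
  then obtain x0 :: "nat \<Rightarrow> real" and \<tau> :: "nat \<Rightarrow> (real \<times> real) measure" where
    \<tau>: "\<And>i. prob_space (\<tau> i)" "\<And>i. sets (\<tau> i) = sets (borel \<Otimes>\<^sub>M borel)" "\<And>i. measure (\<tau> i) {ev. fst ev = 1} = p"
    and law: "\<And>i m \<theta>. distr (square_law \<Otimes>\<^sub>M \<tau> i) borel (curve m \<alpha> (x0 i) \<theta>) = distr M borel (X (max 1 i))"
    by metis
  have smooth: "\<exists>h>0. \<exists>n0. \<forall>n\<ge>n0. \<forall>\<phi> y.
      continuous_on UNIV \<phi> \<longrightarrow> (\<forall>x::real. \<bar>\<phi> x\<bar> \<le> (1::real)) \<longrightarrow> \<bar>y\<bar> \<le> h \<longrightarrow>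
      \<bar>(\<integral>x. \<phi> x \<partial>distr M borel (F n)) - (\<integral>x. \<phi> (x + y) \<partial>distr M borel (F n))\<bar> \<le> e"
    if "e > 0" for e
  proof -
    define \<rho> :: real where "\<rho> = 1 - 1 / (4 * 9 ^ d)"
    have "\<rho> < 1" "\<rho> > 0" using anticoncentration_rate_pos[of d] by (simp_all add: \<rho>_def)
    \<comment> \<open>The budget: 2 (e / 8 + e / 4) for bad and weak samples, and (e \<pi> / 2) / (2
      \<pi>) = e / 4 for the time integral, in total e.\<close>
    then obtain m' where m': "\<rho> ^ m' < e / 8"
      using real_arch_pow_inv[of "e / 8" \<rho>] \<open>e > 0\<close> by auto
    \<comment> \<open>The successor guarantees an annulus, so the minimum \<open>s0\<close> is over
      a nonempty set.\<close>
    define m where "m = Suc m'"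
    have "\<rho> ^ m \<le> \<rho> ^ m'"
      unfolding m_def using \<open>\<rho> < 1\<close> \<open>\<rho> > 0\<close> by (intro power_decreasing) auto
    then have m: "\<rho> ^ m \<le> e / 8" "m \<ge> 1"
      using m' by (simp_all add: m_def)
    obtain l s where s: "\<And>j. s j \<in> {0..2*pi}" and sin: "\<And>j. j < m \<Longrightarrow> sin (real (l j) * s j) \<noteq> 0"
      and sep: "\<And>j k. \<lbrakk>j < m; k < m; j \<noteq> k\<rbrakk> \<Longrightarrow> cos (real (l k) * s j) = 1 \<and> sin (real (l k) * s j) = 0"
      using separating_frequencies[of m] by metis
    define \<mu> where "\<mu> j = p * (\<integral>z. (if annulus m z = j then (snd z)\<^sup>2 else 0) \<partial>square_law)" for j
    have \<mu>: "\<mu> j > 0" if "j < m" for j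
      unfolding \<mu>_def using annulus_second_moment_pos[OF that] \<open>p > 0\<close> by simp
    define b where "b j = ((\<alpha> * sin (real (l j) * s j))\<^sup>2) ^ d * (\<mu> j ^ d / 2)" for j
    have b: "b j > 0" if "j < m" for j
      using \<mu>[OF that] sin[OF that] \<open>\<alpha> > 0\<close> by (simp add: b_def)
    define s0 where "s0 = Min (b ` {..<m})"
    have "s0 \<in> b ` {..<m}" unfolding s0_def using m(2) by (intro Min_in) (auto simp: lessThan_empty_iff)
    then have s0: "s0 > 0" using b by auto
    have s0b: "s0 \<le> b j" if "j < m" for j unfolding s0_def using that by (intro Min_le) auto
    have pos: "sqrt (s0 / 2) > 0" "e * pi / 2 > 0" using s0 \<open>e > 0\<close> by simp_all
    obtain h where h: "h > 0" and
      hsm: "\<And>f u v (\<phi> :: real \<Rightarrow> real) y. \<lbrakk>trig_poly (d * curve_trig_bound m l) f; u \<in> {0..2*pi}; v \<in> {0..2*pi};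
        sqrt (s0 / 2) \<le> \<bar>f u - f v\<bar>; continuous_on UNIV \<phi>; \<And>x. \<bar>\<phi> x\<bar> \<le> 1; \<bar>y\<bar> \<le> h\<rbrakk>
        \<Longrightarrow> \<bar>LINT t:{0..2*pi}|lborel. \<phi> (f t) - \<phi> (f t + y)\<bar> \<le> e * pi / 2"
    proof (rule trig_poly_shift_smooth[OF pos, of "d * curve_trig_bound m l"], goal_cases)
      case (1 h)
      show ?case by (rule 1(1)[OF 1(2)]) (rule 1(3))
    qed
    \<comment> \<open>The influence bound of \<open>influence_le\<close>. It tends to 0 while m,
      \<mu> and \<open>s0\<close> are fixed, and so does the total probability \<open>c n\<close>
      allowed to weak annuli.\<close>
    define T where "T n = (fact d)\<^sup>2 * (MAX i\<in>{1..N n}. \<Sum>jj\<in>index_tuples (d - 1) (N n). (a n (i # jj))\<^sup>2)" for n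
    define c where "c n = (\<Sum>j<m. 4 * real d * T n / (\<mu> j ^ d)\<^sup>2)" for n
    have "T \<longlonglongrightarrow> (fact d)\<^sup>2 * 0" unfolding T_def by (intro tendsto_mult tendsto_const assms(7))
    then have "c \<longlonglongrightarrow> (\<Sum>j<m. 4 * real d * ((fact d)\<^sup>2 * 0) / (\<mu> j ^ d)\<^sup>2)"
      unfolding c_def using \<mu> by (intro tendsto_sum tendsto_divide tendsto_mult tendsto_const) fastforce+
    then have "c \<longlonglongrightarrow> 0" by simp
    then have "\<forall>\<^sub>F n in sequentially. c n < e / 4" using \<open>e > 0\<close> by (intro order_tendstoD) auto
    then obtain n0 where n0: "\<And>n. n \<ge> n0 \<Longrightarrow> c n < e / 4" unfolding eventually_sequentially by blast
    have "\<bar>(\<integral>x. \<phi> x \<partial>distr M borel (F n)) - (\<integral>x. \<phi> (x + y) \<partial>distr M borel (F n))\<bar> \<le> e"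
      if n: "n \<ge> max 1 n0" and \<phi>: "continuous_on UNIV \<phi>" "\<And>x. \<bar>\<phi> x\<bar> \<le> 1" and y: "\<bar>y\<bar> \<le> h"
      for n y and \<phi> :: "real \<Rightarrow> real"
    proof -
      have n1: "n \<ge> 1" and cn: "c n < e / 4" using n n0 by auto
      interpret chaos: coupled_chaos M d "N n" m "a n" X \<alpha> x0 \<tau> l s \<mu> "T n" s0
      proof (intro coupled_chaos.intro coupled_chaos_axioms.intro)
        show "1 \<le> d" using \<open>d \<ge> 2\<close> by simp
        show "1 \<le> N n" using assms(2)[OF n1] by simp
        show "vanishes_on_diagonals d (N n) (a n)"
          by (rule assms(5)[OF n1])
        show "(\<Sum>S\<in>ksets d (N n). (set_coeff (a n) S)\<^sup>2) = 1"
          using sum_set_coeff_sq[OF assms(4,5)[OF n1]] assms(6)[OF n1] by simp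
        show "(\<Sum>S\<in>{S\<in>ksets d (N n). i \<in> S}. (set_coeff (a n) S)\<^sup>2) \<le> T n" if "i \<in> {1..N n}" for i
        proof (rule order_trans[OF influence_le[OF assms(4)[OF n1]]])
          show "(fact d)\<^sup>2 * (\<Sum>jj\<in>index_tuples (d - 1) (N n). (a n (i # jj))\<^sup>2) \<le> T n"
            unfolding T_def using that by (intro mult_left_mono Max_ge) auto
        qed
        show "M.indep_vars (\<lambda>_. borel) X {1..N n}"
          by (rule M.indep_vars_subset[OF indep]) auto
        show "distr (square_law \<Otimes>\<^sub>M \<tau> i) borel (curve m \<alpha> (x0 i) \<theta>) = distr M borel (X i)" if "i \<in> {1..N n}" for i \<theta>
          using law[of i m \<theta>] that by (simp add: max_absorb2)
        show "(\<integral>w. active_weight m j w \<partial>(square_law \<Otimes>\<^sub>M \<tau> i)) = \<mu> j" if "j < m" for i j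
          using integral_active_weight[OF \<tau>(1,2) that] \<tau>(3) by (simp add: \<mu>_def)
        show "s0 \<le> ((\<alpha> * sin (real (l j) * s j))\<^sup>2) ^ d * (\<mu> j ^ d / 2)" if "j < m" for j
          using s0b[OF that] by (simp add: b_def)
        show "cos (real (l k) * s j) = 1 \<and> sin (real (l k) * s j) = 0" if "j < m" "k < m" "j \<noteq> k" for j k
          by (rule sep[OF that])
      qed (rule assms(12) \<tau>(1) \<tau>(2) s s0 | erule \<mu>)+
      have [measurable]: "\<phi> \<in> borel_measurable borel" by (intro borel_measurable_continuous_onI \<phi>)
      have "\<bar>(\<integral>x. \<phi> x \<partial>distr M borel (F n)) - (\<integral>x. \<phi> (x + y) \<partial>distr M borel (F n))\<bar>
        = \<bar>(\<integral>x. \<phi> (F n x) \<partial>M) - (\<integral>x. \<phi> (F n x + y) \<partial>M)\<bar>"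
        by (simp add: integral_distr)
      also have "\<dots> \<le> 2 * (\<rho> ^ m + c n) + (e * pi / 2) / (2 * pi)"
        unfolding F_def \<rho>_def c_def
        by (rule chaos.shift_estimate[OF hsm]) (use \<phi> y \<open>e > 0\<close> in auto)
      also have "\<dots> \<le> e" using m(1) cn by simp
      finally show ?thesis .
    qed
    then show ?thesis using h by blast
  qed
  have dist: "real_distribution (distr M borel (F n))" "real_distribution (distr M' borel W)" for n
    using assms(15) by (auto intro: M.real_distribution_distr M'.real_distribution_distr)
  have conv: "weak_conv_m (\<lambda>n. distr M borel (F n)) (distr M' borel W)"
    using assms(16) unfolding F_def .
  note tv = tv_conv_of_shift_smooth[OF dist conv smooth]
  \<comment> \<open>The density comes from absolute continuity through Radon-Nikodym.\<close>
  have "\<exists>f\<in>borel_measurable lborel. density lborel f = distr M' borel W"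
    using tv(2) by (intro sigma_finite_measure.Radon_Nikodym sigma_finite_lborel) auto
  then obtain f where "f \<in> borel_measurable lborel" "density lborel f = distr M' borel W" by blast
  then have "distributed M' lborel W f"
    using assms(15) unfolding distributed_def by (auto intro: distr_cong)
  moreover have "(\<lambda>n. tv_dist M (F n) M' W) \<longlonglongrightarrow> 0"
    by (rule tv_dist_tendsto_0) (use assms(15) tv(1) in auto)
  ultimately show ?thesis unfolding F_def by blast
qed

end
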